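(* Let $\mu\subseteq\lambda$ be partitions and $r\ge0$. Then \[ P_{\lambda/\mu}\, q_r=\sum_{\lambda^+,\mu^-,\nu}(-1)^{|\mu/\mu^-|}(-t)^{|\nu/\mu^-|}\,\mathrm{hs}_{\lambda^+/\lambda}(t)\,\mathrm{vs}_{\mu/\nu}(t)\,\mathrm{sk}_{\nu/\mu^-}(t)\,P_{\lambda^+/\mu^-}, \] where the sum is over all partitions $\lambda^+\supseteq\lambda$ and $\mu^-\subseteq\nu\subseteq\mu$ with $|\lambda^+/\lambda|+|\mu/\mu^-|=r$.
   Context: $\Lambda[t]$ is the ring of symmetric functions over $\mathbb{Q}(t)$, $P_\lambda=P_\lambda(t)$ are Hall--Littlewood functions, and $q_r=(1-t)P_{(r)}$ for $r>0$, $q_0=1$. Let $Q_\lambda=b_\lambda(t)P_\lambda$ with $b_\lambda(t)=\prod_{i\ge1}(1-t)(1-t^2)\cdots(1-t^{m_i(\lambda)})$, and let $\langle\cdot,\cdot\rangle$ be the scalar product with $\langle P_\lambda,Q_\mu\rangle=\delta_{\lambda\mu}$. For $\mu\subseteq\lambda$, $P_{\lambda/\mu}$ is the unique element with $\langle P_{\lambda/\mu},Q_\nu\rangle=\langle P_\lambda,Q_\nu Q_\mu\rangle$ for all $\nu$. Notation: $\lambda^c$ conjugate partition, $m_j(\lambda)$ number of parts equal to $j$, $|\lambda/\mu|=|\lambda|-|\mu|$, $\begin{bmatrix} a\\ b\end{bmatrix}_t=\frac{(1-t^a)\cdots(1-t^{a-b+1})}{(1-t^b)\cdots(1-t)}$.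 $\lambda/\mu$ is a horizontal strip if $\lambda^c_j\le\mu^c_j+1$ for all $j$, and a vertical strip if $\lambda_i\le\mu_i+1$ for all $i$. Define $\mathrm{hs}_{\lambda/\mu}(t)=\prod_{j:\ \lambda^c_j=\mu^c_j+1,\ \lambda^c_{j+1}=\mu^c_{j+1}}(1-t^{m_j(\lambda)})$ if $\lambda/\mu$ is a horizontal strip and $0$ otherwise; $\mathrm{vs}_{\lambda/\mu}(t)=\prod_{j\ge1}\begin{bmatrix}\lambda^c_j-\lambda^c_{j+1}\\ \lambda^c_j-\mu^c_j\end{bmatrix}_t$ if $\lambda/\mu$ is a vertical strip and $0$ otherwise; and for any $\mu\subseteq\lambda$, $\mathrm{sk}_{\lambda/\mu}(t)=t^{\sum_j\binom{\lambda^c_j-\mu^c_j}{2}}\prod_{j\ge1}\begin{bmatrix}\lambda^c_j-\mu^c_{j+1}\\ m_j(\mu)\end{bmatrix}_t$. *)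

theory Defs
  imports "HOL-Library.Poly_Mapping" "HOL-Library.Multiset"
          "HOL-Computational_Algebra.Polynomial" "HOL-Computational_Algebra.Fraction_Field"
begin

type_synonym coef = "rat poly fract"

definition tt :: coef where "tt = Fract [:0, 1:] 1"

text \<open>An element is a finitely supported map from multisets (the power-sum index rho,
  p_rho = p_{rho_1} p_{rho_2} ...) to coefficients; multiplication is convolution, i.e.
  p_rho p_sigma = p_{rho + sigma}. Lambda[t] is the subring of elements supported on
  multisets of positive integers.\<close>

type_synonym sym = "nat multiset \<Rightarrow>\<^sub>0 coef"

definition in_Lambda :: "sym \<Rightarrow> bool" where
  "in_Lambda f \<longleftrightarrow> (\<forall>M\<in>Poly_Mapping.keys f. 0 \<notin># M)"

definition homog :: "nat \<Rightarrow> sym \<Rightarrow> bool" where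
  "homog n f \<longleftrightarrow> in_Lambda f \<and> (\<forall>M\<in>Poly_Mapping.keys f. sum_mset M = n)"

definition cst :: "coef \<Rightarrow> sym" where
  "cst a = Poly_Mapping.single {#} a"

definition is_partition :: "nat list \<Rightarrow> bool" where
  "is_partition l \<longleftrightarrow> sorted_wrt (\<ge>) l \<and> 0 \<notin> set l"

definition partitions_of :: "nat \<Rightarrow> nat list set" where
  "partitions_of n = {l. is_partition l \<and> sum_list l = n}"

definition part :: "nat list \<Rightarrow> nat \<Rightarrow> nat" where
  "part l i = (if 1 \<le> i \<and> i \<le> length l then l ! (i - 1) else 0)"

definition psize :: "nat list \<Rightarrow> nat" where "psize l = sum_list l"

definition conj :: "nat list \<Rightarrow> nat \<Rightarrow> nat" where
  "conj l j = length (filter (\<lambda>x. j \<le> x) l)"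

definition mult :: "nat list \<Rightarrow> nat \<Rightarrow> nat" where
  "mult l j = count_list l j"

definition contained :: "nat list \<Rightarrow> nat list \<Rightarrow> bool" where
  "contained mu lam \<longleftrightarrow> (\<forall>i. part mu i \<le> part lam i)"

definition dominated :: "nat list \<Rightarrow> nat list \<Rightarrow> bool" where
  "dominated mu lam \<longleftrightarrow> (\<forall>k. sum_list (take k mu) \<le> sum_list (take k lam))"

definition z0 :: "nat multiset \<Rightarrow> nat" where
  "z0 M = (\<Prod>i\<in>set_mset M. i ^ count M i * fact (count M i))"

definition zt :: "nat multiset \<Rightarrow> coef" where
  "zt M = of_nat (z0 M) / (\<Prod>x\<in>#M. (1 - tt ^ x))"

definition hl_inner :: "sym \<Rightarrow> sym \<Rightarrow> coef" where
  "hl_inner f g = (\<Sum>M\<in>Poly_Mapping.keys f. Poly_Mapping.lookup f M * Poly_Mapping.lookup g M * zt M)"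

definition hall_inner :: "sym \<Rightarrow> sym \<Rightarrow> coef" where
  "hall_inner f g = (\<Sum>M\<in>Poly_Mapping.keys f. Poly_Mapping.lookup f M * Poly_Mapping.lookup g M * of_nat (z0 M))"

definition hcomp :: "nat \<Rightarrow> sym" where
  "hcomp n = (\<Sum>rho\<in>partitions_of n. Poly_Mapping.single (mset rho) (1 / of_nat (z0 (mset rho))))"

definition hprod :: "nat list \<Rightarrow> sym" where
  "hprod mu = prod_list (map hcomp mu)"

definition mono :: "nat list \<Rightarrow> sym" where
  "mono lam = (THE f. homog (psize lam) f \<and>
     (\<forall>mu\<in>partitions_of (psize lam). hall_inner f (hprod mu) = (if mu = lam then 1 else 0)))"

text \<open>Characterisation (Macdonald III.2): P_lambda = m_lambda + sum_{mu < lambda} u m_mu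
  (dominance), and <P_lambda, P_mu> = 0 for lambda \<noteq> mu.\<close>
definition HLP_family :: "nat list \<Rightarrow> sym" where
  "HLP_family = (THE P.
     (\<forall>lam. is_partition lam \<longrightarrow>
        (\<exists>c. P lam = mono lam +
           (\<Sum>mu\<in>{mu\<in>partitions_of (psize lam). dominated mu lam \<and> mu \<noteq> lam}. cst (c mu) * mono mu)))
   \<and> (\<forall>lam mu. is_partition lam \<and> is_partition mu \<and> lam \<noteq> mu \<longrightarrow> hl_inner (P lam) (P mu) = 0)
   \<and> (\<forall>lam. \<not> is_partition lam \<longrightarrow> P lam = 0))"

definition HLP :: "nat list \<Rightarrow> sym" where "HLP lam = HLP_family lam"

definition bfac :: "nat list \<Rightarrow> coef" where
  "bfac lam = (\<Prod>i\<in>set lam. \<Prod>k\<in>{1..mult lam i}. (1 - tt ^ k))"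

definition HLQ :: "nat list \<Rightarrow> sym" where "HLQ lam = cst (bfac lam) * HLP lam"

definition qr :: "nat \<Rightarrow> sym" where
  "qr r = (if r = 0 then 1 else cst (1 - tt) * HLP [r])"

definition skewP :: "nat list \<Rightarrow> nat list \<Rightarrow> sym" where
  "skewP lam mu = (THE f. in_Lambda f \<and>
     (\<forall>nu. is_partition nu \<longrightarrow> hl_inner f (HLQ nu) = hl_inner (HLP lam) (HLQ nu * HLQ mu)))"

definition qbin :: "nat \<Rightarrow> nat \<Rightarrow> coef" where
  "qbin a b = (\<Prod>i<b. (1 - tt ^ (a - i))) / (\<Prod>i\<in>{1..b}. (1 - tt ^ i))"

definition horiz_strip :: "nat list \<Rightarrow> nat list \<Rightarrow> bool" where
  "horiz_strip lam mu \<longleftrightarrow> (\<forall>j\<ge>1. conj lam j \<le> conj mu j + 1)"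

definition vert_strip :: "nat list \<Rightarrow> nat list \<Rightarrow> bool" where
  "vert_strip lam mu \<longleftrightarrow> (\<forall>i\<ge>1. part lam i \<le> part mu i + 1)"

text \<open>products over j >= 1 are finite: all factors with j > lambda_1 equal 1\<close>
definition hs :: "nat list \<Rightarrow> nat list \<Rightarrow> coef" where
  "hs lam mu = (if horiz_strip lam mu then
     (\<Prod>j\<in>{j\<in>{1..part lam 1}. conj lam j = conj mu j + 1 \<and> conj lam (j+1) = conj mu (j+1)}.
        (1 - tt ^ mult lam j))
   else 0)"

definition vs :: "nat list \<Rightarrow> nat list \<Rightarrow> coef" where
  "vs lam mu = (if vert_strip lam mu then
     (\<Prod>j\<in>{1..part lam 1}. qbin (conj lam j - conj lam (j+1)) (conj lam j - conj mu j))
   else 0)"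

definition sk :: "nat list \<Rightarrow> nat list \<Rightarrow> coef" where
  "sk lam mu = tt ^ (\<Sum>j\<in>{1..part lam 1}. (conj lam j - conj mu j) choose 2) *
     (\<Prod>j\<in>{1..part lam 1}. qbin (conj lam j - conj mu (j+1)) (mult mu j))"

end

(*
  Multiplication by the group-like series q(u) = sum_r q_r u^r satisfies
  q(u) (f^perp g) = ((q(u)^perp)^(-1) f)^perp (q(u) g), where ^perp is the adjoint for the scalar
  product. For f = Q_mu and g = P_lambda the theorem follows from the Pieri rule for q_r and from
  the expansion of (q(u)^perp)^(-1) Q_mu. As q(u)^(-1) = E(-u) H(tu), the latter is the product of
  the adjoint Pieri rules for e_r (coefficients vs) and h_r (coefficients sk).

  Only the rule for e_r needs an idea specific to Hall-Littlewood functions: for Jing's vertex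
  operators B_m, Q_lambda = B_{lambda_1} B_{lambda_2} ... 1, the adjoint of E(-u) maps B_m to
  B_m - u B_{m-1}, and the relation B_{m-1} B_m = t B_m B_{m-1} turns the words arising from a block
  of equal parts into q-binomial coefficients. The rules for h_r and q_r then come from
  H(u) E(-u) = 1 and q(u) = E(-tu) H(u): in a sum over nu of vs_{lambda/nu} sk_{nu/mu} the columns
  of nu vary independently, so the sum is a product over columns of q-binomial sums.

  That the Q_lambda so constructed are b_lambda times the P_lambda of the definitions is seen from
  two triangularities with respect to dominance: the dual basis P of Q is triangular with respect to
  the e_{lambda'} (by the rule for e_r), b_lambda P_lambda is triangular with respect to the q_lambda
  (by the rule for q_r), and the scalar product of e_{lambda'} and q_mu vanishes unless mu <= lambda.
*)
theory Submission
  imports Defs "HOL-Library.FuncSet"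
begin

section \<open>The coefficient field and power sums\<close>

text \<open>The first identity of the overview holds because q(u)^perp is a ring homomorphism, the
  substitution p_n -> p_n + u^n. Its inverse substitutes p_n - u^n, so f (q(u)^perp h) = q(u)^perp
  (((q(u)^perp)^(-1) f) h); pairing with g and moving q(u)^perp across the scalar product gives the
  identity. It bears on skew functions because P_{lambda/mu} is Q_mu^perp P_lambda. Lambda is given
  by power sums, without variables, so no symmetrization formula for P_lambda is at hand. Vertex
  operators take its place: they are made of multiplications by q_r and of substitutions. Monomial,
  Hall-Littlewood and skew functions are all defined by \<open>THE\<close>, so for each of them
  existence and uniqueness come before any computation. The functions built from vertex operators
  and their dual basis give existence; nondegeneracy of the pairings and triangularity give
  uniqueness.\<close>

instance fract :: ("{idom, ring_char_0}") field_char_0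
proof
  show "inj (of_nat :: nat \<Rightarrow> 'a fract)"
    by (auto intro!: injI simp: of_nat_fract eq_fract)
qed

lemma tt_power: "tt ^ n = Fract (monom 1 n) 1"
proof (induction n)
  case (Suc n)
  have "tt ^ Suc n = Fract ([:0, 1:] * monom 1 n) (1 * 1)"
    unfolding power_Suc Suc.IH by (simp only: tt_def mult_fract)
  also have "[:0, 1:] * monom 1 n = (monom 1 (Suc n) :: rat poly)"
    by (simp add: monom_Suc)
  finally show ?case by simp
qed (simp add: One_fract_def)

text \<open>Distinct powers of t have distinct degrees, so t has no finite order. This makes the
  denominators in the scalar product and in the adjoint operators invertible.\<close>

lemma one_minus_tt_power: "n \<ge> 1 \<Longrightarrow> 1 - tt ^ n \<noteq> 0"
proof
  assume "n \<ge> 1" "1 - tt ^ n = 0"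
  then have "tt ^ n = 1" by simp
  then have "Fract 1 1 = Fract (monom (1::rat) n) 1"
    by (simp only: tt_power One_fract_def)
  then have "(1::rat poly) = monom 1 n" by (simp add: eq_fract)
  then have "degree (1::rat poly) = degree (monom (1::rat) n)" by simp
  then show False using \<open>n \<ge> 1\<close> by (simp add: degree_monom_eq)
qed

lemma cst_add: "cst (a + b) = cst a + cst b"
  and cst_mult: "cst (a * b) = cst a * cst b"
  and cst_diff: "cst (a - b) = cst a - cst b"
  and cst_minus: "cst (- a) = - cst a"
  and cst_0 [simp]: "cst 0 = 0"
  and cst_1 [simp]: "cst 1 = 1"
  by (simp_all add: cst_def single_add mult_single single_diff single_uminus)

lemma cst_of_nat: "cst (of_nat n) = of_nat n"
  by (simp add: cst_def single_of_nat)

lemma cst_sum: "cst (sum f A) = (\<Sum>x\<in>A. cst (f x))"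
  by (induction A rule: infinite_finite_induct) (simp_all add: cst_add)

lemma cst_cancel: "a \<noteq> 0 \<Longrightarrow> cst a * x = cst a * y \<Longrightarrow> x = y"
proof -
  assume a: "a \<noteq> 0" and "cst a * x = cst a * y"
  then have "cst (1 / a) * (cst a * x) = cst (1 / a) * (cst a * y)" by simp
  then show ?thesis using a by (simp add: mult.assoc [symmetric] cst_mult [symmetric])
qed

text \<open>The recursions for coefficients of u^r have the form r X_r = ...; both sides of a claim
  are compared after multiplication by r, and the factor is removed by this rule, which rests on
  characteristic zero.\<close>

lemma of_nat_cancel: "n \<noteq> 0 \<Longrightarrow> of_nat n * (x::sym) = of_nat n * y \<Longrightarrow> x = y"
  using cst_cancel [of "of_nat n" x y] by (simp add: cst_of_nat)

lemma lookup_cst_mult [simp]: "Poly_Mapping.lookup (cst a * f) M = a * Poly_Mapping.lookup f M"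
  by (simp add: cst_def mult_map_scale_conv_mult [symmetric] map.rep_eq when_def)

section \<open>The power sum basis and linear maps\<close>

definition pm :: "nat multiset \<Rightarrow> sym" where
  "pm M = Poly_Mapping.single M 1"

abbreviation pw :: "nat \<Rightarrow> sym" where
  "pw n \<equiv> pm {#n#}"

lemma pm_empty [simp]: "pm {#} = 1"
  by (simp add: pm_def)

lemma pm_add: "pm (M + N) = pm M * pm N"
  by (simp add: pm_def mult_single)

lemma pm_add_mset: "pm (add_mset n M) = pw n * pm M"
  using pm_add [of "{#n#}" M] by simp

lemma lookup_pm: "Poly_Mapping.lookup (pm M) N = (if M = N then 1 else 0)"
  by (simp add: pm_def lookup_single when_def)

lemma sym_expand_superset:
  assumes "finite A" "Poly_Mapping.keys f \<subseteq> A"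
  shows "f = (\<Sum>M\<in>A. cst (Poly_Mapping.lookup f M) * pm M)"
proof (rule poly_mapping_eqI)
  fix N
  have "(\<Sum>M\<in>A. Poly_Mapping.lookup (cst (Poly_Mapping.lookup f M) * pm M) N) =
    (\<Sum>M\<in>A. if M = N then Poly_Mapping.lookup f M else 0)"
    by (rule sum.cong) (auto simp: lookup_pm)
  also have "\<dots> = Poly_Mapping.lookup f N"
    using assms by (auto simp: in_keys_iff)
  finally show "Poly_Mapping.lookup f N =
      Poly_Mapping.lookup (\<Sum>M\<in>A. cst (Poly_Mapping.lookup f M) * pm M) N"
    by (simp add: lookup_sum)
qed

lemmas sym_expand = sym_expand_superset [OF finite_keys subset_refl]

lemma sym_induct [case_names mono add]:
  assumes "\<And>a M. P (cst a * pm M)" and "\<And>f g. P f \<Longrightarrow> P g \<Longrightarrow> P (f + g)"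
  shows "P f"
proof -
  have "P 0" using assms(1)[of 0] by simp
  have "finite A \<Longrightarrow> P (\<Sum>M\<in>A. cst (Poly_Mapping.lookup f M) * pm M)" for A
    by (induction A rule: finite_induct) (use \<open>P 0\<close> assms in auto)
  from this [OF finite_keys, of f] show ?thesis
    by (simp only: sym_expand [symmetric])
qed

text \<open>Scalars act through \<open>cst\<close>, so the rules for spans in vector spaces apply;
  the triangularity statements between families are phrased with them.\<close>

interpretation sv: vector_space "\<lambda>a f. cst a * (f::sym)"
  by standard (simp_all add: cst_add cst_mult algebra_simps)

definition lin :: "(sym \<Rightarrow> sym) \<Rightarrow> bool" where
  "lin F \<longleftrightarrow> (\<forall>f g. F (f + g) = F f + F g) \<and> (\<forall>a f. F (cst a * f) = cst a * F f)"

lemma linI: "(\<And>f g. F (f + g) = F f + F g) \<Longrightarrow> (\<And>a f. F (cst a * f) = cst a * F f) \<Longrightarrow> lin F"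
  by (simp add: lin_def)

lemma lin_add: "lin F \<Longrightarrow> F (f + g) = F f + F g"
  and lin_cst: "lin F \<Longrightarrow> F (cst a * f) = cst a * F f"
  by (simp_all add: lin_def)

lemma lin_0: "lin F \<Longrightarrow> F 0 = 0"
  using lin_cst [of F 0 0] by simp

lemma lin_sum: "lin F \<Longrightarrow> F (\<Sum>x\<in>A. f x) = (\<Sum>x\<in>A. F (f x))"
  by (induction A rule: infinite_finite_induct) (simp_all add: lin_0 lin_add)

lemma lin_of_nat: "lin F \<Longrightarrow> F (of_nat n * f) = of_nat n * F f"
  using lin_cst [of F "of_nat n" f] by (simp add: cst_of_nat)

lemma lin_cong: "lin F \<Longrightarrow> lin G \<Longrightarrow> (\<And>M. F (pm M) = G (pm M)) \<Longrightarrow> F f = G f"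
  by (induction f rule: sym_induct) (simp_all add: lin_add lin_cst)

lemma lin_mult: "lin F \<Longrightarrow> lin (\<lambda>f. g * F f)"
  by (simp add: lin_def algebra_simps)

lemma lin_comp: "lin F \<Longrightarrow> lin G \<Longrightarrow> lin (\<lambda>f. F (G f))"
  by (simp add: lin_def)

lemma lin_sumf: "(\<And>x. x \<in> A \<Longrightarrow> lin (F x)) \<Longrightarrow> lin (\<lambda>f. \<Sum>x\<in>A. F x f)"
  by (simp add: lin_def sum.distrib sum_distrib_left)

lemma lin_funpow: "lin F \<Longrightarrow> lin (F ^^ n)"
  by (induction n) (simp_all add: lin_def)

text \<open>The linear map with prescribed values on the power sum products.\<close>

definition lext :: "(nat multiset \<Rightarrow> sym) \<Rightarrow> sym \<Rightarrow> sym" where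
  "lext F f = (\<Sum>M\<in>Poly_Mapping.keys f. cst (Poly_Mapping.lookup f M) * F M)"

lemma lext_superset:
  assumes "finite A" "Poly_Mapping.keys f \<subseteq> A"
  shows "lext F f = (\<Sum>M\<in>A. cst (Poly_Mapping.lookup f M) * F M)"
  unfolding lext_def by (rule sum.mono_neutral_left) (use assms in \<open>auto simp: in_keys_iff\<close>)

lemma lin_lext: "lin (lext F)"
proof (rule linI)
  fix f g :: sym and a
  let ?A = "Poly_Mapping.keys f \<union> Poly_Mapping.keys g"
  have "lext F (f + g) = (\<Sum>M\<in>?A. cst (Poly_Mapping.lookup (f + g) M) * F M)"
    by (rule lext_superset) (simp_all add: Poly_Mapping.keys_add)
  moreover have "lext F f = (\<Sum>M\<in>?A. cst (Poly_Mapping.lookup f M) * F M)"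
    by (rule lext_superset) simp_all
  moreover have "lext F g = (\<Sum>M\<in>?A. cst (Poly_Mapping.lookup g M) * F M)"
    by (rule lext_superset) simp_all
  ultimately show "lext F (f + g) = lext F f + lext F g"
    by (simp only: lookup_add cst_add distrib_right sum.distrib)
  have "lext F (cst a * f) = (\<Sum>M\<in>Poly_Mapping.keys f. cst (Poly_Mapping.lookup (cst a * f) M) * F M)"
    by (rule lext_superset) (auto simp: in_keys_iff)
  then show "lext F (cst a * f) = cst a * lext F f"
    unfolding lext_def [of F f] by (simp only: lookup_cst_mult cst_mult sum_distrib_left mult.assoc)
qed

lemma lext_pm [simp]: "lext F (pm M) = F M"
  by (simp add: lext_def pm_def)

section \<open>The scalar product\<close>

lemma hl_superset:
  assumes "finite A" "Poly_Mapping.keys f \<subseteq> A"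
  shows "hl_inner f g = (\<Sum>M\<in>A. Poly_Mapping.lookup f M * Poly_Mapping.lookup g M * zt M)"
  unfolding hl_inner_def by (rule sum.mono_neutral_left) (use assms in \<open>auto simp: in_keys_iff\<close>)

lemma hl_superset_right:
  assumes "finite A" "Poly_Mapping.keys g \<subseteq> A"
  shows "hl_inner f g = (\<Sum>M\<in>A. Poly_Mapping.lookup f M * Poly_Mapping.lookup g M * zt M)"
proof -
  have "hl_inner f g = (\<Sum>M\<in>A \<union> Poly_Mapping.keys f. Poly_Mapping.lookup f M * Poly_Mapping.lookup g M * zt M)"
    using assms by (intro hl_superset) auto
  also have "\<dots> = (\<Sum>M\<in>A. Poly_Mapping.lookup f M * Poly_Mapping.lookup g M * zt M)"
    by (rule sum.mono_neutral_right) (use assms in \<open>auto simp: in_keys_iff\<close>)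
  finally show ?thesis .
qed

lemma hl_sym: "hl_inner f g = hl_inner g f"
proof -
  have "hl_inner f g = (\<Sum>M\<in>Poly_Mapping.keys g. Poly_Mapping.lookup f M * Poly_Mapping.lookup g M * zt M)"
    by (rule hl_superset_right) auto
  then show ?thesis by (simp add: hl_inner_def mult.commute)
qed

lemma hl_add_right: "hl_inner f (g + h) = hl_inner f g + hl_inner f h"
  by (simp add: hl_inner_def lookup_add algebra_simps sum.distrib)

lemma hl_cst_right: "hl_inner f (cst a * g) = a * hl_inner f g"
  unfolding hl_inner_def sum_distrib_left lookup_cst_mult by (rule sum.cong) (simp_all add: algebra_simps)

lemma hl_add_left: "hl_inner (f + g) h = hl_inner f h + hl_inner g h"
  by (metis hl_add_right hl_sym)

lemma hl_cst_left: "hl_inner (cst a * f) g = a * hl_inner f g"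
  by (metis hl_cst_right hl_sym)

lemma hl_0 [simp]: "hl_inner 0 f = 0" "hl_inner f 0 = 0"
  by (simp_all add: hl_inner_def)

lemma hl_minus_left: "hl_inner (- f) g = - hl_inner f g"
  using hl_cst_left [of "-1" f g] by (simp add: cst_minus)

lemma hl_diff_left: "hl_inner (f - h) g = hl_inner f g - hl_inner h g"
  using hl_add_left [of f "-h" g] by (simp add: hl_minus_left)

lemma hl_diff_right: "hl_inner g (f - h) = hl_inner g f - hl_inner g h"
  by (metis hl_diff_left hl_sym)

lemma hl_sum_left: "hl_inner (\<Sum>x\<in>A. f x) g = (\<Sum>x\<in>A. hl_inner (f x) g)"
  by (induction A rule: infinite_finite_induct) (simp_all add: hl_add_left)

lemma hl_sum_right: "hl_inner g (\<Sum>x\<in>A. f x) = (\<Sum>x\<in>A. hl_inner g (f x))"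
  by (induction A rule: infinite_finite_induct) (simp_all add: hl_add_right)

lemma hl_pm: "hl_inner f (pm M) = Poly_Mapping.lookup f M * zt M"
proof -
  have "hl_inner f (pm M) = (\<Sum>N\<in>{M}. Poly_Mapping.lookup f N * Poly_Mapping.lookup (pm M) N * zt N)"
    by (rule hl_superset_right) (auto simp: pm_def)
  then show ?thesis by (simp add: lookup_pm)
qed

lemma z0_superset:
  assumes "finite A" "set_mset M \<subseteq> A"
  shows "z0 M = (\<Prod>i\<in>A. i ^ count M i * fact (count M i))"
  unfolding z0_def
  by (rule prod.mono_neutral_left) (use assms in \<open>auto simp: not_in_iff\<close>)

lemma z0_add_mset: "z0 (add_mset n M) = z0 M * (n * (count M n + 1))"
proof -
  let ?A = "insert n (set_mset M)"
  have "z0 (add_mset n M) = (\<Prod>i\<in>?A. i ^ count (add_mset n M) i * fact (count (add_mset n M) i))"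
    by (rule z0_superset) auto
  also have "\<dots> = (n ^ count (add_mset n M) n * fact (count (add_mset n M) n)) *
      (\<Prod>i\<in>?A - {n}. i ^ count (add_mset n M) i * fact (count (add_mset n M) i))"
    by (rule prod.remove) auto
  also have "(\<Prod>i\<in>?A - {n}. i ^ count (add_mset n M) i * fact (count (add_mset n M) i)) =
     (\<Prod>i\<in>?A - {n}. i ^ count M i * fact (count M i))"
    by (rule prod.cong) auto
  finally have 1: "z0 (add_mset n M) = (n ^ Suc (count M n) * fact (Suc (count M n))) *
     (\<Prod>i\<in>?A - {n}. i ^ count M i * fact (count M i))"
    by simp
  have "z0 M = (\<Prod>i\<in>?A. i ^ count M i * fact (count M i))"
    by (rule z0_superset) auto
  also have "\<dots> = (n ^ count M n * fact (count M n)) *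
      (\<Prod>i\<in>?A - {n}. i ^ count M i * fact (count M i))"
    by (rule prod.remove) auto
  finally show ?thesis unfolding 1 by (simp add: algebra_simps)
qed

lemma zt_add_mset: "zt (add_mset n M) = zt M * (of_nat n / (1 - tt ^ n)) * of_nat (count M n + 1)"
  by (simp add: zt_def z0_add_mset algebra_simps)

lemma z0_nonzero: "0 \<notin># M \<Longrightarrow> z0 M \<noteq> 0"
  by (auto simp: z0_def)

text \<open>A multiset containing 0 has \<open>z0\<close> equal to 0, so the form is degenerate on
  the full type; it is nondegenerate only on indices without 0, that is on Lambda.\<close>

lemma zt_nonzero: "0 \<notin># M \<Longrightarrow> zt M \<noteq> 0"
proof -
  assume M: "0 \<notin># M"
  have "(\<Prod>x\<in>#M. (1 - tt ^ x)) \<noteq> 0"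
  proof
    assume "(\<Prod>x\<in>#M. (1 - tt ^ x)) = 0"
    then have "0 \<in># image_mset (\<lambda>x. 1 - tt ^ x) M"
      by (simp add: prod_mset_zero_iff)
    then obtain x where "x \<in># M" "1 - tt ^ x = 0" by auto
    then show False using one_minus_tt_power [of x] M by (cases x) auto
  qed
  then show ?thesis using z0_nonzero [OF M] by (simp add: zt_def)
qed

section \<open>The derivations d/dp_n\<close>

definition dp :: "nat \<Rightarrow> sym \<Rightarrow> sym" where
  "dp n = lext (\<lambda>M. of_nat (count M n) * pm (M - {#n#}))"

lemma lin_dp: "lin (dp n)"
  by (simp add: dp_def lin_lext)

lemma dp_pm: "dp n (pm M) = of_nat (count M n) * pm (M - {#n#})"
  by (simp add: dp_def)

lemma dp_1 [simp]: "dp n 1 = 0"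
  using dp_pm [of n "{#}"] by simp

lemma dp_pw: "dp n (pw k) = (if n = k then 1 else 0)"
  by (simp add: dp_pm)

lemma dp_mult: "dp n (f * g) = dp n f * g + f * dp n g"
proof -
  have 0: "dp n (pm M * pm N) = dp n (pm M) * pm N + pm M * dp n (pm N)" for M N
  proof -
    \<comment> \<open>Where n is absent from M, the difference \<open>M - {#n#}\<close> is not the
      wanted index, but its coefficient is then zero.\<close>
    have 1: "pm (M + N - {#n#}) * of_nat (count M n) = of_nat (count M n) * (pm (M - {#n#}) * pm N)"
      by (cases "n \<in># M") (auto simp: pm_add [symmetric] not_in_iff)
    have 2: "pm (M + N - {#n#}) * of_nat (count N n) = of_nat (count N n) * (pm M * pm (N - {#n#}))"
      by (cases "n \<in># N") (auto simp: pm_add [symmetric] not_in_iff add.commute)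
    have "dp n (pm M * pm N) = of_nat (count M n + count N n) * pm (M + N - {#n#})"
      by (simp add: pm_add [symmetric] dp_pm)
    then show ?thesis using 1 2 by (simp add: dp_pm algebra_simps)
  qed
  have 1: "dp n (f * pm N) = dp n f * pm N + f * dp n (pm N)" for N
    by (induction f rule: sym_induct)
      (simp_all add: lin_add [OF lin_dp] lin_cst [OF lin_dp] 0 distrib_left distrib_right mult.assoc add_ac)
  have 2: "dp n (f * (cst a * pm N)) = cst a * dp n (f * pm N)" for a N
    by (metis lin_cst [OF lin_dp] mult.left_commute)
  show ?thesis
  proof (induction g rule: sym_induct)
    case (mono a M)
    show ?case unfolding 2 1 lin_cst [OF lin_dp] by (simp add: algebra_simps)
  qed (simp add: lin_add [OF lin_dp] distrib_left add_ac)
qed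

lemma dp_commute: "dp m (dp n f) = dp n (dp m f)"
proof (rule lin_cong [where F = "\<lambda>f. dp m (dp n f)" and G = "\<lambda>f. dp n (dp m f)"])
  fix M
  show "dp m (dp n (pm M)) = dp n (dp m (pm M))"
  proof (cases "m = n")
    case False
    have 1: "M - {#n#} - {#m#} = M - {#m#} - {#n#}"
      by (rule multiset_eqI) simp
    have 2: "count (M - {#n#}) m = count M m" "count (M - {#m#}) n = count M n"
      using False by simp_all
    have "dp m (dp n (pm M)) = of_nat (count M n) * (of_nat (count M m) * pm (M - {#n#} - {#m#}))"
      unfolding dp_pm lin_of_nat [OF lin_dp] 2 ..
    moreover have "dp n (dp m (pm M)) = of_nat (count M m) * (of_nat (count M n) * pm (M - {#m#} - {#n#}))"
      unfolding dp_pm lin_of_nat [OF lin_dp] 2 ..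
    ultimately show ?thesis unfolding 1 by (simp only: mult.left_commute)
  qed simp
qed (rule lin_comp [OF lin_dp lin_dp])+

text \<open>Adding a part n to an index multiplies \<open>zt\<close> by n / (1 - t^n) times the new
  multiplicity of n, and d/dp_n produces the same multiplicity. So multiplication by p_n is adjoint
  to n / (1 - t^n) d/dp_n.\<close>

lemma hl_pw_mult: "hl_inner (pw n * f) g = of_nat n / (1 - tt ^ n) * hl_inner f (dp n g)"
proof -
  have 0: "hl_inner (pw n * pm M) (pm N) = of_nat n / (1 - tt ^ n) * hl_inner (pm M) (dp n (pm N))" for M N
  proof (cases "n \<in># N")
    case True
    then obtain N' where N: "N = add_mset n N'" by (metis mset_add)
    show ?thesis
      by (simp add: N pm_add_mset [symmetric] dp_pm hl_pm lookup_pm zt_add_mset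
          hl_cst_right cst_of_nat [symmetric] del: of_nat_Suc) 
  next
    case False
    then show ?thesis
      by (auto simp: pm_add_mset [symmetric] dp_pm hl_pm lookup_pm not_in_iff)
  qed
  have 1: "hl_inner (pw n * pm M) g = of_nat n / (1 - tt ^ n) * hl_inner (pm M) (dp n g)" for M
    by (induction g rule: sym_induct)
      (simp_all only: lin_add [OF lin_dp] lin_cst [OF lin_dp] hl_add_right hl_cst_right 0 distrib_left
        mult.left_commute)
  have 2: "hl_inner (pw n * (cst a * pm M)) g = a * hl_inner (pw n * pm M) g" for a M
    by (metis hl_cst_left mult.left_commute)
  show ?thesis
    by (induction f rule: sym_induct)
      (simp_all only: hl_add_left hl_cst_left 1 2 distrib_left mult.left_commute)
qed

section \<open>Exponentials of power sums and their adjoints\<close>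

text \<open>psexp a r is the coefficient of u^r in exp (sum_n a_n p_n u^n / n), and pshift c r the coefficient
  of u^r in the substitution p_n -> p_n + c_n u^n. Both are defined by the recursion that u d/du
  gives for their generating functions. If a_n = c_n (1 - t^n) they are adjoint, see hl_psexp_mult;
  the values a_n = 1, (-1)^(n-1), 1 - t^n give h_r, e_r and q_r.\<close>

fun psexp :: "(nat \<Rightarrow> coef) \<Rightarrow> nat \<Rightarrow> sym" where
  "psexp a r = (if r = 0 then 1
     else cst (1 / of_nat r) * (\<Sum>n=1..r. cst (a n) * pw n * psexp a (r - n)))"

fun pshift :: "(nat \<Rightarrow> coef) \<Rightarrow> nat \<Rightarrow> sym \<Rightarrow> sym" where
  "pshift c r f = (if r = 0 then f
     else cst (1 / of_nat r) * (\<Sum>n=1..r. cst (c n * of_nat n) * pshift c (r - n) (dp n f)))"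

declare psexp.simps [simp del] pshift.simps [simp del]

lemma psexp_0 [simp]: "psexp a 0 = 1"
  by (simp add: psexp.simps)

lemma pshift_0 [simp]: "pshift c 0 f = f"
  by (simp add: pshift.simps)

lemma cst_inverse_of_nat: "r \<noteq> 0 \<Longrightarrow> of_nat r * (cst (1 / of_nat r) * x) = x"
  by (simp add: cst_of_nat [symmetric] mult.assoc [symmetric] cst_mult [symmetric])

lemma psexp_rec: "of_nat r * psexp a r = (\<Sum>n=1..r. cst (a n) * pw n * psexp a (r - n))"
  by (cases "r = 0") (simp_all add: psexp.simps [of a r] cst_inverse_of_nat)

lemma pshift_rec:
  "of_nat r * pshift c r f = (\<Sum>n=1..r. cst (c n * of_nat n) * pshift c (r - n) (dp n f))"
  by (cases "r = 0") (simp_all add: pshift.simps [of c r] cst_inverse_of_nat)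

lemma lin_pshift: "lin (pshift c r)"
proof (induction r rule: less_induct)
  case (less r)
  show ?case
  proof (cases "r = 0")
    case True
    then show ?thesis by (simp add: lin_def)
  next
    case False
    have "pshift c r = (\<lambda>f. cst (1 / of_nat r) * (\<Sum>n=1..r. cst (c n * of_nat n) * pshift c (r - n) (dp n f)))"
      using False by (intro ext) (simp add: pshift.simps [of c r])
    moreover have "lin \<dots>"
      using less False by (intro lin_mult lin_sumf lin_comp [OF _ lin_dp]) auto
    ultimately show ?thesis by simp
  qed
qed

lemma pshift_dp: "dp m (pshift c r f) = pshift c r (dp m f)"
proof (induction r arbitrary: f rule: less_induct)
  case (less r)
  show ?case
  proof (cases "r = 0")
    case False
    have "of_nat r * dp m (pshift c r f) = dp m (of_nat r * pshift c r f)"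
      by (simp add: lin_of_nat [OF lin_dp])
    also have "\<dots> = (\<Sum>n=1..r. cst (c n * of_nat n) * dp m (pshift c (r - n) (dp n f)))"
      unfolding pshift_rec by (simp add: lin_sum [OF lin_dp] lin_cst [OF lin_dp])
    also have "\<dots> = (\<Sum>n=1..r. cst (c n * of_nat n) * pshift c (r - n) (dp n (dp m f)))"
      using less by (intro sum.cong refl) (simp add: dp_commute)
    also have "\<dots> = of_nat r * pshift c r (dp m f)"
      unfolding pshift_rec ..
    finally show ?thesis by (rule of_nat_cancel [OF False])
  qed simp
qed

text \<open>Both operators are polynomials in the commuting derivations \<open>dp n\<close> with
  scalar coefficients.\<close>

lemma pshift_commute: "pshift c r (pshift d s f) = pshift d s (pshift c r f)"
proof (induction r arbitrary: f rule: less_induct)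
  case (less r)
  show ?case
  proof (cases "r = 0")
    case False
    have "of_nat r * pshift c r (pshift d s f) =
      (\<Sum>n=1..r. cst (c n * of_nat n) * pshift d s (pshift c (r - n) (dp n f)))"
      unfolding pshift_rec pshift_dp using less by (intro sum.cong refl) auto
    also have "\<dots> = pshift d s (of_nat r * pshift c r f)"
      unfolding pshift_rec by (simp add: lin_sum [OF lin_pshift] lin_cst [OF lin_pshift])
    also have "\<dots> = of_nat r * pshift d s (pshift c r f)"
      by (simp add: lin_of_nat [OF lin_pshift])
    finally show ?thesis by (rule of_nat_cancel [OF False])
  qed simp
qed

text \<open>The adjoint of a_n p_n is a_n n / (1 - t^n) d/dp_n = c_n n d/dp_n, so the recursions of
  \<open>psexp\<close> and \<open>pshift\<close> are adjoint term by term.\<close>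

lemma hl_psexp_mult:
  assumes "\<And>n. n \<ge> 1 \<Longrightarrow> a n = c n * (1 - tt ^ n)"
  shows "hl_inner (psexp a r * f) g = hl_inner f (pshift c r g)"
proof (induction r arbitrary: f g rule: less_induct)
  case (less r)
  show ?case
  proof (cases "r = 0")
    case False
    have "of_nat r * hl_inner (psexp a r * f) g = hl_inner (of_nat r * psexp a r * f) g"
      by (simp add: cst_of_nat [symmetric] hl_cst_left mult.assoc)
    also have "\<dots> = (\<Sum>n=1..r. hl_inner (cst (a n) * (pw n * (psexp a (r - n) * f))) g)"
      unfolding psexp_rec by (simp add: sum_distrib_right hl_sum_left mult.assoc)
    also have "\<dots> = (\<Sum>n=1..r. hl_inner f (cst (c n * of_nat n) * pshift c (r - n) (dp n g)))"
    proof (rule sum.cong [OF refl])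
      fix n assume n: "n \<in> {1..r}"
      have "hl_inner (cst (a n) * (pw n * (psexp a (r - n) * f))) g =
        a n * (of_nat n / (1 - tt ^ n)) * hl_inner f (pshift c (r - n) (dp n g))"
        using less [of "r - n"] n by (simp add: hl_cst_left hl_pw_mult)
      also have "a n * (of_nat n / (1 - tt ^ n)) = c n * of_nat n"
        using n assms [of n] one_minus_tt_power [of n] by simp
      finally show "hl_inner (cst (a n) * (pw n * (psexp a (r - n) * f))) g =
        hl_inner f (cst (c n * of_nat n) * pshift c (r - n) (dp n g))"
        by (simp add: hl_cst_right)
    qed
    also have "\<dots> = hl_inner f (of_nat r * pshift c r g)"
      unfolding pshift_rec by (simp add: hl_sum_right)
    also have "\<dots> = of_nat r * hl_inner f (pshift c r g)"
      by (simp add: cst_of_nat [symmetric] hl_cst_right)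
    finally show ?thesis using False by simp
  qed simp
qed

text \<open>The three arguments of \<open>\<phi>\<close> always add up to r. This identity and the
  next regroup a recursion applied to the first or to the second factor by the index n that it
  splits off.\<close>

lemma sum_triangle_left:
  fixes \<phi> :: "nat \<Rightarrow> nat \<Rightarrow> nat \<Rightarrow> 'a::comm_monoid_add"
  shows "(\<Sum>i\<le>r. \<Sum>n=1..i. \<phi> n (i - n) (r - i)) = (\<Sum>n=1..r. \<Sum>i\<le>r-n. \<phi> n i (r - n - i))"
proof -
  have "(\<Sum>(i, n)\<in>Sigma {..r} (\<lambda>i. {1..i}). \<phi> n (i - n) (r - i)) =
     (\<Sum>(n, i)\<in>Sigma {1..r} (\<lambda>n. {..r-n}). \<phi> n i (r - n - i))"
    by (rule sum.reindex_bij_witness [where i = "\<lambda>(n, i). (i + n, n)" and j = "\<lambda>(i, n). (n, i - n)"]) auto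
  then show ?thesis by (simp add: sum.Sigma)
qed

lemma sum_triangle_right:
  fixes \<phi> :: "nat \<Rightarrow> nat \<Rightarrow> nat \<Rightarrow> 'a::comm_monoid_add"
  shows "(\<Sum>i\<le>r. \<Sum>n=1..r-i. \<phi> n i (r - i - n)) = (\<Sum>n=1..r. \<Sum>i\<le>r-n. \<phi> n i (r - n - i))"
proof -
  have "(\<Sum>(i, n)\<in>Sigma {..r} (\<lambda>i. {1..r-i}). \<phi> n i (r - i - n)) =
     (\<Sum>(n, i)\<in>Sigma {1..r} (\<lambda>n. {..r-n}). \<phi> n i (r - n - i))"
    by (rule sum.reindex_bij_witness [where i = "\<lambda>(n, i). (i, n)" and j = "\<lambda>(i, n). (n, i)"])
      (auto simp: add.commute)
  then show ?thesis by (simp add: sum.Sigma)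
qed

text \<open>The Leibniz rule for u d/du, read off at the coefficient of u^r in a product.\<close>

lemma of_nat_mult_sum_split:
  fixes h :: "nat \<Rightarrow> sym"
  shows "of_nat r * (\<Sum>i\<le>r. h i) = (\<Sum>i\<le>r. of_nat i * h i) + (\<Sum>i\<le>r. of_nat (r - i) * h i)"
proof -
  have "of_nat r * h i = of_nat i * h i + of_nat (r - i) * h i" if "i \<le> r" for i
    using that by (metis distrib_right le_add_diff_inverse of_nat_add)
  then show ?thesis by (simp add: sum_distrib_left sum.distrib [symmetric])
qed

text \<open>A substitution for the p_n is a ring homomorphism; on the coefficient of u^r this reads
  as a convolution. After multiplication by r both sides obey the same recursion, by the Leibniz
  rules for d/dp_n and for u d/du.\<close>

lemma pshift_mult: "pshift c r (f * g) = (\<Sum>i\<le>r. pshift c i f * pshift c (r - i) g)"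
proof (induction r arbitrary: f g rule: less_induct)
  case (less r)
  show ?case
  proof (cases "r = 0")
    case False
    let ?\<phi> = "\<lambda>n i j. cst (c n * of_nat n) * (pshift c i (dp n f) * pshift c j g)"
    let ?\<psi> = "\<lambda>n i j. cst (c n * of_nat n) * (pshift c i f * pshift c j (dp n g))"
    have "of_nat r * pshift c r (f * g) =
      (\<Sum>n=1..r. cst (c n * of_nat n) * pshift c (r - n) (dp n f * g + f * dp n g))"
      by (simp add: pshift_rec dp_mult)
    also have "\<dots> = (\<Sum>n=1..r. (\<Sum>i\<le>r-n. ?\<phi> n i (r - n - i)) + (\<Sum>i\<le>r-n. ?\<psi> n i (r - n - i)))"
    proof (rule sum.cong [OF refl])
      fix n assume n: "n \<in> {1..r}"
      then have "r - n < r" by auto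
      then show "cst (c n * of_nat n) * pshift c (r - n) (dp n f * g + f * dp n g) =
        (\<Sum>i\<le>r-n. ?\<phi> n i (r - n - i)) + (\<Sum>i\<le>r-n. ?\<psi> n i (r - n - i))"
        by (simp only: lin_add [OF lin_pshift] less.IH sum_distrib_left distrib_left)
    qed
    also have "\<dots> = (\<Sum>i\<le>r. \<Sum>n=1..i. ?\<phi> n (i - n) (r - i)) + (\<Sum>i\<le>r. \<Sum>n=1..r-i. ?\<psi> n i (r - i - n))"
      unfolding sum_triangle_left [of ?\<phi>] sum_triangle_right [of ?\<psi>] by (rule sum.distrib)
    also have "(\<Sum>i\<le>r. \<Sum>n=1..i. ?\<phi> n (i - n) (r - i)) =
        (\<Sum>i\<le>r. of_nat i * pshift c i f * pshift c (r - i) g)"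
      unfolding pshift_rec sum_distrib_right by (simp only: mult.assoc)
    also have "(\<Sum>i\<le>r. \<Sum>n=1..r-i. ?\<psi> n i (r - i - n)) =
        (\<Sum>i\<le>r. pshift c i f * (of_nat (r - i) * pshift c (r - i) g))"
      unfolding pshift_rec sum_distrib_left by (simp only: mult.left_commute)
    also have "(\<Sum>i\<le>r. of_nat i * pshift c i f * pshift c (r - i) g) + \<dots> =
        of_nat r * (\<Sum>i\<le>r. pshift c i f * pshift c (r - i) g)"
      unfolding of_nat_mult_sum_split by (simp only: mult.assoc mult.left_commute)
    finally show ?thesis by (rule of_nat_cancel [OF False])
  qed simp
qed

text \<open>Successive substitutions add their shifts. Opposite shifts are therefore inverse, which
  is how inverse series of operators are obtained below.\<close>

lemma pshift_compose: "(\<Sum>i\<le>r. pshift c i (pshift d (r - i) f)) = pshift (\<lambda>n. c n + d n) r f"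
proof (induction r arbitrary: f rule: less_induct)
  case (less r)
  show ?case
  proof (cases "r = 0")
    case False
    let ?\<phi> = "\<lambda>n i j. cst (c n * of_nat n) * pshift c i (pshift d j (dp n f))"
    let ?\<psi> = "\<lambda>n i j. cst (d n * of_nat n) * pshift c i (pshift d j (dp n f))"
    have "of_nat r * (\<Sum>i\<le>r. pshift c i (pshift d (r - i) f)) =
      (\<Sum>i\<le>r. \<Sum>n=1..i. ?\<phi> n (i - n) (r - i)) + (\<Sum>i\<le>r. \<Sum>n=1..r-i. ?\<psi> n i (r - i - n))"
    proof -
      have "of_nat (r - i) * pshift c i (pshift d (r - i) f) = (\<Sum>n=1..r-i. ?\<psi> n i (r - i - n))" for i
      proof -
        have "of_nat (r - i) * pshift c i (pshift d (r - i) f) = pshift c i (of_nat (r - i) * pshift d (r - i) f)"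
          by (simp add: lin_of_nat [OF lin_pshift])
        also have "\<dots> = (\<Sum>n=1..r-i. ?\<psi> n i (r - i - n))"
          unfolding pshift_rec by (simp add: lin_sum [OF lin_pshift] lin_cst [OF lin_pshift])
        finally show ?thesis .
      qed
      then have 1: "(\<Sum>i\<le>r. of_nat (r - i) * pshift c i (pshift d (r - i) f)) =
          (\<Sum>i\<le>r. \<Sum>n=1..r-i. ?\<psi> n i (r - i - n))"
        by (intro sum.cong refl)
      have "(\<Sum>i\<le>r. of_nat i * pshift c i (pshift d (r - i) f)) =
          (\<Sum>i\<le>r. \<Sum>n=1..i. ?\<phi> n (i - n) (r - i))"
        unfolding pshift_rec pshift_dp ..
      with 1 show ?thesis unfolding of_nat_mult_sum_split by simp
    qed
    also have "\<dots> = (\<Sum>n=1..r. (\<Sum>i\<le>r-n. ?\<phi> n i (r - n - i)) + (\<Sum>i\<le>r-n. ?\<psi> n i (r - n - i)))"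
      unfolding sum_triangle_left [of ?\<phi>] sum_triangle_right [of ?\<psi>] by (rule sum.distrib [symmetric])
    also have "\<dots> = (\<Sum>n=1..r. cst ((c n + d n) * of_nat n) * pshift (\<lambda>n. c n + d n) (r - n) (dp n f))"
    proof (rule sum.cong [OF refl])
      fix n assume "n \<in> {1..r}"
      then have "pshift (\<lambda>n. c n + d n) (r - n) (dp n f) = (\<Sum>i\<le>r-n. pshift c i (pshift d (r - n - i) (dp n f)))"
        using less [of "r - n"] by simp
      then show "(\<Sum>i\<le>r-n. ?\<phi> n i (r - n - i)) + (\<Sum>i\<le>r-n. ?\<psi> n i (r - n - i)) =
        cst ((c n + d n) * of_nat n) * pshift (\<lambda>n. c n + d n) (r - n) (dp n f)"
        by (simp only: sum_distrib_left distrib_right cst_add sum.distrib)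
    qed
    also have "\<dots> = of_nat r * pshift (\<lambda>n. c n + d n) r f"
      by (simp only: pshift_rec)
    finally show ?thesis by (rule of_nat_cancel [OF False])
  qed simp
qed

lemma pshift_zero: "pshift (\<lambda>n. 0) r f = (if r = 0 then f else 0)"
  by (simp add: pshift.simps [of _ r])

text \<open>The rescaling u -> s u of the generating variable.\<close>

lemma pshift_scale: "pshift (\<lambda>n. c n * s ^ n) r f = cst (s ^ r) * pshift c r f"
proof (induction r arbitrary: f rule: less_induct)
  case (less r)
  show ?case
  proof (cases "r = 0")
    case False
    have "of_nat r * pshift (\<lambda>n. c n * s ^ n) r f =
      (\<Sum>n=1..r. cst (s ^ r) * (cst (c n * of_nat n) * pshift c (r - n) (dp n f)))"
      unfolding pshift_rec
    proof (rule sum.cong [OF refl])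
      fix n assume n: "n \<in> {1..r}"
      then have "s ^ r = s ^ n * s ^ (r - n)" by (simp add: power_add [symmetric])
      moreover have "pshift (\<lambda>n. c n * s ^ n) (r - n) (dp n f) = cst (s ^ (r - n)) * pshift c (r - n) (dp n f)"
        using less [of "r - n"] n by simp
      ultimately show "cst (c n * s ^ n * of_nat n) * pshift (\<lambda>n. c n * s ^ n) (r - n) (dp n f) =
        cst (s ^ r) * (cst (c n * of_nat n) * pshift c (r - n) (dp n f))"
        by (simp only: cst_mult mult_ac)
    qed
    also have "\<dots> = of_nat r * (cst (s ^ r) * pshift c r f)"
      by (simp only: sum_distrib_left [symmetric] pshift_rec [symmetric] mult.left_commute)
    finally show ?thesis by (rule of_nat_cancel [OF False])
  qed simp
qed

lemma pshift_one: "pshift c r 1 = (if r = 0 then 1 else 0)"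
  by (simp add: pshift.simps [of c r] lin_0 [OF lin_pshift])

text \<open>The exponential is an eigenvector of d/dp_n with eigenvalue a_n u^n / n.\<close>

lemma dp_psexp:
  assumes "n \<ge> 1"
  shows "dp n (psexp a k) = (if n \<le> k then cst (a n / of_nat n) * psexp a (k - n) else 0)"
proof (induction k rule: less_induct)
  case (less k)
  show ?case
  proof (cases "k = 0")
    case False
    let ?b = "cst (a n / of_nat n)"
    have n: "cst (a n) = of_nat n * ?b"
      using assms by (simp add: cst_of_nat [symmetric] cst_mult [symmetric])
    have "of_nat k * dp n (psexp a k) = (\<Sum>m=1..k. cst (a m) * dp n (pw m * psexp a (k - m)))"
      by (simp add: lin_of_nat [OF lin_dp, symmetric] psexp_rec lin_sum [OF lin_dp] mult.assoc lin_cst [OF lin_dp])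
    also have "\<dots> = (\<Sum>m=1..k. (if m = n then cst (a m) * psexp a (k - m) else 0) +
        (if m \<le> k - n \<and> n \<le> k then ?b * (cst (a m) * pw m * psexp a (k - n - m)) else 0))"
      using less assms by (intro sum.cong refl) (auto simp: dp_mult dp_pw distrib_left mult_ac add.commute)
    also have "\<dots> = (if n \<le> k then cst (a n) * psexp a (k - n) else 0) +
       (\<Sum>m=1..k. if m \<le> k - n \<and> n \<le> k then ?b * (cst (a m) * pw m * psexp a (k - n - m)) else 0)"
      using assms by (simp add: sum.distrib)
    also have "(\<Sum>m=1..k. if m \<le> k - n \<and> n \<le> k then ?b * (cst (a m) * pw m * psexp a (k - n - m)) else 0) =
       (if n \<le> k then \<Sum>m=1..k-n. ?b * (cst (a m) * pw m * psexp a (k - n - m)) else 0)"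
      by (auto intro!: sum.mono_neutral_cong_right)
    also have "\<dots> = (if n \<le> k then ?b * (of_nat (k - n) * psexp a (k - n)) else 0)"
      by (simp only: sum_distrib_left [symmetric] psexp_rec)
    also have "(if n \<le> k then cst (a n) * psexp a (k - n) else 0) + \<dots> =
       of_nat k * (if n \<le> k then ?b * psexp a (k - n) else 0)"
      unfolding n by (auto simp: algebra_simps of_nat_diff)
    finally show ?thesis by (rule of_nat_cancel [OF False])
  qed (use assms in simp)
qed

text \<open>g is the series exp (sum_n a_n c_n x^n / n).\<close>

lemma pshift_psexp:
  assumes g0: "g 0 = 1"
    and g: "\<And>l. l \<ge> 1 \<Longrightarrow> of_nat l * g l = (\<Sum>n=1..l. c n * a n * g (l - n))"
  shows "pshift c l (psexp a k) = (if l \<le> k then cst (g l) * psexp a (k - l) else 0)"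
proof (induction l arbitrary: k rule: less_induct)
  case (less l)
  show ?case
  proof (cases "l = 0")
    case False
    have "of_nat l * pshift c l (psexp a k) =
      (\<Sum>n=1..l. cst (c n * of_nat n) * pshift c (l - n) (dp n (psexp a k)))"
      by (rule pshift_rec)
    also have "\<dots> = (\<Sum>n=1..l. if l \<le> k then cst (c n * a n * g (l - n)) * psexp a (k - l) else 0)"
    proof (rule sum.cong [OF refl])
      fix n assume n: "n \<in> {1..l}"
      have "cst (c n * of_nat n) * (cst (a n / of_nat n) * (cst (g (l - n)) * x)) = cst (c n * a n * g (l - n)) * x" for x
        using n by (simp add: mult.assoc [symmetric] cst_mult [symmetric])
      then show "cst (c n * of_nat n) * pshift c (l - n) (dp n (psexp a k)) =
        (if l \<le> k then cst (c n * a n * g (l - n)) * psexp a (k - l) else 0)"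
        using n less [of "l - n" "k - n"]
        by (auto simp: dp_psexp lin_cst [OF lin_pshift] lin_0 [OF lin_pshift])
    qed
    also have "\<dots> = of_nat l * (if l \<le> k then cst (g l) * psexp a (k - l) else 0)"
    proof (cases "l \<le> k")
      case True
      have "(\<Sum>n=1..l. cst (c n * a n * g (l - n)) * psexp a (k - l)) =
          cst (of_nat l * g l) * psexp a (k - l)"
        using g [of l] False by (simp only: sum_distrib_right [symmetric] cst_sum [symmetric])
      then show ?thesis
        unfolding if_P [OF True] by (simp only: cst_mult cst_of_nat mult.assoc)
    qed simp
    finally show ?thesis by (rule of_nat_cancel [OF False])
  qed (simp add: g0)
qed

text \<open>Unlike \<open>homog\<close>, a bound that every element satisfies for some n (see
  \<open>degb\<close>); it allows operators given by infinite sums to be defined on the whole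
  type.\<close>

definition dle :: "nat \<Rightarrow> sym \<Rightarrow> bool" where
  "dle n f \<longleftrightarrow> (\<forall>M\<in>Poly_Mapping.keys f. sum_mset M \<le> n)"

lemma dle_mono: "dle m f \<Longrightarrow> m \<le> n \<Longrightarrow> dle n f"
  by (force simp: dle_def)

lemma dle_0 [simp]: "dle n 0"
  by (simp add: dle_def)

lemma dle_add: "dle n f \<Longrightarrow> dle n g \<Longrightarrow> dle n (f + g)"
  unfolding dle_def using Poly_Mapping.keys_add [of f g] by blast

lemma dle_sum: "(\<And>x. x \<in> A \<Longrightarrow> dle n (f x)) \<Longrightarrow> dle n (\<Sum>x\<in>A. f x)"
  by (induction A rule: infinite_finite_induct) (simp_all add: dle_add)

lemma dle_mult: "dle m f \<Longrightarrow> dle n g \<Longrightarrow> dle (m + n) (f * g)"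
  unfolding dle_def using keys_mult [of f g] by (force intro: add_mono)

lemma dle_cst [simp]: "dle n (cst a)"
  by (auto simp: dle_def cst_def keys_single)

lemma dle_cst_mult: "dle n f \<Longrightarrow> dle n (cst a * f)"
  using dle_mult [of 0 "cst a" n f] by simp

lemma dle_pm: "sum_mset M \<le> n \<Longrightarrow> dle n (pm M)"
  by (auto simp: dle_def pm_def)

lemma dle_1 [simp]: "dle n 1"
  using dle_pm [of "{#}"] by simp

lemma sum_mset_remove1: "n \<in># M \<Longrightarrow> sum_mset (M - {#n#}) = sum_mset M - (n::nat)"
  by (metis diff_add_inverse sum_mset.remove)

lemma dp_keys_sum:
  "dp n f = (\<Sum>M\<in>Poly_Mapping.keys f. cst (Poly_Mapping.lookup f M) * (of_nat (count M n) * pm (M - {#n#})))"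
  by (simp add: dp_def lext_def)

lemma dle_dp: "dle d f \<Longrightarrow> dle (d - n) (dp n f)"
  unfolding dp_keys_sum
proof (rule dle_sum)
  fix M assume "dle d f" "M \<in> Poly_Mapping.keys f"
  then have M: "sum_mset M \<le> d" by (auto simp: dle_def)
  show "dle (d - n) (cst (Poly_Mapping.lookup f M) * (of_nat (count M n) * pm (M - {#n#})))"
  proof (cases "n \<in># M")
    case True
    then show ?thesis
      using M by (auto simp: cst_of_nat [symmetric] sum_mset_remove1 intro!: dle_cst_mult dle_pm)
  qed (simp add: not_in_iff)
qed

lemma dp_beyond: "dle d f \<Longrightarrow> n > d \<Longrightarrow> dp n f = 0"
  unfolding dp_keys_sum
proof (rule sum.neutral, rule ballI)
  fix M assume *: "dle d f" "n > d" "M \<in> Poly_Mapping.keys f"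
  then have "sum_mset M < n" by (auto simp: dle_def)
  then have "n \<notin># M" using sum_mset.remove [of n M] by fastforce
  then show "cst (Poly_Mapping.lookup f M) * (of_nat (count M n) * pm (M - {#n#})) = 0"
    by (simp add: not_in_iff)
qed

lemma dle_pshift: "dle d f \<Longrightarrow> dle (d - r) (pshift c r f)"
proof (induction r arbitrary: d f rule: less_induct)
  case (less r)
  show ?case
  proof (cases "r = 0")
    case False
    have "dle (d - r) (pshift c (r - n) (dp n f))" if "n \<in> {1..r}" for n
      using less(1) [of "r - n" "d - n" "dp n f"] that dle_dp [OF less(2), of n] by auto
    then show ?thesis
      using False by (subst pshift.simps) (auto intro!: dle_cst_mult dle_sum)
  qed (simp add: less)
qed

text \<open>Every term removes parts of total size r from an index.\<close>

lemma pshift_beyond: "dle d f \<Longrightarrow> r > d \<Longrightarrow> pshift c r f = 0"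
proof (induction r arbitrary: d f rule: less_induct)
  case (less r)
  have "pshift c (r - n) (dp n f) = 0" if n: "n \<in> {1..r}" for n
  proof (cases "n \<le> d")
    case True
    then show ?thesis using less(1) [of "r - n" "d - n" "dp n f"] n less dle_dp by auto
  next
    case False
    then show ?thesis using dp_beyond less by (simp add: lin_0 [OF lin_pshift])
  qed
  then show ?case using less(3) by (simp add: pshift.simps)
qed

section \<open>Membership in Lambda and homogeneous elements\<close>

lemma in_Lambda_0 [simp]: "in_Lambda 0"
  by (simp add: in_Lambda_def)

lemma in_Lambda_add: "in_Lambda f \<Longrightarrow> in_Lambda g \<Longrightarrow> in_Lambda (f + g)"
  unfolding in_Lambda_def using Poly_Mapping.keys_add [of f g] by blast

lemma in_Lambda_sum: "(\<And>x. x \<in> A \<Longrightarrow> in_Lambda (f x)) \<Longrightarrow> in_Lambda (\<Sum>x\<in>A. f x)"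
  by (induction A rule: infinite_finite_induct) (simp_all add: in_Lambda_add)

lemma in_Lambda_mult: "in_Lambda f \<Longrightarrow> in_Lambda g \<Longrightarrow> in_Lambda (f * g)"
  unfolding in_Lambda_def using keys_mult [of f g] by fastforce

lemma in_Lambda_cst [simp]: "in_Lambda (cst a)"
  by (auto simp: in_Lambda_def cst_def keys_single)

lemma in_Lambda_minus: "in_Lambda f \<Longrightarrow> in_Lambda (- f)"
  using in_Lambda_mult [OF in_Lambda_cst, of f "-1"] by (simp add: cst_minus)

lemma in_Lambda_diff: "in_Lambda f \<Longrightarrow> in_Lambda g \<Longrightarrow> in_Lambda (f - g)"
  using in_Lambda_add [of f "- g"] by (simp add: in_Lambda_minus)

lemma homog_0 [simp]: "homog n 0"
  by (simp add: homog_def)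

lemma homog_add: "homog n f \<Longrightarrow> homog n g \<Longrightarrow> homog n (f + g)"
  unfolding homog_def using Poly_Mapping.keys_add [of f g] in_Lambda_add by blast

lemma homog_sum: "(\<And>x. x \<in> A \<Longrightarrow> homog n (f x)) \<Longrightarrow> homog n (\<Sum>x\<in>A. f x)"
  by (induction A rule: infinite_finite_induct) (simp_all add: homog_add)

lemma homog_mult: "homog m f \<Longrightarrow> homog n g \<Longrightarrow> homog (m + n) (f * g)"
  unfolding homog_def using keys_mult [of f g] in_Lambda_mult by fastforce

lemma homog_cst [simp]: "homog 0 (cst a)"
  by (auto simp: homog_def in_Lambda_def cst_def keys_single)

lemma homog_1 [simp]: "homog 0 1"
  using homog_cst [of 1] by simp

lemma homog_cst_mult: "homog n f \<Longrightarrow> homog n (cst a * f)"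
  using homog_mult [of 0 "cst a" n f] by simp

lemma homog_minus: "homog n f \<Longrightarrow> homog n (- f)"
  using homog_cst_mult [of n f "-1"] by (simp add: cst_minus)

lemma homog_diff: "homog n f \<Longrightarrow> homog n g \<Longrightarrow> homog n (f - g)"
  using homog_add [of n f "- g"] by (simp add: homog_minus)

lemma homog_pm: "0 \<notin># M \<Longrightarrow> sum_mset M = n \<Longrightarrow> homog n (pm M)"
  by (auto simp: homog_def in_Lambda_def pm_def)

lemma homog_imp_dle: "homog n f \<Longrightarrow> dle n f"
  by (auto simp: homog_def dle_def)

lemma homog_imp_in_Lambda: "homog n f \<Longrightarrow> in_Lambda f"
  by (simp add: homog_def)

lemma homog_psexp: "homog r (psexp a r)"
proof (induction r rule: less_induct)
  case (less r)
  have "homog r (pw n * psexp a (r - n))" if "n \<in> {1..r}" for n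
    using homog_mult [of n "pw n" "r - n" "psexp a (r - n)"] less [of "r - n"] that by (auto simp: homog_pm)
  then show ?case
    by (subst psexp.simps) (auto simp: mult.assoc intro!: homog_cst_mult homog_sum)
qed

lemma homog_dp: "homog d f \<Longrightarrow> homog (d - n) (dp n f)"
  unfolding dp_keys_sum
proof (rule homog_sum)
  fix M assume "homog d f" "M \<in> Poly_Mapping.keys f"
  then have M: "sum_mset M = d" "0 \<notin># M" by (auto simp: homog_def in_Lambda_def)
  show "homog (d - n) (cst (Poly_Mapping.lookup f M) * (of_nat (count M n) * pm (M - {#n#})))"
  proof (cases "n \<in># M")
    case True
    then show ?thesis
      using M by (auto simp: cst_of_nat [symmetric] sum_mset_remove1 intro!: homog_cst_mult homog_pm
        dest: in_diffD)
  qed (simp add: not_in_iff)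
qed

text \<open>When r exceeds d the truncated difference does no harm, because the value is then
  zero.\<close>

lemma homog_pshift: "homog d f \<Longrightarrow> homog (d - r) (pshift c r f)"
proof (induction r arbitrary: d f rule: less_induct)
  case (less r)
  show ?case
  proof (cases "r = 0")
    case False
    have "homog (d - r) (pshift c (r - n) (dp n f))" if "n \<in> {1..r}" for n
      using less(1) [of "r - n" "d - n" "dp n f"] that homog_dp [OF less(2), of n] by auto
    then show ?thesis
      using False by (subst pshift.simps) (auto intro!: homog_cst_mult homog_sum)
  qed (simp add: less)
qed

lemma hl_homog_neq:
  assumes "homog m f" "homog n g" "m \<noteq> n"
  shows "hl_inner f g = 0"
proof -
  have "Poly_Mapping.lookup f M * Poly_Mapping.lookup g M = 0" for M
    using assms unfolding homog_def by (metis in_keys_iff mult_eq_0_iff)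
  then show ?thesis unfolding hl_inner_def by (intro sum.neutral) (simp del: mult_eq_0_iff)
qed

lemma hl_nondegenerate:
  assumes "in_Lambda f" "\<And>M. 0 \<notin># M \<Longrightarrow> hl_inner (pm M) f = 0"
  shows "f = 0"
proof (rule poly_mapping_eqI)
  fix M
  show "Poly_Mapping.lookup f M = Poly_Mapping.lookup 0 M"
  proof (cases "0 \<in># M")
    case True
    then show ?thesis using assms(1) by (auto simp: in_Lambda_def in_keys_iff)
  next
    case False
    then show ?thesis using assms(2) [of M] hl_pm [of f M] zt_nonzero [of M] by (simp add: hl_sym)
  qed
qed

section \<open>Vertex operators\<close>

text \<open>With c_n a_n = -1 the factor is exp (- sum x^n / n) = 1 - x, which has only two
  coefficients.\<close>

lemma pshift_psexp_minus_one:
  assumes "\<And>n. n \<ge> 1 \<Longrightarrow> c n * a n = -1"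
  shows "pshift c l (psexp a k) =
    (if l = 0 then psexp a k else if l = 1 \<and> k \<ge> 1 then - psexp a (k - 1) else 0)"
proof -
  define g :: "nat \<Rightarrow> coef" where "g l = (if l = 0 then 1 else if l = 1 then -1 else 0)" for l
  have "of_nat l * g l = (\<Sum>n=1..l. c n * a n * g (l - n))" if "l \<ge> 1" for l
  proof -
    have "(\<Sum>n=1..l. c n * a n * g (l - n)) = (\<Sum>n=1..l. - g (l - n))"
      using assms by (intro sum.cong) auto
    also have "\<dots> = (\<Sum>n\<in>{l} \<union> (if l = 1 then {} else {l - 1}). - g (l - n))"
      using that by (intro sum.mono_neutral_right) (auto simp: g_def)
    also have "\<dots> = of_nat l * g l"
      using that by (auto simp: g_def)
    finally show ?thesis ..
  qed
  then have "pshift c l (psexp a k) = (if l \<le> k then cst (g l) * psexp a (k - l) else 0)"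
    by (intro pshift_psexp) (auto simp: g_def)
  then show ?thesis by (auto simp: g_def cst_minus)
qed

definition qg :: "nat \<Rightarrow> sym" where
  "qg k = psexp (\<lambda>n. 1 - tt ^ n) k"

text \<open>Up to sign, Eop r below is the adjoint of multiplication by e_r; Rop is the inverse, as a series, of
  the adjoint of multiplication by q_r.\<close>

definition Rop :: "nat \<Rightarrow> sym \<Rightarrow> sym" where
  "Rop i = pshift (\<lambda>n. -1) i"

definition Eop :: "nat \<Rightarrow> sym \<Rightarrow> sym" where
  "Eop r = pshift (\<lambda>n. -1 / (1 - tt ^ n)) r"

lemma Eop_qg: "Eop l (qg k) = (if l = 0 then qg k else if l = 1 \<and> k \<ge> 1 then - qg (k - 1) else 0)"
  unfolding Eop_def qg_def by (rule pshift_psexp_minus_one) (use one_minus_tt_power in auto)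

text \<open>Coefficients of (1 - x) / (1 - t x).\<close>

definition fr :: "nat \<Rightarrow> coef" where
  "fr l = (if l = 0 then 1 else - (1 - tt) * tt ^ (l - 1))"

lemma sum_fr: "(\<Sum>m\<le>l. fr m) = tt ^ l"
  by (induction l) (simp_all add: fr_def algebra_simps)

text \<open>The logarithm of (1 - x) / (1 - t x) is - sum (1 - t^n) x^n / n, and this is its
  logarithmic derivative on coefficients. In \<open>sum_fr\<close> the series is divided by 1 - x,
  which leaves 1 / (1 - t x).\<close>

lemma fr_rec:
  assumes "l \<ge> 1"
  shows "of_nat l * fr l = (\<Sum>n=1..l. -1 * (1 - tt ^ n) * fr (l - n))"
proof -
  obtain k where l: "l = Suc k" using assms by (cases l) auto
  have U: "(\<Sum>m\<le>k. tt ^ (Suc k - m) * fr m) = tt ^ Suc k - of_nat k * ((1 - tt) * tt ^ k)"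
  proof -
    have "(\<Sum>m\<le>k. tt ^ (Suc k - m) * fr m) = tt ^ Suc k * fr 0 + (\<Sum>m=1..k. tt ^ (Suc k - m) * fr m)"
      by (simp add: atMost_atLeast0 sum.atLeast_Suc_atMost)
    also have "(\<Sum>m=1..k. tt ^ (Suc k - m) * fr m) = (\<Sum>m=1..k. - ((1 - tt) * tt ^ k))"
    proof (rule sum.cong [OF refl])
      fix m assume m: "m \<in> {1..k}"
      then have "k = (Suc k - m) + (m - 1)" by auto
      then have "tt ^ k = tt ^ (Suc k - m) * tt ^ (m - 1)" by (metis power_add)
      moreover have "fr m = - ((1 - tt) * tt ^ (m - 1))" using m by (simp add: fr_def algebra_simps)
      ultimately show "tt ^ (Suc k - m) * fr m = - ((1 - tt) * tt ^ k)"
        by (simp only: mult_ac mult_minus_right)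
    qed
    finally show ?thesis by (simp add: fr_def)
  qed
  have "(\<Sum>n=1..l. -1 * (1 - tt ^ n) * fr (l - n)) = (\<Sum>m\<le>k. - (1 - tt ^ (l - m)) * fr m)"
    by (rule sum.reindex_bij_witness [where i = "\<lambda>m. l - m" and j = "\<lambda>n. l - n"]) (auto simp: l)
  also have "\<dots> = (\<Sum>m\<le>k. tt ^ (Suc k - m) * fr m) - (\<Sum>m\<le>k. fr m)"
    by (simp add: sum_subtractf [symmetric] algebra_simps l)
  also have "\<dots> = of_nat l * fr l"
    unfolding U sum_fr by (simp add: l fr_def algebra_simps)
  finally show ?thesis ..
qed

lemma Rop_qg: "Rop l (qg k) = (if l \<le> k then cst (fr l) * qg (k - l) else 0)"
  unfolding Rop_def qg_def by (rule pshift_psexp) (use fr_rec in \<open>auto simp: fr_def\<close>)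

definition degb :: "sym \<Rightarrow> nat" where
  "degb f = Max (insert 0 (sum_mset ` Poly_Mapping.keys f))"

lemma dle_degb: "dle (degb f) f"
  by (auto simp: dle_def degb_def)

text \<open>The sum over i is infinite in principle, but Rop i f vanishes beyond the degree of f.\<close>

definition B :: "nat \<Rightarrow> sym \<Rightarrow> sym" where
  "B m f = (\<Sum>i\<le>degb f. qg (m + i) * Rop i f)"

lemma B_eq:
  assumes "dle N f"
  shows "B m f = (\<Sum>i\<le>N. qg (m + i) * Rop i f)"
proof -
  have *: "(\<Sum>i\<le>n. qg (m + i) * Rop i f) = (\<Sum>i\<le>max N (degb f). qg (m + i) * Rop i f)"
    if "dle n f" "n \<le> max N (degb f)" for n
    using that pshift_beyond [OF that(1)]
    by (intro sum.mono_neutral_left) (auto simp: Rop_def)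
  show ?thesis unfolding B_def by (subst (1 2) *) (simp_all add: assms dle_degb)
qed

lemma lin_B: "lin (B m)"
proof (rule linI)
  fix f g :: sym and a
  let ?N = "max (degb f) (degb g)"
  have d: "dle ?N f" "dle ?N g"
    by (auto intro: dle_mono [OF dle_degb])
  show "B m (f + g) = B m f + B m g"
    using d dle_add [OF d]
    by (simp add: B_eq [of ?N] Rop_def lin_add [OF lin_pshift] distrib_left sum.distrib)
  show "B m (cst a * f) = cst a * B m f"
    using d(1) dle_cst_mult [OF d(1)]
    by (simp add: B_eq [of ?N] Rop_def lin_cst [OF lin_pshift] sum_distrib_left mult.left_commute)
qed

text \<open>\<open>Rop\<close> is multiplicative and sends q_k to multiples of the q_{k-l}, with the
  coefficients \<open>fr l\<close>. Terms with l > k or i - l > N vanish, and after renaming i - l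
  the range of summation is a rectangle.\<close>

lemma B_qg_mult:
  assumes "dle N h"
  shows "B a (qg k * h) = (\<Sum>i\<le>N. \<Sum>l\<le>k. cst (fr l) * qg (a + i + l) * qg (k - l) * Rop i h)"
proof -
  have d: "dle (k + N) (qg k * h)"
    unfolding qg_def by (rule dle_mult [OF homog_imp_dle [OF homog_psexp] assms])
  let ?F = "\<lambda>i l. qg (a + i) * (if l \<le> k then cst (fr l) * qg (k - l) * Rop (i - l) h else 0)"
  have "B a (qg k * h) = (\<Sum>i\<le>k+N. qg (a + i) * (\<Sum>l\<le>i. Rop l (qg k) * Rop (i - l) h))"
    by (simp add: B_eq [OF d] Rop_def pshift_mult)
  also have "\<dots> = (\<Sum>i\<le>k+N. \<Sum>l\<le>i. ?F i l)"
    by (intro sum.cong refl, subst sum_distrib_left) (auto intro!: sum.cong simp: Rop_qg)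
  also have "\<dots> = (\<Sum>(i, l)\<in>Sigma {..k+N} (\<lambda>i. {..i}). ?F i l)"
    by (simp add: sum.Sigma)
  also have "\<dots> = (\<Sum>(i, l)\<in>{(i, l). l \<le> k \<and> l \<le> i \<and> i - l \<le> N}. ?F i l)"
  proof (rule sum.mono_neutral_right)
    have z: "?F i l = 0" if "\<not> (l \<le> k \<and> i - l \<le> N)" for i l
      using that pshift_beyond [OF assms, of "i - l"] by (auto simp: Rop_def not_le)
    show "\<forall>p\<in>Sigma {..k+N} (\<lambda>i. {..i}) - {(i, l). l \<le> k \<and> l \<le> i \<and> i - l \<le> N}.
        (case p of (i, l) \<Rightarrow> ?F i l) = 0"
    proof
      fix p assume p: "p \<in> Sigma {..k+N} (\<lambda>i. {..i}) - {(i, l). l \<le> k \<and> l \<le> i \<and> i - l \<le> N}"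
      obtain i l where il: "p = (i, l)" by (cases p)
      have "?F i l = 0" by (rule z) (use p il in auto)
      then show "(case p of (i, l) \<Rightarrow> ?F i l) = 0" by (simp add: il)
    qed
  qed auto
  also have "\<dots> = (\<Sum>(i, l)\<in>{..N} \<times> {..k}. cst (fr l) * qg (a + i + l) * qg (k - l) * Rop i h)"
    by (rule sum.reindex_bij_witness [where i = "\<lambda>(i, l). (i + l, l)" and j = "\<lambda>(i, l). (i - l, l)"])
      (auto simp: mult_ac)
  also have "\<dots> = (\<Sum>i\<le>N. \<Sum>l\<le>k. cst (fr l) * qg (a + i + l) * qg (k - l) * Rop i h)"
    by (simp add: sum.cartesian_product)
  finally show ?thesis .
qed

text \<open>Kq x y is the function Q of the two-row composition (x, y).\<close>

definition Kq :: "nat \<Rightarrow> nat \<Rightarrow> sym" where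
  "Kq x y = (\<Sum>l\<le>y. cst (fr l) * qg (x + l) * qg (y - l))"

text \<open>The generating function of \<open>Kq x y\<close> in z^x w^y is q(z) q(w) (1 - w/z) / (1
  - t w/z); multiplication by 1 - t w/z clears the denominator. What remains is antisymmetric in x
  and y.\<close>

lemma Kq_diff: "Kq x (Suc y) - cst tt * Kq (Suc x) y = qg x * qg (Suc y) - qg (Suc x) * qg y"
proof -
  have "Kq x (Suc y) = cst (fr 0) * qg x * qg (Suc y) + (\<Sum>l\<le>y. cst (fr (Suc l)) * (qg (x + Suc l) * qg (y - l)))"
    unfolding Kq_def by (subst sum.atMost_Suc_shift) (simp add: mult.assoc)
  moreover have "cst tt * Kq (Suc x) y = (\<Sum>l\<le>y. cst (tt * fr l) * (qg (x + Suc l) * qg (y - l)))"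
    unfolding Kq_def by (simp only: sum_distrib_left cst_mult mult.assoc add_Suc_shift)
  moreover have "(\<Sum>l\<le>y. cst (fr (Suc l)) * (qg (x + Suc l) * qg (y - l))) -
      (\<Sum>l\<le>y. cst (tt * fr l) * (qg (x + Suc l) * qg (y - l))) =
      (\<Sum>l\<le>y. if l = 0 then - (qg (Suc x) * qg y) else 0)"
    unfolding sum_subtractf [symmetric]
  proof (rule sum.cong [OF refl])
    fix l
    have "fr (Suc l) - tt * fr l = (if l = 0 then -1 else 0)"
      by (cases l) (auto simp: fr_def algebra_simps)
    then have "cst (fr (Suc l)) - cst (tt * fr l) = (if l = 0 then -1 else 0)"
      by (simp add: cst_diff [symmetric] cst_minus split: if_splits)
    then show "cst (fr (Suc l)) * (qg (x + Suc l) * qg (y - l)) - cst (tt * fr l) * (qg (x + Suc l) * qg (y - l)) =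
       (if l = 0 then - (qg (Suc x) * qg y) else 0)"
      unfolding left_diff_distrib [symmetric] by (simp only:) simp
  qed
  ultimately show ?thesis by (simp add: fr_def)
qed

lemma B_B:
  assumes "dle N f"
  shows "B a (B b f) = (\<Sum>j\<le>N. \<Sum>i\<le>N. Kq (a + i) (b + j) * Rop i (Rop j f))"
proof -
  have "dle N (Rop j f)" for j
    unfolding Rop_def using dle_pshift [OF assms] by (rule dle_mono) simp
  then have "B a (qg (b + j) * Rop j f) = (\<Sum>i\<le>N. Kq (a + i) (b + j) * Rop i (Rop j f))" for j
    by (simp add: B_qg_mult [of N] Kq_def sum_distrib_right)
  then show ?thesis by (simp add: B_eq [OF assms] lin_sum [OF lin_B])
qed

text \<open>By \<open>Kq_diff\<close> the difference of the two sides is a double sum whose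
  coefficients are antisymmetric in i and j, while \<open>Rop i (Rop j f)\<close> is
  symmetric.\<close>

lemma B_straighten: "B b (B (Suc b) f) = cst tt * B (Suc b) (B b f)"
proof -
  let ?N = "degb f"
  let ?S = "\<lambda>i j. Rop i (Rop j f)"
  have S: "?S i j = ?S j i" for i j
    by (simp add: Rop_def pshift_commute)
  let ?A = "\<Sum>j\<le>?N. \<Sum>i\<le>?N. qg (b + i) * qg (Suc (b + j)) * ?S i j"
  let ?C = "\<Sum>j\<le>?N. \<Sum>i\<le>?N. qg (Suc (b + i)) * qg (b + j) * ?S i j"
  have "B b (B (Suc b) f) - cst tt * B (Suc b) (B b f) =
    (\<Sum>j\<le>?N. \<Sum>i\<le>?N. (Kq (b + i) (Suc (b + j)) - cst tt * Kq (Suc (b + i)) (b + j)) * ?S i j)"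
    by (simp add: B_B [OF dle_degb] sum_distrib_left sum_subtractf left_diff_distrib mult.assoc)
  also have "\<dots> = ?A - ?C"
    unfolding Kq_diff by (simp add: sum_subtractf left_diff_distrib)
  also have "?A = ?C"
  proof -
    have "?A = (\<Sum>i\<le>?N. \<Sum>j\<le>?N. qg (b + i) * qg (Suc (b + j)) * ?S i j)"
      by (rule sum.swap)
    also have "\<dots> = ?C"
      by (intro sum.cong refl) (simp add: S mult.commute)
    finally show ?thesis .
  qed
  finally show ?thesis by simp
qed

text \<open>On q_k the series of the \<open>Eop l\<close> gives q_k - u q_{k-1}, so only l = 0 and l
  = 1 contribute. Writing the index as \<open>Suc m\<close> keeps the lowered index a natural
  number.\<close>

lemma Eop_B:
  "Eop r (B (Suc m) f) = B (Suc m) (Eop r f) - (if r = 0 then 0 else B m (Eop (r - 1) f))"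
proof -
  let ?N = "degb f"
  have d: "dle ?N (Eop s f)" for s
    unfolding Eop_def using dle_pshift [OF dle_degb] by (rule dle_mono) simp
  have c: "Eop s (Rop j f) = Rop j (Eop s f)" for s j
    by (simp add: Eop_def Rop_def pshift_commute)
  have e: "Eop r (qg (Suc m + j) * Rop j f) = qg (Suc m + j) * Rop j (Eop r f) -
      (if r = 0 then 0 else qg (m + j) * Rop j (Eop (r - 1) f))" for j
  proof -
    have "Eop r (qg (Suc m + j) * Rop j f) = (\<Sum>l\<le>r. Eop l (qg (Suc m + j)) * Rop j (Eop (r - l) f))"
      by (simp add: c [symmetric]) (simp add: Eop_def pshift_mult)
    also have "\<dots> = (\<Sum>l\<in>(if r = 0 then {0} else {0, 1}). Eop l (qg (Suc m + j)) * Rop j (Eop (r - l) f))"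
      by (intro sum.mono_neutral_right) (auto simp: Eop_qg)
    also have "\<dots> = qg (Suc m + j) * Rop j (Eop r f) -
      (if r = 0 then 0 else qg (m + j) * Rop j (Eop (r - 1) f))"
      by (simp add: Eop_qg)
    finally show ?thesis .
  qed
  have "Eop r (B (Suc m) f) = (\<Sum>j\<le>?N. Eop r (qg (Suc m + j) * Rop j f))"
    by (simp add: B_def Eop_def lin_sum [OF lin_pshift])
  also have "\<dots> = B (Suc m) (Eop r f) - (if r = 0 then 0 else B m (Eop (r - 1) f))"
    unfolding e by (auto simp: B_eq [OF d] sum_subtractf)
  finally show ?thesis .
qed

lemma homog_qg: "homog k (qg k)"
  by (simp add: qg_def homog_psexp)

lemma homog_B: "homog d f \<Longrightarrow> homog (m + d) (B m f)"
proof -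
  assume f: "homog d f"
  have "homog (m + d) (qg (m + i) * Rop i f)" if "i \<le> d" for i
    using homog_mult [OF homog_qg homog_pshift [OF f]] that unfolding Rop_def
    by (metis add.assoc le_add_diff_inverse)
  then show ?thesis
    using homog_imp_dle [OF f] by (auto simp: B_eq intro!: homog_sum)
qed

text \<open>Parts lowered to zero disappear at the right end of a word in the operators.\<close>

lemma B_0_one: "B 0 1 = 1"
  using B_eq [of 0 1 0] by (simp add: Rop_def qg_def)

lemma B_straighten_power: "B b ((B (Suc b) ^^ n) f) = cst (tt ^ n) * (B (Suc b) ^^ n) (B b f)"
proof (induction n)
  case (Suc n)
  show ?case
    by (simp only: funpow.simps comp_apply B_straighten Suc.IH lin_cst [OF lin_B] power_Suc cst_mult mult.assoc)
qed simp

section \<open>q-binomial coefficients\<close>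

definition qfac :: "nat \<Rightarrow> coef" where
  "qfac n = (\<Prod>i\<in>{1..n}. 1 - tt ^ i)"

lemma qfac_0 [simp]: "qfac 0 = 1"
  by (simp add: qfac_def)

lemma qfac_Suc: "qfac (Suc n) = qfac n * (1 - tt ^ Suc n)"
  by (simp add: qfac_def)

lemma qfac_nonzero [simp]: "qfac n \<noteq> 0"
  using one_minus_tt_power by (auto simp: qfac_def)

lemma prod_falling_tt: "b \<le> a \<Longrightarrow> (\<Prod>i<b. 1 - tt ^ (a - i)) * qfac (a - b) = qfac a"
proof (induction b)
  case (Suc b)
  then have "a - b = Suc (a - Suc b)" by simp
  then have "qfac (a - b) = qfac (a - Suc b) * (1 - tt ^ (a - b))" by (metis qfac_Suc)
  then show ?case using Suc by (simp add: mult_ac)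
qed simp

lemma qbin_qfac: "b \<le> a \<Longrightarrow> qbin a b = qfac a / (qfac b * qfac (a - b))"
proof -
  assume "b \<le> a"
  then have "(\<Prod>i<b. 1 - tt ^ (a - i)) = qfac a / qfac (a - b)"
    using prod_falling_tt [of b a] by (simp add: eq_divide_eq)
  then show ?thesis unfolding qbin_def qfac_def [of b, symmetric] by (simp add: mult.commute)
qed

lemma qbin_0 [simp]: "qbin a 0 = 1"
  by (simp add: qbin_def)

lemma qbin_eq_0: "b > a \<Longrightarrow> qbin a b = 0"
proof -
  assume "b > a"
  then have "(\<Prod>i<b. 1 - tt ^ (a - i)) = 0"
    by (intro prod_zero) (auto intro!: bexI [of _ a])
  then show ?thesis by (simp add: qbin_def)
qed

lemma qbin_self [simp]: "qbin a a = 1"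
  by (simp add: qbin_qfac)

text \<open>Of the two Pascal rules this is the one that fits words in \<open>B\<close>: moving a
  lowered letter past \<open>n - k\<close> letters that were kept costs
  \<open>tt ^ (n - k)\<close>.\<close>

lemma qbin_Suc_Suc: "qbin (Suc n) (Suc k) = qbin n (Suc k) + tt ^ (n - k) * qbin n k"
proof -
  consider "k < n" | "k = n" | "k > n" by linarith
  then show ?thesis
  proof cases
    case 1
    then obtain m where n: "n = Suc (k + m)" using less_iff_Suc_add by auto
    have 1: "1 - tt ^ Suc n = (1 - tt ^ Suc m) + tt ^ Suc m * (1 - tt ^ Suc k)"
      by (simp add: n algebra_simps power_add)
    have "qbin (Suc n) (Suc k) = qfac n * (1 - tt ^ Suc n) / (qfac (Suc k) * qfac (Suc m))"
      using 1 by (subst qbin_qfac) (simp_all add: n qfac_Suc)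
    moreover have "qbin n (Suc k) = qfac n * (1 - tt ^ Suc m) / (qfac (Suc k) * qfac (Suc m))"
      using one_minus_tt_power [of "Suc m"] by (subst qbin_qfac) (simp_all add: n qfac_Suc)
    moreover have "qbin n k = qfac n * (1 - tt ^ Suc k) / (qfac (Suc k) * qfac (Suc m))"
      using one_minus_tt_power [of "Suc k"] by (subst qbin_qfac) (simp_all add: n qfac_Suc)
    ultimately show ?thesis unfolding 1
      by (simp add: n add_divide_distrib [symmetric] distrib_left mult.left_commute)
  qed (simp_all add: qbin_eq_0)
qed

lemma qbin_sym: "k \<le> n \<Longrightarrow> qbin n (n - k) = qbin n k"
  by (simp add: qbin_qfac mult.commute)

text \<open>Trinomial revision; in the column sums it isolates the factor that does not depend on
  the summation index.\<close>

lemma qbin_mult: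
  assumes "m \<le> k" "k \<le> n"
  shows "qbin n k * qbin k m = qbin n m * qbin (n - m) (k - m)"
proof -
  have "n - m - (k - m) = n - k" using assms by simp
  then show ?thesis using assms by (simp add: qbin_qfac)
qed

lemma choose_two_Suc: "Suc y choose 2 = (y choose 2) + y"
  by (simp add: numeral_2_eq_2)

text \<open>Applied at a = -1 and a = -t, where the factor i = 0 or i = 1 makes the product vanish
  for s \<ge> 1 or s \<ge> 2. These zeros are behind the inversion formula and behind the
  restriction to horizontal strips.\<close>

lemma q_binomial: "(\<Sum>y\<le>s. qbin s y * tt ^ (y choose 2) * a ^ (s - y)) = (\<Prod>i<s. a + tt ^ i)"
proof (induction s)
  case (Suc s)
  let ?f = "\<lambda>y. qbin s y * tt ^ (y choose 2)"
  have 1: "(\<Sum>y\<le>s. qbin s (Suc y) * tt ^ (Suc y choose 2) * a ^ (s - y)) + a ^ Suc s =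
     a * (\<Sum>y\<le>s. ?f y * a ^ (s - y))"
  proof -
    have "(\<Sum>y\<le>s. qbin s (Suc y) * tt ^ (Suc y choose 2) * a ^ (s - y)) + a ^ Suc s =
       (\<Sum>y\<le>Suc s. ?f y * a ^ (Suc s - y))"
      by (subst sum.atMost_Suc_shift) (simp add: numeral_2_eq_2)
    also have "\<dots> = (\<Sum>y\<le>s. ?f y * a ^ (Suc s - y))"
      by (simp add: qbin_eq_0)
    also have "\<dots> = a * (\<Sum>y\<le>s. ?f y * a ^ (s - y))"
      unfolding sum_distrib_left by (rule sum.cong) (auto simp: Suc_diff_le mult_ac)
    finally show ?thesis .
  qed
  \<comment> \<open>The exponents agree since (s - y) + binomial(y + 1, 2) = s + binomial(y,
    2).\<close>
  have 2: "tt ^ (s - y) * qbin s y * tt ^ (Suc y choose 2) * a ^ (s - y) = tt ^ s * (?f y * a ^ (s - y))"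
    if "y \<le> s" for y
  proof -
    have "tt ^ (s - y) * tt ^ (Suc y choose 2) = tt ^ s * tt ^ (y choose 2)"
      using that by (simp add: power_add [symmetric] choose_two_Suc add.commute)
    then show ?thesis by (simp add: mult_ac)
  qed
  have "(\<Sum>y\<le>Suc s. qbin (Suc s) y * tt ^ (y choose 2) * a ^ (Suc s - y)) =
    a ^ Suc s + (\<Sum>y\<le>s. qbin (Suc s) (Suc y) * tt ^ (Suc y choose 2) * a ^ (s - y))"
    by (subst sum.atMost_Suc_shift) (simp add: numeral_2_eq_2)
  also have "\<dots> = ((\<Sum>y\<le>s. qbin s (Suc y) * tt ^ (Suc y choose 2) * a ^ (s - y)) + a ^ Suc s) +
     (\<Sum>y\<le>s. tt ^ (s - y) * qbin s y * tt ^ (Suc y choose 2) * a ^ (s - y))"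
    by (simp add: qbin_Suc_Suc distrib_right sum.distrib)
  also have "\<dots> = (a + tt ^ s) * (\<Sum>y\<le>s. ?f y * a ^ (s - y))"
    unfolding 1 by (simp add: 2 sum_distrib_left distrib_right sum.distrib)
  finally show ?case unfolding Suc.IH prod.lessThan_Suc by (simp only: mult.commute)
qed (simp add: numeral_2_eq_2)

section \<open>The adjoint Pieri rule for vertical strips\<close>

text \<open>Every letter of the block is kept or lowered, and k lowered letters use up u^k, hence
  the value 0 for k > r. Sorting moves the lowered letters to the right, where the next block
  begins.\<close>

lemma Eop_B_power:
  "Eop r ((B (Suc m) ^^ n) f) = (\<Sum>k\<le>n. cst ((-1) ^ k * qbin n k) *
     (B (Suc m) ^^ (n - k)) ((B m ^^ k) (if k \<le> r then Eop (r - k) f else 0)))"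
proof (induction n arbitrary: r)
  case (Suc n)
  define X where "X r k = (if k \<le> r then Eop (r - k) f else 0)" for r k
  let ?D = "B (Suc m)"
  let ?T = "\<lambda>n k r. (?D ^^ (n - k)) ((B m ^^ k) (X r k))"
  have IH: "Eop r ((?D ^^ n) f) = (\<Sum>k\<le>n. cst ((-1) ^ k * qbin n k) * ?T n k r)" for r
    using Suc [of r] by (simp add: X_def)
  have A: "?D (Eop r ((?D ^^ n) f)) = (\<Sum>k\<le>n. cst ((-1) ^ k * qbin n k) * ?T (Suc n) k r)"
    unfolding IH by (auto simp: lin_sum [OF lin_B] lin_cst [OF lin_B] Suc_diff_le intro!: sum.cong)
  have C: "(if r = 0 then 0 else B m (Eop (r - 1) ((?D ^^ n) f))) =
      (\<Sum>k\<le>n. cst ((-1) ^ k * (tt ^ (n - k) * qbin n k)) * ?T (Suc n) (Suc k) r)"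
  proof (cases "r = 0")
    case True
    then show ?thesis by (simp add: X_def lin_0 [OF lin_funpow [OF lin_B]] lin_0 [OF lin_B])
  next
    case False
    have "B m (Eop (r - 1) ((?D ^^ n) f)) =
       (\<Sum>k\<le>n. cst ((-1) ^ k * qbin n k) * B m ((?D ^^ (n - k)) ((B m ^^ k) (X (r - 1) k))))"
      unfolding IH by (simp only: lin_sum [OF lin_B] lin_cst [OF lin_B])
    also have "\<dots> = (\<Sum>k\<le>n. cst ((-1) ^ k * (tt ^ (n - k) * qbin n k)) * ?T (Suc n) (Suc k) r)"
    proof (rule sum.cong [OF refl])
      fix k
      have "X (r - 1) k = X r (Suc k)" using False by (auto simp: X_def)
      then have "B m ((?D ^^ (n - k)) ((B m ^^ k) (X (r - 1) k))) = cst (tt ^ (n - k)) * ?T (Suc n) (Suc k) r"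
        by (simp add: B_straighten_power)
      then show "cst ((-1) ^ k * qbin n k) * B m ((?D ^^ (n - k)) ((B m ^^ k) (X (r - 1) k))) =
         cst ((-1) ^ k * (tt ^ (n - k) * qbin n k)) * ?T (Suc n) (Suc k) r"
        by (simp only: cst_mult mult_ac)
    qed
    finally show ?thesis using False by simp
  qed
  have "(\<Sum>k\<le>n. cst ((-1) ^ k * qbin n k) * ?T (Suc n) k r) =
      (\<Sum>k\<le>Suc n. cst ((-1) ^ k * qbin n k) * ?T (Suc n) k r)"
    by (simp add: qbin_eq_0)
  also have "\<dots> = ?T (Suc n) 0 r + (\<Sum>k\<le>n. cst ((-1) ^ Suc k * qbin n (Suc k)) * ?T (Suc n) (Suc k) r)"
    by (subst sum.atMost_Suc_shift) simp
  finally have A': "?D (Eop r ((?D ^^ n) f)) =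
      ?T (Suc n) 0 r + (\<Sum>k\<le>n. cst ((-1) ^ Suc k * qbin n (Suc k)) * ?T (Suc n) (Suc k) r)"
    using A by simp
  have "Eop r ((?D ^^ Suc n) f) = ?D (Eop r ((?D ^^ n) f)) - (if r = 0 then 0 else B m (Eop (r - 1) ((?D ^^ n) f)))"
    by (simp add: Eop_B)
  also have "\<dots> = ?T (Suc n) 0 r + (\<Sum>k\<le>n. cst ((-1) ^ Suc k * qbin (Suc n) (Suc k)) * ?T (Suc n) (Suc k) r)"
    unfolding A' C
    by (simp only: add_diff_eq [symmetric] sum_subtractf [symmetric] left_diff_distrib [symmetric] cst_diff [symmetric])
      (simp only: qbin_Suc_Suc power_Suc distrib_left mult_minus_left mult_1_left minus_add_distrib diff_conv_add_uminus)
  also have "\<dots> = (\<Sum>k\<le>Suc n. cst ((-1) ^ k * qbin (Suc n) k) * ?T (Suc n) k r)"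
    by (subst sum.atMost_Suc_shift) simp
  finally show ?case by (simp only: X_def)
qed simp

text \<open>W J c is the product of the operators B_j over the parts j of the partition with columns
  c 1, ..., c J, the largest parts leftmost; the value c (J + 1) is subtracted from all columns.\<close>

fun W :: "nat \<Rightarrow> (nat \<Rightarrow> nat) \<Rightarrow> sym" where
  "W 0 c = 1"
| "W (Suc J) c = (B (Suc J) ^^ (c (Suc J) - c (Suc (Suc J)))) (W J c)"

lemma W_cong: "(\<And>j. 1 \<le> j \<Longrightarrow> j \<le> Suc J \<Longrightarrow> c j = d j) \<Longrightarrow> W J c = W J d"
  by (induction J) auto

text \<open>Letters lowered from J + 1 to J join the block of letters J. As \<open>W\<close>
  subtracts the value at J + 1, absorbing k of them only lowers that value by k. For J = 0 the
  letters are absorbed by 1.\<close>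

lemma B_power_W:
  assumes "k \<le> z" "J \<ge> 1 \<Longrightarrow> z \<le> y J"
  shows "(B J ^^ k) (W J (y(Suc J := z))) = W J (y(Suc J := z - k))"
proof (cases J)
  case 0
  have "(B 0 ^^ k) 1 = 1"
    by (induction k) (simp_all add: B_0_one)
  then show ?thesis using 0 by simp
next
  case (Suc i)
  have 1: "W i (y(Suc J := z)) = W i (y(Suc J := z - k))"
    by (rule W_cong) (auto simp: Suc)
  have "y J - (z - k) = k + (y J - z)" using assms Suc by auto
  then show ?thesis using 1 by (simp add: Suc funpow_add)
qed

lemma sum_PiE_insert:
  assumes "x \<notin> S"
  shows "(\<Sum>g\<in>PiE (insert x S) T. F g) = (\<Sum>v\<in>T x. \<Sum>g\<in>PiE S T. F (g(x := v)))"
proof -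
  have "(\<Sum>g\<in>PiE (insert x S) T. F g) = (\<Sum>p\<in>T x \<times> PiE S T. F (case p of (v, g) \<Rightarrow> g(x := v)))"
    unfolding PiE_insert_eq using inj_combinator [OF assms, of T] by (simp add: sum.reindex)
  also have "\<dots> = (\<Sum>v\<in>T x. \<Sum>g\<in>PiE S T. F (g(x := v)))"
    by (simp add: sum.cartesian_product split_def)
  finally show ?thesis .
qed

text \<open>Of the c_j - c_{j+1} parts equal to j, c_j - y_j are lowered, so y lists the new
  columns. Functions in \<open>PiE\<close> are undefined at J + 1, where \<open>W J\<close> also
  looks; hence the explicit value there.\<close>

lemma Eop_W:
  assumes "\<And>j. 1 \<le> j \<Longrightarrow> j \<le> J \<Longrightarrow> c (Suc j) \<le> c j"
  shows "Eop r (W J c) = (\<Sum>y\<in>PiE {1..J} (\<lambda>j. {c (Suc j)..c j}).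
    if (\<Sum>j=1..J. c j - y j) = r
    then cst ((-1) ^ r * (\<Prod>j=1..J. qbin (c j - c (Suc j)) (c j - y j))) * W J (y(Suc J := c (Suc J)))
    else 0)"
  using assms
proof (induction J arbitrary: r)
  case 0
  then show ?case by (simp add: Eop_def pshift_one)
next
  case (Suc J)
  let ?T = "\<lambda>j. {c (Suc j)..c j}"
  let ?P = "PiE {1..J} ?T"
  let ?z = "c (Suc J)"
  define n where "n = ?z - c (Suc (Suc J))"
  define S where "S y = (\<Sum>j=1..J. c j - y j)" for y
  define p where "p y = (\<Prod>j=1..J. qbin (c j - c (Suc j)) (c j - y j))" for y
  let ?D = "B (Suc J)"
  \<comment> \<open>The contribution of k lowered letters in the top block and of columns y below
    it; column J + 1 then has length \<open>?z - k\<close>.\<close>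
  define G where "G y k = (if S y + k = r then cst ((-1) ^ r * (p y * qbin n k)) *
     (?D ^^ (n - k)) (W J (y(Suc J := ?z - k))) else 0)" for y k
  have IH: "Eop s (W J c) = (\<Sum>y\<in>?P. if S y = s then cst ((-1) ^ s * p y) * W J (y(Suc J := ?z)) else 0)" for s
    unfolding S_def p_def by (rule Suc.IH) (use Suc.prems in auto)
  have "Eop r (W (Suc J) c) = (\<Sum>k\<le>n. cst ((-1) ^ k * qbin n k) *
     (?D ^^ (n - k)) ((B J ^^ k) (if k \<le> r then Eop (r - k) (W J c) else 0)))"
    unfolding W.simps n_def [symmetric] by (rule Eop_B_power)
  also have "\<dots> = (\<Sum>k\<le>n. \<Sum>y\<in>?P. G y k)"
  proof (rule sum.cong [OF refl])
    fix k assume k: "k \<in> {..n}"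
    show "cst ((-1) ^ k * qbin n k) * (?D ^^ (n - k)) ((B J ^^ k) (if k \<le> r then Eop (r - k) (W J c) else 0)) =
      (\<Sum>y\<in>?P. G y k)"
    proof (cases "k \<le> r")
      case False
      then have "G y k = 0" for y by (auto simp: G_def)
      then show ?thesis using False by (simp add: lin_0 [OF lin_funpow [OF lin_B]])
    next
      case True
      have "(B J ^^ k) (W J (y(Suc J := ?z))) = W J (y(Suc J := ?z - k))" if "y \<in> ?P" for y
      proof (rule B_power_W)
        show "k \<le> ?z" using k by (auto simp: n_def)
        show "?z \<le> y J" if "J \<ge> 1" using PiE_mem [OF \<open>y \<in> ?P\<close>, of J] that by simp
      qed
      then have "(B J ^^ k) (Eop (r - k) (W J c)) =
         (\<Sum>y\<in>?P. if S y = r - k then cst ((-1) ^ (r - k) * p y) * W J (y(Suc J := ?z - k)) else 0)"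
        unfolding IH
        by (auto simp: lin_sum [OF lin_funpow [OF lin_B]] lin_cst [OF lin_funpow [OF lin_B]]
             lin_0 [OF lin_funpow [OF lin_B]] intro!: sum.cong)
      then have "cst ((-1) ^ k * qbin n k) * (?D ^^ (n - k)) ((B J ^^ k) (Eop (r - k) (W J c))) =
        (\<Sum>y\<in>?P. if S y = r - k then cst ((-1) ^ k * qbin n k) * (cst ((-1) ^ (r - k) * p y) *
           (?D ^^ (n - k)) (W J (y(Suc J := ?z - k)))) else 0)"
        by (auto simp: lin_sum [OF lin_funpow [OF lin_B]] lin_cst [OF lin_funpow [OF lin_B]]
             lin_0 [OF lin_funpow [OF lin_B]] sum_distrib_left intro!: sum.cong)
      also have "\<dots> = (\<Sum>y\<in>?P. G y k)"
      proof (rule sum.cong [OF refl])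
        fix y
        have "(-1) ^ r = (-1 :: coef) ^ k * (-1) ^ (r - k)"
          using True by (simp add: power_add [symmetric])
        then have "cst ((-1) ^ k * qbin n k) * (cst ((-1) ^ (r - k) * p y) * x) =
            cst ((-1) ^ r * (p y * qbin n k)) * x" for x
          by (simp only: cst_mult mult_ac)
        moreover have "S y = r - k \<longleftrightarrow> S y + k = r" using True by auto
        ultimately show "(if S y = r - k then cst ((-1) ^ k * qbin n k) * (cst ((-1) ^ (r - k) * p y) *
           (?D ^^ (n - k)) (W J (y(Suc J := ?z - k)))) else 0) = G y k"
          by (simp only: G_def)
      qed
      finally show ?thesis using True by simp
    qed
  qed
  \<comment> \<open>The number k of lowered letters is replaced by the new length v =
    \<open>?z - k\<close> of column J + 1.\<close>
  also have "\<dots> = (\<Sum>v\<in>{c (Suc (Suc J))..?z}. \<Sum>y\<in>?P. G y (?z - v))"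
    by (rule sum.reindex_bij_witness [where i = "\<lambda>v. ?z - v" and j = "\<lambda>k. ?z - k"])
      (use Suc.prems [of "Suc J"] in \<open>auto simp: n_def\<close>)
  also have "\<dots> = (\<Sum>v\<in>?T (Suc J). \<Sum>y\<in>?P.
     if (\<Sum>j=1..Suc J. c j - (y(Suc J := v)) j) = r
     then cst ((-1) ^ r * (\<Prod>j=1..Suc J. qbin (c j - c (Suc j)) (c j - (y(Suc J := v)) j))) *
       W (Suc J) ((y(Suc J := v))(Suc (Suc J) := c (Suc (Suc J))))
     else 0)"
  proof (intro sum.cong refl)
    fix v y assume v: "v \<in> ?T (Suc J)" and y: "y \<in> ?P"
    have "(\<Sum>j=1..J. c j - (y(Suc J := v)) j) = S y"
      unfolding S_def by (rule sum.cong) auto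
    then have 1: "(\<Sum>j=1..Suc J. c j - (y(Suc J := v)) j) = S y + (?z - v)"
      by simp
    have "(\<Prod>j=1..J. qbin (c j - c (Suc j)) (c j - (y(Suc J := v)) j)) = p y"
      unfolding p_def by (rule prod.cong) auto
    then have 2: "(\<Prod>j=1..Suc J. qbin (c j - c (Suc j)) (c j - (y(Suc J := v)) j)) = p y * qbin n (?z - v)"
      by (simp add: n_def)
    have 3: "W J ((y(Suc J := v))(Suc (Suc J) := c (Suc (Suc J)))) = W J (y(Suc J := ?z - (?z - v)))"
      using v by (intro W_cong) auto
    have "n - (?z - v) = v - c (Suc (Suc J))" using v by (auto simp: n_def)
    then have 4: "W (Suc J) ((y(Suc J := v))(Suc (Suc J) := c (Suc (Suc J)))) =
        (?D ^^ (n - (?z - v))) (W J (y(Suc J := ?z - (?z - v))))"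
      unfolding W.simps 3 by simp
    show "G y (?z - v) = (if (\<Sum>j=1..Suc J. c j - (y(Suc J := v)) j) = r
     then cst ((-1) ^ r * (\<Prod>j=1..Suc J. qbin (c j - c (Suc j)) (c j - (y(Suc J := v)) j))) *
       W (Suc J) ((y(Suc J := v))(Suc (Suc J) := c (Suc (Suc J))))
     else 0)"
      unfolding 1 2 4 G_def ..
  qed
  also have "\<dots> = (\<Sum>y\<in>PiE (insert (Suc J) {1..J}) ?T.
    if (\<Sum>j=1..Suc J. c j - y j) = r
    then cst ((-1) ^ r * (\<Prod>j=1..Suc J. qbin (c j - c (Suc j)) (c j - y j))) *
      W (Suc J) (y(Suc (Suc J) := c (Suc (Suc J))))
    else 0)"
    by (rule sum_PiE_insert [symmetric]) simp
  also have "insert (Suc J) {1..J} = {1..Suc J}" by auto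
  finally show ?case .
qed

lemma homog_B_power: "homog d f \<Longrightarrow> homog (m * n + d) ((B m ^^ n) f)"
proof (induction n)
  case (Suc n)
  then show ?case using homog_B [of "m * n + d" "(B m ^^ n) f" m] by (simp add: add.assoc)
qed simp

lemma homog_W: "homog (\<Sum>j=1..J. j * (c j - c (Suc j))) (W J c)"
proof (induction J)
  case (Suc J)
  then show ?case
    using homog_B_power [OF Suc, of "Suc J" "c (Suc J) - c (Suc (Suc J))"] by (simp add: add.commute)
qed simp

section \<open>Partitions and their columns\<close>

lemma is_partition_Nil [simp]: "is_partition []"
  by (simp add: is_partition_def)

lemma is_partition_Cons: "is_partition (a # l) \<longleftrightarrow> is_partition l \<and> a \<noteq> 0 \<and> (\<forall>x\<in>set l. x \<le> a)"
  by (auto simp: is_partition_def)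

lemma conj_Nil [simp]: "conj [] j = 0"
  by (simp add: conj_def)

lemma conj_Cons: "conj (a # l) j = (if j \<le> a then Suc (conj l j) else conj l j)"
  by (simp add: conj_def)

lemma part_0 [simp]: "part l 0 = 0"
  by (simp add: part_def)

lemma part_Nil [simp]: "part [] i = 0"
  by (simp add: part_def)

lemma part_Cons: "part (a # l) (Suc i) = (if i = 0 then a else part l i)"
  by (auto simp: part_def nth_Cons')

lemma conj_antimono: "j \<le> k \<Longrightarrow> conj l k \<le> conj l j"
  by (induction l) (auto simp: conj_Cons)

lemma conj_eq_0: "(\<forall>x\<in>set l. x < j) \<Longrightarrow> conj l j = 0"
  by (induction l) (auto simp: conj_Cons)

text \<open>Both sides say that the diagram has a box in row i and column j. Row conditions in the
  definitions are translated to columns through this equivalence.\<close>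

lemma le_part_iff_le_conj:
  assumes "is_partition l" "i \<ge> 1" "j \<ge> 1"
  shows "j \<le> part l i \<longleftrightarrow> i \<le> conj l j"
  using assms
proof (induction l arbitrary: i)
  case (Cons a l)
  obtain k where i: "i = Suc k" using Cons.prems by (cases i) auto
  show ?case
  proof (cases "j \<le> a")
    case True
    then show ?thesis using Cons i by (cases "k = 0") (auto simp: part_Cons conj_Cons is_partition_Cons)
  next
    case False
    have "conj l j = 0" using Cons.prems False by (intro conj_eq_0) (auto simp: is_partition_Cons)
    then show ?thesis using False i Cons by (cases "k = 0") (auto simp: part_Cons conj_Cons is_partition_Cons)
  qed
qed auto

lemma conj_beyond: "is_partition l \<Longrightarrow> j > part l 1 \<Longrightarrow> conj l j = 0"
  using le_part_iff_le_conj [of l 1 j] by (cases "conj l j") auto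

lemma le_by_lower:
  fixes a b :: nat
  assumes "\<And>i. i \<ge> 1 \<Longrightarrow> i \<le> a \<Longrightarrow> i \<le> b"
  shows "a \<le> b"
  using assms [of a] by (cases a) auto

lemma contained_iff_conj:
  assumes "is_partition mu" "is_partition lam"
  shows "contained mu lam \<longleftrightarrow> (\<forall>j\<ge>1. conj mu j \<le> conj lam j)"
proof
  assume c: "contained mu lam"
  show "\<forall>j\<ge>1. conj mu j \<le> conj lam j"
  proof (intro allI impI, rule le_by_lower)
    fix j i assume ij: "(1::nat) \<le> j" "1 \<le> i" "i \<le> conj mu j"
    then have "j \<le> part mu i" using assms le_part_iff_le_conj [of mu i j] by simp
    also have "\<dots> \<le> part lam i" using c by (simp add: contained_def)
    finally show "i \<le> conj lam j" using assms ij le_part_iff_le_conj [of lam i j] by simp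
  qed
next
  assume c: "\<forall>j\<ge>1. conj mu j \<le> conj lam j"
  show "contained mu lam"
    unfolding contained_def
  proof (intro allI)
    fix i
    show "part mu i \<le> part lam i"
    proof (cases "i = 0")
      case False
      show ?thesis
      proof (rule le_by_lower)
        fix j assume j: "1 \<le> j" "j \<le> part mu i"
        then have "i \<le> conj mu j" using assms False le_part_iff_le_conj [of mu i j] by simp
        also have "\<dots> \<le> conj lam j" using c j by simp
        finally show "j \<le> part lam i" using assms j False le_part_iff_le_conj [of lam i j] by simp
      qed
    qed simp
  qed
qed

text \<open>At most one box in each row means that the columns interlace. In this form the condition
  bounds each column of mu by data of lam alone.\<close>

lemma vert_strip_iff_conj:
  assumes "is_partition lam" "is_partition mu"
  shows "vert_strip lam mu \<longleftrightarrow> (\<forall>j\<ge>1. conj lam (Suc j) \<le> conj mu j)"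
proof
  assume c: "vert_strip lam mu"
  show "\<forall>j\<ge>1. conj lam (Suc j) \<le> conj mu j"
  proof (intro allI impI, rule le_by_lower)
    fix j i assume ij: "(1::nat) \<le> j" "1 \<le> i" "i \<le> conj lam (Suc j)"
    then have "Suc j \<le> part lam i" using assms le_part_iff_le_conj [of lam i "Suc j"] by simp
    moreover have "part lam i \<le> part mu i + 1" using c ij by (auto simp: vert_strip_def)
    ultimately show "i \<le> conj mu j" using assms ij le_part_iff_le_conj [of mu i j] by simp
  qed
next
  assume c: "\<forall>j\<ge>1. conj lam (Suc j) \<le> conj mu j"
  show "vert_strip lam mu"
    unfolding vert_strip_def
  proof (intro allI impI, rule le_by_lower)
    fix i k assume ik: "(1::nat) \<le> i" "1 \<le> k" "k \<le> part lam i"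
    show "k \<le> part mu i + 1"
    proof (cases "k = 1")
      case False
      then obtain j where j: "k = Suc j" "j \<ge> 1" using ik by (cases k) auto
      then have "i \<le> conj lam (Suc j)" using ik assms le_part_iff_le_conj [of lam i k] by simp
      then have "i \<le> conj mu j" using c j le_trans by blast
      then show ?thesis using j ik assms le_part_iff_le_conj [of mu i j] by simp
    qed simp
  qed
qed

lemma conj_Suc_count: "conj l j = count_list l j + conj l (Suc j)"
  by (induction l) (auto simp: conj_Cons)

lemma mult_conj: "mult l j = conj l j - conj l (Suc j)"
  using conj_Suc_count [of l j] by (simp add: mult_def)

lemma part_le_psize: "part l i \<le> psize l"
  by (auto simp: part_def psize_def intro: member_le_sum_list)

lemma sum_conj_aux: "(\<forall>x\<in>set l. x \<le> J) \<Longrightarrow> sum_list l = (\<Sum>j=1..J. conj l j)"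
proof (induction l)
  case (Cons a l)
  have "(\<Sum>j=1..J. if j \<le> a then (1::nat) else 0) = (\<Sum>j\<in>{1..a}. 1)"
    using Cons.prems by (intro sum.mono_neutral_cong_right) auto
  then have "a = (\<Sum>j=1..J. if j \<le> a then 1 else 0)" by simp
  moreover have "(\<Sum>j=1..J. conj (a # l) j) = (\<Sum>j=1..J. conj l j) + (\<Sum>j=1..J. if j \<le> a then 1 else 0)"
    unfolding sum.distrib [symmetric] by (rule sum.cong) (auto simp: conj_Cons)
  ultimately show ?case using Cons by simp
qed simp

lemma set_le_part_1: "is_partition l \<Longrightarrow> x \<in> set l \<Longrightarrow> x \<le> part l 1"
  by (cases l) (auto simp: is_partition_Cons part_def)

lemma psize_conj: "is_partition l \<Longrightarrow> part l 1 \<le> J \<Longrightarrow> psize l = (\<Sum>j=1..J. conj l j)"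
  unfolding psize_def by (rule sum_conj_aux) (meson le_trans set_le_part_1)

lemma partition_eqI:
  assumes "is_partition l" "is_partition m" "\<And>j. j \<ge> 1 \<Longrightarrow> conj l j = conj m j"
  shows "l = m"
proof -
  have "mset l = mset m"
  proof (rule multiset_eqI)
    fix x
    show "count (mset l) x = count (mset m) x"
    proof (cases "x = 0")
      case True
      have "0 \<notin># mset l" "0 \<notin># mset m"
        using assms by (auto simp: is_partition_def)
      then show ?thesis unfolding True by (simp only: not_in_iff)
    next
      case False
      then show ?thesis using assms(3) [of x] assms(3) [of "Suc x"] conj_Suc_count [of l x] conj_Suc_count [of m x]
        by (simp add: count_mset)
    qed
  qed
  then have "mset (rev l) = mset (rev m)" by simp
  moreover have "sorted (rev l)" "sorted (rev m)"
    using assms by (auto simp: is_partition_def sorted_wrt_rev)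
  ultimately have "rev l = rev m" using properties_for_sort sorted_sort_id by metis
  then show ?thesis by simp
qed

lemma ex_partition_conj:
  assumes "\<And>j. j \<ge> 1 \<Longrightarrow> c (Suc j) \<le> c j" "\<And>j. j > J \<Longrightarrow> c j = 0"
  shows "\<exists>l. is_partition l \<and> (\<forall>j\<ge>1. conj l j = c j)"
proof -
  \<comment> \<open>The parts larger than K are still missing at this stage, so each column is too
    short by exactly c_{K+1}.\<close>
  have "\<exists>l. is_partition l \<and> (\<forall>x\<in>set l. x \<le> K) \<and> (\<forall>j\<ge>1. conj l j = (if j \<le> K then c j - c (Suc K) else 0))" for K
  proof (induction K)
    case 0
    show ?case by (rule exI [of _ "[]"]) auto
  next
    case (Suc K)
    then obtain l where l: "is_partition l" "\<forall>x\<in>set l. x \<le> K"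
      "\<And>j. j \<ge> 1 \<Longrightarrow> conj l j = (if j \<le> K then c j - c (Suc K) else 0)" by auto
    define n where "n = c (Suc K) - c (Suc (Suc K))"
    have "sorted_wrt (\<ge>) (replicate n (Suc K))" by (induction n) auto
    then have 1: "is_partition (replicate n (Suc K) @ l)"
      using l by (auto simp: is_partition_def sorted_wrt_append)
    have 2: "conj (replicate n (Suc K) @ l) j = (if j \<le> Suc K then n else 0) + conj l j" for j
      by (simp add: conj_def)
    have dec: "c (Suc K) \<le> c j" if "1 \<le> j" "j \<le> Suc K" for j
      using that(2) that(1)
    proof (induction j rule: inc_induct)
      case (step j)
      then show ?case using assms(1) [of j] by simp
    qed simp
    have dec2: "c (Suc (Suc K)) \<le> c (Suc K)" using assms(1) by simp
    show ?case
    proof (rule exI [of _ "replicate n (Suc K) @ l"], intro conjI allI impI 1)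
      show "\<forall>x\<in>set (replicate n (Suc K) @ l). x \<le> Suc K" using l by auto
      fix j :: nat assume "j \<ge> 1"
      then show "conj (replicate n (Suc K) @ l) j = (if j \<le> Suc K then c j - c (Suc (Suc K)) else 0)"
        unfolding 2 using l(3) [of j] dec [of j] dec2 by (auto simp: n_def le_Suc_eq)
    qed
  qed
  from this [of J] assms(2) show ?thesis
    by (metis diff_zero lessI not_le)
qed

lemma finite_partitions_le: "finite {l. is_partition l \<and> psize l \<le> n}"
proof (rule finite_subset)
  show "{l. is_partition l \<and> psize l \<le> n} \<subseteq> {xs. set xs \<subseteq> {..n} \<and> length xs \<le> n}"
  proof
    fix l assume "l \<in> {l. is_partition l \<and> psize l \<le> n}"
    then have l: "0 \<notin> set l" "sum_list l \<le> n" by (auto simp: is_partition_def psize_def)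
    have "length l \<le> sum_list l" using l(1) by (induction l) auto
    moreover have "x \<le> n" if "x \<in> set l" for x using member_le_sum_list [OF that] l by simp
    ultimately show "l \<in> {xs. set xs \<subseteq> {..n} \<and> length xs \<le> n}" using l by auto
  qed
qed (rule finite_lists_length_le, simp)

lemma finite_partitions_of [simp]: "finite (partitions_of n)"
  by (rule finite_subset [OF _ finite_partitions_le [of n]]) (auto simp: partitions_of_def psize_def)

lemma contained_psize:
  assumes "is_partition mu" "is_partition lam" "contained mu lam"
  shows "psize mu \<le> psize lam"
proof -
  let ?J = "max (part mu 1) (part lam 1)"
  have "(\<Sum>j=1..?J. conj mu j) \<le> (\<Sum>j=1..?J. conj lam j)"
    using assms by (intro sum_mono) (auto simp: contained_iff_conj)
  then show ?thesis using psize_conj [of mu ?J] psize_conj [of lam ?J] assms by simp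
qed

lemma finite_contained [simp]: "finite {nu. is_partition nu \<and> contained nu lam \<and> P nu}" if "is_partition lam"
  by (rule finite_subset [OF _ finite_partitions_le [of "psize lam"]]) (use that contained_psize in auto)

lemma contained_refl [simp]: "contained l l"
  by (simp add: contained_def)

lemma contained_trans: "contained a b \<Longrightarrow> contained b c \<Longrightarrow> contained a c"
  unfolding contained_def by (meson order_trans)

lemma contained_Nil [simp]: "contained [] l"
  by (simp add: contained_def)

lemma contained_part_1: "contained mu lam \<Longrightarrow> part mu 1 \<le> part lam 1"
  by (simp add: contained_def)

lemma contained_eqI:
  assumes "is_partition mu" "is_partition lam" "contained mu lam" "psize mu = psize lam"
  shows "mu = lam"
proof (rule partition_eqI [OF assms(1,2)])
  fix j :: nat assume j: "j \<ge> 1"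
  let ?J = "max j (part lam 1)"
  have le: "conj mu j \<le> conj lam j" if "j \<in> {1..?J}" for j
    using that assms by (auto simp: contained_iff_conj)
  have "psize mu = (\<Sum>j=1..?J. conj mu j)" "psize lam = (\<Sum>j=1..?J. conj lam j)"
    using assms contained_part_1 [OF assms(3)] by (intro psize_conj; simp)+
  then have eq: "(\<Sum>j=1..?J. conj mu j) = (\<Sum>j=1..?J. conj lam j)" using assms(4) by simp
  show "conj mu j = conj lam j"
  proof (rule ccontr)
    assume "conj mu j \<noteq> conj lam j"
    then have "conj mu j < conj lam j" using le [of j] j by simp
    then have "(\<Sum>j=1..?J. conj mu j) < (\<Sum>j=1..?J. conj lam j)"
      using le j by (intro sum_strict_mono_ex1) auto
    then show False using eq by simp
  qed
qed

text \<open>The support of \<open>vs lam\<close> above a lower bound mu. The bound [] serves the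
  rule for e_r, a general mu the sums of products of \<open>vs\<close> and
  \<open>sk\<close>.\<close>

definition VS :: "nat list \<Rightarrow> nat list \<Rightarrow> nat list set" where
  "VS lam mu = {nu. is_partition nu \<and> contained mu nu \<and> contained nu lam \<and> vert_strip lam nu}"

text \<open>The upper end of the range for column j + 1 is at most the lower end of the range for
  column j, so every choice of columns is decreasing and the columns are independent of each
  other.\<close>

lemma bij_betw_VS:
  assumes lam: "is_partition lam" and mu: "is_partition mu" and J: "part lam 1 \<le> J"
    and sub: "contained mu lam"
  shows "bij_betw (\<lambda>nu. restrict (conj nu) {1..J}) (VS lam mu)
    (PiE {1..J} (\<lambda>j. {max (conj lam (Suc j)) (conj mu j)..conj lam j}))"
proof (rule bij_betw_imageI)
  have z: "conj nu j = 0" if "is_partition nu" "contained nu lam" "j > J" for nu j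
    using conj_beyond [OF that(1)] contained_part_1 [OF that(2)] that(3) J by auto
  show "inj_on (\<lambda>nu. restrict (conj nu) {1..J}) (VS lam mu)"
  proof (rule inj_onI)
    fix a b assume a: "a \<in> VS lam mu" and b: "b \<in> VS lam mu"
      and eq: "restrict (conj a) {1..J} = restrict (conj b) {1..J}"
    show "a = b"
    proof (rule partition_eqI)
      fix j :: nat assume "j \<ge> 1"
      then show "conj a j = conj b j"
        using fun_cong [OF eq, of j] z [of a j] z [of b j] a b by (cases "j \<le> J") (auto simp: VS_def)
    qed (use a b in \<open>auto simp: VS_def\<close>)
  qed
  show "(\<lambda>nu. restrict (conj nu) {1..J}) ` VS lam mu =
      PiE {1..J} (\<lambda>j. {max (conj lam (Suc j)) (conj mu j)..conj lam j})" (is "_ = ?P")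
  proof (intro set_eqI iffI)
    fix y assume "y \<in> (\<lambda>nu. restrict (conj nu) {1..J}) ` VS lam mu"
    then show "y \<in> ?P"
      using lam mu by (auto simp: VS_def vert_strip_iff_conj contained_iff_conj)
  next
    fix y assume y: "y \<in> ?P"
    define c where "c j = (if j \<le> J then y j else 0)" for j
    have b: "conj lam (Suc j) \<le> y j" "conj mu j \<le> y j" "y j \<le> conj lam j" if "1 \<le> j" "j \<le> J" for j
      using PiE_mem [OF y, of j] that by auto
    have "c (Suc j) \<le> c j" if "j \<ge> 1" for j
      using b(1) [of j] b(3) [of "Suc j"] that by (auto simp: c_def)
    then obtain nu where nu: "is_partition nu" "\<And>j. j \<ge> 1 \<Longrightarrow> conj nu j = c j"
      using ex_partition_conj [of c J] by (auto simp: c_def)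
    have "nu \<in> VS lam mu"
      using b nu lam mu z [OF lam contained_refl] z [OF mu sub]
      by (auto simp: VS_def vert_strip_iff_conj contained_iff_conj c_def)
    moreover have "y = restrict (conj nu) {1..J}"
    proof
      fix j
      show "y j = restrict (conj nu) {1..J} j"
        using nu(2) [of j] PiE_arb [OF y, of j] by (auto simp: c_def)
    qed
    ultimately show "y \<in> (\<lambda>nu. restrict (conj nu) {1..J}) ` VS lam mu" by blast
  qed
qed

section \<open>Sums of products of vs and sk\<close>

text \<open>Since binomial(z + 1, 2) = binomial(z, 2) + z, a factor t^n comes out, and the
  q-binomial theorem at a = -1 remains.\<close>

lemma qbin_shifted_sum:
  "(\<Sum>z\<le>n. (- tt) ^ (n - z) * qbin n z * tt ^ (Suc z choose 2)) = (if n = 0 then 1 else 0)"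
proof -
  have "(\<Sum>z\<le>n. (- tt) ^ (n - z) * qbin n z * tt ^ (Suc z choose 2)) =
     (\<Sum>z\<le>n. tt ^ n * (qbin n z * tt ^ (z choose 2) * (-1) ^ (n - z)))"
  proof (rule sum.cong [OF refl])
    fix z assume "z \<in> {..n}"
    then have "tt ^ n = tt ^ (n - z) * tt ^ z" by (simp add: power_add [symmetric])
    moreover have "(- tt) ^ (n - z) = (-1) ^ (n - z) * tt ^ (n - z)"
      by (metis mult_minus1 power_mult_distrib)
    ultimately show "(- tt) ^ (n - z) * qbin n z * tt ^ (Suc z choose 2) =
       tt ^ n * (qbin n z * tt ^ (z choose 2) * (-1) ^ (n - z))"
      by (simp only: choose_two_Suc power_add mult_ac)
  qed
  also have "\<dots> = tt ^ n * (\<Prod>i<n. -1 + tt ^ i)"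
    by (simp only: sum_distrib_left [symmetric] q_binomial)
  also have "\<dots> = (if n = 0 then 1 else 0)"
    by (cases n) (simp_all add: prod.lessThan_Suc_shift del: prod.lessThan_Suc)
  finally show ?thesis .
qed

text \<open>Pascal's rule splits \<open>qbin (N + y) N\<close>. After trinomial revision the part
  with \<open>tt ^ y\<close> is the q-binomial theorem at a = -1 with n + 1 factors and vanishes;
  the other part loses its term y = 0 and turns into \<open>qbin_shifted_sum\<close>.\<close>

lemma qbin_column_sum:
  "(\<Sum>y\<le>Suc n. (- tt) ^ (Suc n - y) * qbin (n + N) (Suc n - y) * tt ^ (y choose 2) * qbin (N + y) N)
    = (if n = 0 then 1 else 0)"
proof (cases N)
  case 0
  have "(\<Sum>y\<le>Suc n. (- tt) ^ (Suc n - y) * qbin n (Suc n - y) * tt ^ (y choose 2)) =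
      (\<Sum>z\<le>n. (- tt) ^ (n - z) * qbin n (n - z) * tt ^ (Suc z choose 2))"
    by (subst sum.atMost_Suc_shift) (simp add: qbin_eq_0)
  also have "\<dots> = (if n = 0 then 1 else 0)"
    unfolding qbin_shifted_sum [symmetric] by (intro sum.cong) (simp_all add: qbin_sym)
  finally show ?thesis using 0 by simp
next
  case (Suc K)
  let ?M = "n + N"
  let ?A = "\<lambda>y. (- tt) ^ (Suc n - y) * qbin ?M (Suc n - y) * tt ^ (y choose 2) * (tt ^ y * qbin (K + y) K)"
  let ?C = "\<lambda>y. (- tt) ^ (Suc n - y) * qbin ?M (Suc n - y) * tt ^ (y choose 2) * qbin (K + y) N"
  have sp: "qbin (N + y) N = qbin (K + y) N + tt ^ y * qbin (K + y) K" for y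
    using qbin_Suc_Suc [of "K + y" K] by (simp add: Suc)
  have A: "?A y = tt ^ Suc n * qbin ?M K * (qbin (Suc n) y * tt ^ (y choose 2) * (-1) ^ (Suc n - y))"
    if y: "y \<le> Suc n" for y
  proof -
    have "qbin ?M (Suc n - y) = qbin ?M (?M - (K + y))" using y Suc by simp
    also have "\<dots> = qbin ?M (K + y)" using y Suc by (intro qbin_sym) simp
    finally have "qbin ?M (Suc n - y) * qbin (K + y) K = qbin ?M K * qbin (Suc n) y"
      using qbin_mult [of K "K + y" ?M] y Suc by simp
    moreover have "tt ^ Suc n = tt ^ (Suc n - y) * tt ^ y" using y by (simp only: power_add [symmetric]) simp
    moreover have "(- tt) ^ (Suc n - y) = (-1) ^ (Suc n - y) * tt ^ (Suc n - y)"
      by (metis mult_minus1 power_mult_distrib)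
    ultimately show ?thesis by (simp only: mult_ac)
  qed
  have "(\<Sum>y\<le>Suc n. ?A y) = tt ^ Suc n * qbin ?M K * (\<Prod>i<Suc n. -1 + tt ^ i)"
    unfolding q_binomial [symmetric] sum_distrib_left by (rule sum.cong [OF refl], rule A) simp
  also have "\<dots> = 0"
    by (simp add: prod.lessThan_Suc_shift del: prod.lessThan_Suc)
  finally have A0: "(\<Sum>y\<le>Suc n. ?A y) = 0" .
  have C: "?C (Suc z) = qbin ?M N * ((- tt) ^ (n - z) * qbin n z * tt ^ (Suc z choose 2))" if z: "z \<le> n" for z
  proof -
    have "qbin ?M (n - z) = qbin ?M (?M - (N + z))" using z by simp
    also have "\<dots> = qbin ?M (N + z)" using z by (intro qbin_sym) simp
    finally have "qbin ?M (n - z) * qbin (N + z) N = qbin ?M N * qbin n z"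
      using qbin_mult [of N "N + z" ?M] z by simp
    moreover have "K + Suc z = N + z" using Suc by simp
    moreover have "?C (Suc z) = ((- tt) ^ (n - z) * tt ^ (Suc z choose 2)) * (qbin ?M (n - z) * qbin (K + Suc z) N)"
      by (simp only: diff_Suc_Suc mult_ac)
    ultimately show ?thesis by (simp only: mult_ac)
  qed
  have "(\<Sum>y\<le>Suc n. ?C y) = (\<Sum>z\<le>n. ?C (Suc z))"
    by (subst sum.atMost_Suc_shift) (simp add: qbin_eq_0 Suc)
  also have "\<dots> = qbin ?M N * (if n = 0 then 1 else 0)"
    unfolding qbin_shifted_sum [symmetric] sum_distrib_left by (rule sum.cong [OF refl], rule C) simp
  finally have "(\<Sum>y\<le>Suc n. ?C y) = (if n = 0 then 1 else 0)" by simp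
  then show ?thesis using A0 by (simp only: sp distrib_left sum.distrib add_0_right)
qed

text \<open>The contribution of one column to the sum over nu: L and m are the lengths of the column in lambda
  and mu, L' and m' the lengths of the next one.\<close>

definition Phi :: "coef \<Rightarrow> nat \<Rightarrow> nat \<Rightarrow> nat \<Rightarrow> nat \<Rightarrow> coef" where
  "Phi s L L' m m' = (\<Sum>x\<in>{max L' m..L}.
     s ^ (L - x) * qbin (L - L') (L - x) * tt ^ ((x - m) choose 2) * qbin (x - m') (m - m'))"

text \<open>The case in which lambda and mu have equal next columns. Trinomial revision isolates the
  binomial coefficient, and the q-binomial theorem in s remains.\<close>

lemma Phi_0:
  assumes "m' \<le> m" "m \<le> L"
  shows "Phi s L m' m m' = qbin (L - m') (m - m') * (\<Prod>i<L - m. s + tt ^ i)"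
proof -
  let ?N = "L - m'"
  have "Phi s L m' m m' = (\<Sum>y\<le>L - m. s ^ (L - m - y) * qbin ?N (L - m - y) * tt ^ (y choose 2) * qbin (m + y - m') (m - m'))"
    unfolding Phi_def
    by (rule sum.reindex_bij_witness [where i = "\<lambda>y. m + y" and j = "\<lambda>x. x - m"]) (use assms in auto)
  also have "\<dots> = (\<Sum>y\<le>L - m. qbin ?N (m - m') * (qbin (L - m) y * tt ^ (y choose 2) * s ^ (L - m - y)))"
  proof (rule sum.cong [OF refl])
    fix y assume y: "y \<in> {..L - m}"
    have "qbin ?N (L - m - y) = qbin ?N (?N - (m + y - m'))" using y assms by simp
    also have "\<dots> = qbin ?N (m + y - m')" using y assms by (intro qbin_sym) auto
    finally have "qbin ?N (L - m - y) * qbin (m + y - m') (m - m') = qbin ?N (m - m') * qbin (L - m) y"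
      using qbin_mult [of "m - m'" "m + y - m'" ?N] y assms by simp
    then show "s ^ (L - m - y) * qbin ?N (L - m - y) * tt ^ (y choose 2) * qbin (m + y - m') (m - m') =
      qbin ?N (m - m') * (qbin (L - m) y * tt ^ (y choose 2) * s ^ (L - m - y))"
      by (simp only: mult_ac)
  qed
  also have "\<dots> = qbin ?N (m - m') * (\<Prod>i<L - m. s + tt ^ i)"
    by (simp only: sum_distrib_left [symmetric] q_binomial)
  finally show ?thesis .
qed

text \<open>The case in which the next column of lambda is one box longer than that of mu, for the
  weight -t.\<close>

lemma Phi_1:
  assumes "m' \<le> m" "m \<le> L" "Suc m' \<le> L"
  shows "Phi (- tt) L (Suc m') m m' = (if L - m \<le> 1 then 1 else 0)"
proof (cases "L = m")
  case True
  then show ?thesis using assms by (simp add: Phi_def numeral_2_eq_2)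
next
  case False
  then obtain n where n: "L - m = Suc n" using assms by (metis Suc_diff_Suc le_neq_implies_less)
  let ?N = "m - m'"
  have L: "L - Suc m' = n + ?N" using n assms by linarith
  have L': "L = m + Suc n" using n by linarith
  \<comment> \<open>The ranges differ only if m = m'; the additional term x = m then contains a
    binomial coefficient whose lower index exceeds the upper one.\<close>
  have "Phi (- tt) L (Suc m') m m' = (\<Sum>x\<in>{m..L}.
     (- tt) ^ (L - x) * qbin (L - Suc m') (L - x) * tt ^ ((x - m) choose 2) * qbin (x - m') (m - m'))"
    unfolding Phi_def using assms n by (intro sum.mono_neutral_left) (auto intro!: qbin_eq_0)
  also have "\<dots> = (\<Sum>y\<le>Suc n. (- tt) ^ (Suc n - y) * qbin (n + ?N) (Suc n - y) * tt ^ (y choose 2) * qbin (?N + y) ?N)"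
    unfolding L
    by (rule sum.reindex_bij_witness [where i = "\<lambda>y. m + y" and j = "\<lambda>x. x - m"])
      (use assms L' in \<open>auto simp: add.commute\<close>)
  also have "\<dots> = (if n = 0 then 1 else 0)"
    by (rule qbin_column_sum)
  finally show ?thesis using n by auto
qed

lemma vs_conj:
  assumes "is_partition lam" "nu \<in> VS lam mu" "part lam 1 \<le> J"
  shows "vs lam nu = (\<Prod>j=1..J. qbin (conj lam j - conj lam (Suc j)) (conj lam j - conj nu j))"
proof -
  have "conj lam j = 0" if "j \<in> {1..J} - {1..part lam 1}" for j
    using conj_beyond [OF assms(1), of j] that by auto
  then have "(\<Prod>j\<in>{1..part lam 1}. qbin (conj lam j - conj lam (j+1)) (conj lam j - conj nu j)) =
    (\<Prod>j=1..J. qbin (conj lam j - conj lam (j+1)) (conj lam j - conj nu j))"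
    using assms by (intro prod.mono_neutral_left) auto
  then show ?thesis using assms by (simp add: vs_def VS_def)
qed

lemma sk_conj:
  assumes "is_partition nu" "is_partition mu" "contained mu nu" "part nu 1 \<le> J"
  shows "sk nu mu = (\<Prod>j=1..J. tt ^ ((conj nu j - conj mu j) choose 2) *
     qbin (conj nu j - conj mu (Suc j)) (conj mu j - conj mu (Suc j)))"
proof -
  have z: "conj nu j = 0" "conj mu j = 0" if "j \<in> {1..J} - {1..part nu 1}" for j
    using conj_beyond [OF assms(1), of j] conj_beyond [OF assms(2), of j] contained_part_1 [OF assms(3)] that by auto
  have "(\<Sum>j\<in>{1..part nu 1}. (conj nu j - conj mu j) choose 2) = (\<Sum>j=1..J. (conj nu j - conj mu j) choose 2)"
    using assms z by (intro sum.mono_neutral_left) (auto simp: numeral_2_eq_2)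
  moreover have "(\<Prod>j\<in>{1..part nu 1}. qbin (conj nu j - conj mu (j+1)) (mult mu j)) =
      (\<Prod>j=1..J. qbin (conj nu j - conj mu (j+1)) (mult mu j))"
    using assms z by (intro prod.mono_neutral_left) (auto simp: mult_conj)
  ultimately show ?thesis
    by (simp add: sk_def power_sum prod.distrib mult_conj)
qed

lemma sum_vs_sk:
  assumes lam: "is_partition lam" and mu: "is_partition mu" and sub: "contained mu lam" and J: "part lam 1 \<le> J"
  shows "(\<Sum>nu\<in>{nu. is_partition nu \<and> contained nu lam \<and> contained mu nu}.
      s ^ (psize lam - psize nu) * vs lam nu * sk nu mu) =
    (\<Prod>j=1..J. Phi s (conj lam j) (conj lam (Suc j)) (conj mu j) (conj mu (Suc j)))"
proof -
  let ?f = "\<lambda>j x. s ^ (conj lam j - x) * qbin (conj lam j - conj lam (Suc j)) (conj lam j - x) *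
     tt ^ ((x - conj mu j) choose 2) * qbin (x - conj mu (Suc j)) (conj mu j - conj mu (Suc j))"
  let ?T = "\<lambda>j. {max (conj lam (Suc j)) (conj mu j)..conj lam j}"
  have "(\<Sum>nu\<in>{nu. is_partition nu \<and> contained nu lam \<and> contained mu nu}.
      s ^ (psize lam - psize nu) * vs lam nu * sk nu mu) =
      (\<Sum>nu\<in>VS lam mu. s ^ (psize lam - psize nu) * vs lam nu * sk nu mu)"
    using lam by (intro sum.mono_neutral_right) (auto simp: VS_def vs_def)
  also have "\<dots> = (\<Sum>nu\<in>VS lam mu. \<Prod>j=1..J. ?f j (restrict (conj nu) {1..J} j))"
  proof (rule sum.cong [OF refl])
    fix nu assume nu: "nu \<in> VS lam mu"
    then have nu': "is_partition nu" "contained nu lam" "contained mu nu" by (auto simp: VS_def)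
    have pn: "part nu 1 \<le> J" using contained_part_1 [OF nu'(2)] J by simp
    have "psize lam - psize nu = (\<Sum>j=1..J. conj lam j) - (\<Sum>j=1..J. conj nu j)"
      using psize_conj [OF lam J] psize_conj [OF nu'(1) pn] by simp
    also have "\<dots> = (\<Sum>j=1..J. conj lam j - conj nu j)"
      using nu' lam by (intro sum_subtractf_nat [symmetric]) (auto simp: contained_iff_conj)
    finally have "s ^ (psize lam - psize nu) = (\<Prod>j=1..J. s ^ (conj lam j - conj nu j))"
      by (simp add: power_sum)
    then have "s ^ (psize lam - psize nu) * vs lam nu * sk nu mu = (\<Prod>j=1..J. ?f j (conj nu j))"
      by (simp add: vs_conj [OF lam nu J] sk_conj [OF nu'(1) mu nu'(3) pn] prod.distrib [symmetric] mult.assoc)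
    then show "s ^ (psize lam - psize nu) * vs lam nu * sk nu mu =
        (\<Prod>j=1..J. ?f j (restrict (conj nu) {1..J} j))"
      by simp
  qed
  also have "\<dots> = (\<Sum>y\<in>PiE {1..J} ?T. \<Prod>j=1..J. ?f j (y j))"
    by (rule sum.reindex_bij_betw [OF bij_betw_VS [OF lam mu J sub]])
  also have "\<dots> = (\<Prod>j=1..J. \<Sum>x\<in>?T j. ?f j x)"
    by (rule prod_sum_PiE [symmetric]) auto
  finally show ?thesis by (simp only: Phi_def)
qed

text \<open>At the last column with the property the next column lacks it, so that
  \<open>Phi_0\<close> or \<open>Phi_1\<close> applies there.\<close>

lemma ex_last_bad:
  assumes "P j" "1 \<le> j" "\<And>j. P j \<Longrightarrow> j \<le> J"
  obtains k where "k \<in> {1..J}" "P k" "\<not> P (Suc k)"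
proof -
  let ?A = "{j. 1 \<le> j \<and> P j}"
  have fin: "finite ?A" by (rule finite_subset [of _ "{..J}"]) (use assms in auto)
  have ne: "?A \<noteq> {}" using assms by auto
  have "Max ?A \<in> ?A" using fin ne by (rule Max_in)
  moreover have "\<not> P (Suc (Max ?A))"
  proof
    assume "P (Suc (Max ?A))"
    then have "Suc (Max ?A) \<le> Max ?A" using fin by (intro Max_ge) auto
    then show False by simp
  qed
  ultimately show ?thesis using that assms by auto
qed

text \<open>At the last column in which lam and mu differ the next columns agree, so
  \<open>Phi_0\<close> applies; for s = -1 its factor i = 0 vanishes.\<close>

lemma sum_vs_sk_inverse:
  assumes lam: "is_partition lam" and mu: "is_partition mu" and sub: "contained mu lam"
  shows "(\<Sum>nu\<in>{nu. is_partition nu \<and> contained nu lam \<and> contained mu nu}.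
      (-1) ^ (psize lam - psize nu) * vs lam nu * sk nu mu) = (if lam = mu then 1 else 0)"
proof -
  let ?J = "part lam 1"
  let ?F = "\<lambda>j. Phi (-1) (conj lam j) (conj lam (Suc j)) (conj mu j) (conj mu (Suc j))"
  have le: "conj mu j \<le> conj lam j" if "j \<ge> 1" for j
    using sub lam mu that by (simp add: contained_iff_conj)
  have "(\<Prod>j=1..?J. ?F j) = (if lam = mu then 1 else 0)"
  proof (cases "lam = mu")
    case True
    then show ?thesis by (simp add: Phi_0 conj_antimono)
  next
    case False
    then obtain j where j: "j \<ge> 1" "conj lam j \<noteq> conj mu j"
      using partition_eqI [OF lam mu] by auto
    obtain k where k: "k \<in> {1..?J}" "1 \<le> k \<and> conj lam k \<noteq> conj mu k" "\<not> (1 \<le> Suc k \<and> conj lam (Suc k) \<noteq> conj mu (Suc k))"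
    proof (rule ex_last_bad [where P = "\<lambda>j. 1 \<le> j \<and> conj lam j \<noteq> conj mu j" and J = ?J])
      fix i assume i: "1 \<le> i \<and> conj lam i \<noteq> conj mu i"
      show "i \<le> ?J"
      proof (rule ccontr)
        assume "\<not> i \<le> ?J"
        then have "conj lam i = 0" using conj_beyond [OF lam] by simp
        then show False using i le [of i] by simp
      qed
    qed (use j in auto)
    have "?F k = qbin (conj lam k - conj mu (Suc k)) (conj mu k - conj mu (Suc k)) *
       (\<Prod>i<conj lam k - conj mu k. -1 + tt ^ i)"
      using k le [of k] by (simp add: Phi_0 conj_antimono)
    moreover have "(\<Prod>i<conj lam k - conj mu k. -1 + tt ^ i) = 0"
      using k le [of k] by (intro prod_zero) (auto intro!: bexI [of _ 0])
    ultimately have "?F k = 0" by simp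
    then have "(\<Prod>j=1..?J. ?F j) = 0" using k(1) by (intro prod_zero) auto
    then show ?thesis using False by simp
  qed
  then show ?thesis using sum_vs_sk [OF lam mu sub order_refl, of "-1"] by simp
qed

text \<open>For a horizontal strip each column falls under \<open>Phi_0\<close> or
  \<open>Phi_1\<close>, according to whether the next columns agree. Otherwise the last column that
  grows by more than one box gives a zero factor: the next one grows by at most one, so one of the
  two formulas still applies.\<close>

lemma sum_vs_sk_hs:
  assumes lam: "is_partition lam" and mu: "is_partition mu" and sub: "contained mu lam"
  shows "(\<Sum>nu\<in>{nu. is_partition nu \<and> contained nu lam \<and> contained mu nu}.
      (- tt) ^ (psize lam - psize nu) * vs lam nu * sk nu mu) = hs lam mu"
proof -
  let ?J = "part lam 1"
  let ?F = "\<lambda>j. Phi (- tt) (conj lam j) (conj lam (Suc j)) (conj mu j) (conj mu (Suc j))"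
  have le: "conj mu j \<le> conj lam j" if "j \<ge> 1" for j
    using sub lam mu that by (simp add: contained_iff_conj)
  have "(\<Prod>j=1..?J. ?F j) = hs lam mu"
  proof (cases "horiz_strip lam mu")
    case True
    have F: "?F j = (if conj lam j = conj mu j + 1 \<and> conj lam (j+1) = conj mu (j+1) then 1 - tt ^ mult lam j else 1)"
      if j: "j \<in> {1..?J}" for j
    proof -
      have a: "conj lam j = conj mu j \<or> conj lam j = Suc (conj mu j)"
        using True [unfolded horiz_strip_def, rule_format, of j] j le [of j] by auto
      have b: "conj lam (Suc j) = conj mu (Suc j) \<or> conj lam (Suc j) = Suc (conj mu (Suc j))"
        using True [unfolded horiz_strip_def, rule_format, of "Suc j"] le [of "Suc j"] by auto
      have c: "conj mu (Suc j) \<le> conj mu j" "conj lam (Suc j) \<le> conj lam j"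
        by (simp_all add: conj_antimono)
      show ?thesis
      proof (cases "conj lam (Suc j) = conj mu (Suc j)")
        case True
        show ?thesis
        proof (cases "conj lam j = conj mu j")
          case eq: True
          then show ?thesis using True c by (simp add: Phi_0)
        next
          case False
          then have L: "conj lam j = Suc (conj mu j)" using a by simp
          let ?N = "conj mu j - conj mu (Suc j)"
          \<comment> \<open>The factor 1 - t from the product cancels the denominator of the
            binomial coefficient and leaves 1 - t^(N+1).\<close>
          have "?F j = qbin (Suc ?N) ?N * (1 - tt)"
            using True L c by (simp add: Phi_0 Suc_diff_le)
          also have "qbin (Suc ?N) ?N = qbin (Suc ?N) 1"
            using qbin_sym [of 1 "Suc ?N"] by simp
          also have "qbin (Suc ?N) 1 * (1 - tt) = 1 - tt ^ Suc ?N"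
            using one_minus_tt_power [of 1] by (simp add: qbin_def lessThan_Suc)
          also have "Suc ?N = mult lam j"
            using True L c by (simp add: mult_conj Suc_diff_le)
          finally show ?thesis using True L by simp
        qed
      next
        case False
        then have d: "conj lam (Suc j) = Suc (conj mu (Suc j))" using b by simp
        have "?F j = 1" unfolding d using a c d by (subst Phi_1) auto
        then show ?thesis using False by simp
      qed
    qed
    have "(\<Prod>j=1..?J. ?F j) =
      (\<Prod>j=1..?J. if conj lam j = conj mu j + 1 \<and> conj lam (j+1) = conj mu (j+1) then 1 - tt ^ mult lam j else 1)"
      by (rule prod.cong [OF refl]) (rule F)
    also have "\<dots> = hs lam mu"
      unfolding hs_def if_P [OF True] by (rule prod.inter_filter [symmetric]) simp
    finally show ?thesis .
  next
    case False
    then obtain j where j: "j \<ge> 1" "conj lam j > conj mu j + 1" by (auto simp: horiz_strip_def not_le)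
    obtain k where k: "k \<in> {1..?J}" "conj lam k > conj mu k + 1" "\<not> conj lam (Suc k) > conj mu (Suc k) + 1"
    proof (rule ex_last_bad [where P = "\<lambda>j. conj lam j > conj mu j + 1" and J = ?J])
      fix i assume i: "conj lam i > conj mu i + 1"
      show "i \<le> ?J"
      proof (rule ccontr)
        assume "\<not> i \<le> ?J"
        then have "conj lam i = 0" using conj_beyond [OF lam] by simp
        then show False using i by simp
      qed
    qed (use j in auto)
    have c: "conj mu (Suc k) \<le> conj mu k" "conj lam (Suc k) \<le> conj lam k"
      by (simp_all add: conj_antimono)
    have "conj lam (Suc k) = conj mu (Suc k) \<or> conj lam (Suc k) = Suc (conj mu (Suc k))"
      using k le [of "Suc k"] by force
    then have "?F k = 0"
    proof
      assume e: "conj lam (Suc k) = conj mu (Suc k)"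
      have "(\<Prod>i<conj lam k - conj mu k. - tt + tt ^ i) = 0"
        using k by (intro prod_zero) (auto intro!: bexI [of _ 1])
      then show ?thesis unfolding e using c k by (subst Phi_0) auto
    next
      assume e: "conj lam (Suc k) = Suc (conj mu (Suc k))"
      then show ?thesis unfolding e using c k by (subst Phi_1) auto
    qed
    then have "(\<Prod>j=1..?J. ?F j) = 0" using k(1) by (intro prod_zero) auto
    then show ?thesis using False by (simp add: hs_def)
  qed
  then show ?thesis using sum_vs_sk [OF lam mu sub order_refl, of "- tt"] by simp
qed

section \<open>Pieri rules for the functions built from vertex operators\<close>

text \<open>The vertex operator word for Q_lambda. Here \<open>psize lam\<close> only serves as a
  bound for the largest part; by \<open>W_eq_Qv\<close> every other bound gives the same
  element.\<close>

definition Qv :: "nat list \<Rightarrow> sym" where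
  "Qv lam = W (psize lam) (conj lam)"

abbreviation below :: "nat list \<Rightarrow> nat list set" where
  "below lam \<equiv> {nu. is_partition nu \<and> contained nu lam}"

abbreviation between :: "nat list \<Rightarrow> nat list \<Rightarrow> nat list set" where
  "between lam mu \<equiv> {nu. is_partition nu \<and> contained nu lam \<and> contained mu nu}"

lemma finite_below [simp]: "is_partition lam \<Longrightarrow> finite (below lam)"
  using finite_contained [of lam "\<lambda>_. True"] by simp

lemma W_eq_Qv:
  assumes "is_partition lam" "part lam 1 \<le> J"
  shows "W J (conj lam) = Qv lam"
proof -
  have *: "W K (conj lam) = W (part lam 1) (conj lam)" if "part lam 1 \<le> K" for K
    using that
  proof (induction K rule: dec_induct)
    case (step K)
    then show ?case using conj_beyond [OF assms(1), of "Suc K"] by simp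
  qed simp
  show ?thesis unfolding Qv_def using *[OF assms(2)] *[OF part_le_psize] by simp
qed

lemma homog_Qv: "is_partition lam \<Longrightarrow> homog (psize lam) (Qv lam)"
proof -
  assume lam: "is_partition lam"
  \<comment> \<open>Summation by parts, with boundary term J times column J + 1.\<close>
  have *: "(\<Sum>j=1..J. j * (conj lam j - conj lam (Suc j))) + J * conj lam (Suc J) = (\<Sum>j=1..J. conj lam j)" for J
  proof (induction J)
    case (Suc J)
    have "conj lam (Suc (Suc J)) \<le> conj lam (Suc J)" by (rule conj_antimono) simp
    then obtain d where "conj lam (Suc J) = conj lam (Suc (Suc J)) + d" using le_Suc_ex by blast
    then show ?case using Suc by (simp add: algebra_simps)
  qed simp
  have "conj lam (Suc (psize lam)) = 0"
    using conj_beyond [OF lam] part_le_psize [of lam 1] by simp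
  then show ?thesis
    using homog_W [of "conj lam" "psize lam"] *[of "psize lam"] psize_conj [OF lam part_le_psize]
    by (simp add: Qv_def)
qed

lemma Eop_Qv:
  assumes lam: "is_partition lam"
  shows "Eop r (Qv lam) = (\<Sum>nu\<in>below lam.
    if psize lam - psize nu = r then cst ((-1) ^ r * vs lam nu) * Qv nu else 0)"
proof -
  let ?J = "part lam 1"
  let ?G = "\<lambda>y. if (\<Sum>j=1..?J. conj lam j - y j) = r
    then cst ((-1) ^ r * (\<Prod>j=1..?J. qbin (conj lam j - conj lam (Suc j)) (conj lam j - y j))) *
      W ?J (y(Suc ?J := conj lam (Suc ?J))) else 0"
  have "Eop r (Qv lam) = (\<Sum>y\<in>PiE {1..?J} (\<lambda>j. {conj lam (Suc j)..conj lam j}). ?G y)"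
    unfolding W_eq_Qv [OF lam order_refl, symmetric] by (rule Eop_W) (simp add: conj_antimono)
  \<comment> \<open>The maximum with the empty columns of [] brings the range into the form of
    \<open>bij_betw_VS\<close>.\<close>
  also have "\<dots> = (\<Sum>y\<in>PiE {1..?J} (\<lambda>j. {max (conj lam (Suc j)) (conj [] j)..conj lam j}). ?G y)"
    by simp
  also have "\<dots> = (\<Sum>nu\<in>VS lam []. ?G (restrict (conj nu) {1..?J}))"
    by (rule sum.reindex_bij_betw [OF bij_betw_VS [OF lam is_partition_Nil order_refl contained_Nil], symmetric])
  also have "\<dots> = (\<Sum>nu\<in>VS lam []. if psize lam - psize nu = r then cst ((-1) ^ r * vs lam nu) * Qv nu else 0)"
  proof (rule sum.cong [OF refl])
    fix nu assume nu: "nu \<in> VS lam []"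
    then have nu': "is_partition nu" "contained nu lam" by (auto simp: VS_def)
    have pn: "part nu 1 \<le> ?J" using contained_part_1 [OF nu'(2)] .
    have "psize lam - psize nu = (\<Sum>j=1..?J. conj lam j) - (\<Sum>j=1..?J. conj nu j)"
      using psize_conj [OF lam order_refl] psize_conj [OF nu'(1) pn] by simp
    also have "\<dots> = (\<Sum>j=1..?J. conj lam j - conj nu j)"
      using nu' lam by (intro sum_subtractf_nat [symmetric]) (auto simp: contained_iff_conj)
    also have "\<dots> = (\<Sum>j=1..?J. conj lam j - restrict (conj nu) {1..?J} j)"
      by (rule sum.cong) auto
    finally have 1: "psize lam - psize nu = (\<Sum>j=1..?J. conj lam j - restrict (conj nu) {1..?J} j)" .
    have 2: "vs lam nu = (\<Prod>j=1..?J. qbin (conj lam j - conj lam (Suc j)) (conj lam j - restrict (conj nu) {1..?J} j))"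
      unfolding vs_conj [OF lam nu order_refl] by (rule prod.cong) auto
    have "conj nu (Suc ?J) = 0" "conj lam (Suc ?J) = 0"
      using conj_beyond [OF nu'(1)] conj_beyond [OF lam] pn by auto
    then have "W ?J ((restrict (conj nu) {1..?J})(Suc ?J := conj lam (Suc ?J))) = W ?J (conj nu)"
      by (intro W_cong) auto
    also have "\<dots> = Qv nu" by (rule W_eq_Qv [OF nu'(1) pn])
    finally have 3: "W ?J ((restrict (conj nu) {1..?J})(Suc ?J := conj lam (Suc ?J))) = Qv nu" .
    show "?G (restrict (conj nu) {1..?J}) = (if psize lam - psize nu = r then cst ((-1) ^ r * vs lam nu) * Qv nu else 0)"
      unfolding 1 2 3 ..
  qed
  also have "\<dots> = (\<Sum>nu\<in>below lam. if psize lam - psize nu = r then cst ((-1) ^ r * vs lam nu) * Qv nu else 0)"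
    using lam by (intro sum.mono_neutral_left) (auto simp: VS_def vs_def)
  finally show ?thesis .
qed

section \<open>The adjoint rules for h_r, for q_r and for the inverse of q(u)\<close>

lemma pshift_cong: "(\<And>n. n \<ge> 1 \<Longrightarrow> c n = d n) \<Longrightarrow> pshift c r f = pshift d r f"
proof (induction r arbitrary: f rule: less_induct)
  case (less r)
  show ?case unfolding pshift.simps [of c r] pshift.simps [of d r]
    using less by (auto intro!: arg_cong [of _ _ "\<lambda>x. cst (1 / of_nat r) * x"] sum.cong)
qed

text \<open>The adjoints of multiplication by h_r and by q_r.\<close>

definition Hop :: "nat \<Rightarrow> sym \<Rightarrow> sym" where
  "Hop r = pshift (\<lambda>n. 1 / (1 - tt ^ n)) r"

definition qperp :: "nat \<Rightarrow> sym \<Rightarrow> sym" where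
  "qperp r = pshift (\<lambda>n. 1) r"

lemma sum_Hop_Eop: "(\<Sum>i\<le>r. Hop i (Eop (r - i) f)) = (if r = 0 then f else 0)"
  by (simp add: Hop_def Eop_def pshift_compose add_divide_distrib [symmetric] pshift_zero)

lemma sum_Hop_Eop_qperp: "(\<Sum>i\<le>r. Hop i (cst (tt ^ (r - i)) * Eop (r - i) f)) = qperp r f"
proof -
  have "(\<Sum>i\<le>r. Hop i (cst (tt ^ (r - i)) * Eop (r - i) f)) =
     pshift (\<lambda>n. 1 / (1 - tt ^ n) + -1 / (1 - tt ^ n) * tt ^ n) r f"
    unfolding Hop_def Eop_def pshift_scale [symmetric] by (rule pshift_compose)
  also have "\<dots> = qperp r f"
    unfolding qperp_def
  proof (rule pshift_cong)
    fix n :: nat assume "n \<ge> 1"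
    then show "1 / (1 - tt ^ n) + -1 / (1 - tt ^ n) * tt ^ n = 1"
      using one_minus_tt_power [of n] by (simp add: divide_simps)
  qed
  finally show ?thesis .
qed

lemma sum_Hop_Eop_Rop: "(\<Sum>i\<le>r. cst (tt ^ i) * Hop i (Eop (r - i) f)) = Rop r f"
proof -
  have "(\<Sum>i\<le>r. cst (tt ^ i) * Hop i (Eop (r - i) f)) =
     pshift (\<lambda>n. 1 / (1 - tt ^ n) * tt ^ n + -1 / (1 - tt ^ n)) r f"
    unfolding Hop_def Eop_def pshift_scale [symmetric] by (rule pshift_compose)
  also have "\<dots> = Rop r f"
    unfolding Rop_def
  proof (rule pshift_cong)
    fix n :: nat assume "n \<ge> 1"
    then show "1 / (1 - tt ^ n) * tt ^ n + -1 / (1 - tt ^ n) = -1"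
      using one_minus_tt_power [of n] by (simp add: divide_simps)
  qed
  finally show ?thesis .
qed

lemma sum_qperp_Rop: "(\<Sum>i\<le>r. qperp i (Rop (r - i) f)) = (if r = 0 then f else 0)"
  by (simp add: qperp_def Rop_def pshift_compose pshift_zero)

lemma vs_self: "is_partition lam \<Longrightarrow> vs lam lam = 1"
  by (simp add: vs_def vert_strip_def)

lemma below_same_size:
  assumes "is_partition lam" "nu \<in> below lam"
  shows "psize lam - psize nu = 0 \<longleftrightarrow> nu = lam"
proof
  assume "psize lam - psize nu = 0"
  then have "psize nu = psize lam" using contained_psize [of nu lam] assms by simp
  then show "nu = lam" using contained_eqI [of nu lam] assms by blast
qed simp

text \<open>The inversion sum for equal partitions has nu = lam as its only term.\<close>

lemma sk_self: "is_partition lam \<Longrightarrow> sk lam lam = 1"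
proof -
  assume lam: "is_partition lam"
  have "nu = lam" if "nu \<in> between lam lam" for nu
  proof -
    have "psize nu = psize lam"
      using that lam contained_psize [of nu lam] contained_psize [of lam nu] by simp
    then show ?thesis using that lam contained_eqI [of nu lam] by blast
  qed
  then have "between lam lam = {lam}"
    using lam by (intro equalityI subsetI) auto
  then show ?thesis using sum_vs_sk_inverse [OF lam lam contained_refl] lam by (simp add: vs_self)
qed

text \<open>The value that \<open>Hop_Qv\<close> will give to the adjoint of h_i on Q_nu, with an
  additional weight b_i. Having it apart from \<open>Hop\<close> allows sums to be regrouped before
  that rule is available.\<close>

definition skQ :: "(nat \<Rightarrow> coef) \<Rightarrow> nat \<Rightarrow> nat list \<Rightarrow> sym" where
  "skQ b i nu = (\<Sum>ka\<in>below nu. if psize nu - psize ka = i then cst (b i * sk nu ka) * Qv ka else 0)"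

text \<open>Sizes force i to be the size of nu/ka, so the sum over i has at most one term; the rest
  is an exchange of summations over chains ka, nu, lam. The weights a and b are free because three
  different pairs of them occur.\<close>

lemma sum_vs_skQ:
  assumes lam: "is_partition lam"
  shows "(\<Sum>i\<le>r. \<Sum>nu\<in>below lam. if psize lam - psize nu = r - i
      then cst (a (r - i) * vs lam nu) * skQ b i nu else 0) =
    (\<Sum>ka\<in>below lam. if psize lam - psize ka = r
      then cst (\<Sum>nu\<in>between lam ka. a (psize lam - psize nu) * b (psize nu - psize ka) * vs lam nu * sk nu ka) * Qv ka
      else 0)"
proof -
  define G where "G nu ka = (if psize lam - psize ka = r
     then cst (a (psize lam - psize nu) * b (psize nu - psize ka) * vs lam nu * sk nu ka) * Qv ka else 0)" for nu ka
  have "(\<Sum>i\<le>r. if psize lam - psize nu = r - i then cst (a (r - i) * vs lam nu) * skQ b i nu else 0) =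
      (\<Sum>ka\<in>below nu. G nu ka)" if nu: "nu \<in> below lam" for nu
  proof -
    have le: "psize nu \<le> psize lam" using nu lam contained_psize by auto
    have "(\<Sum>i\<le>r. if psize lam - psize nu = r - i then cst (a (r - i) * vs lam nu) * skQ b i nu else 0) =
      (\<Sum>i\<le>r. \<Sum>ka\<in>below nu. if psize nu - psize ka = i \<and> psize lam - psize nu = r - i
         then cst (a (r - i) * vs lam nu) * (cst (b i * sk nu ka) * Qv ka) else 0)"
      unfolding skQ_def by (auto simp: sum_distrib_left intro!: sum.cong)
    also have "\<dots> = (\<Sum>ka\<in>below nu. \<Sum>i\<le>r. if psize nu - psize ka = i \<and> psize lam - psize nu = r - i
         then cst (a (r - i) * vs lam nu) * (cst (b i * sk nu ka) * Qv ka) else 0)"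
      by (rule sum.swap)
    also have "\<dots> = (\<Sum>ka\<in>below nu. G nu ka)"
    proof (rule sum.cong [OF refl])
      fix ka assume ka: "ka \<in> below nu"
      then have le2: "psize ka \<le> psize nu" using nu contained_psize by auto
      let ?i = "psize nu - psize ka"
      let ?c = "\<lambda>i. cst (a (r - i) * vs lam nu) * (cst (b i * sk nu ka) * Qv ka)"
      have "(\<Sum>i\<le>r. if psize nu - psize ka = i \<and> psize lam - psize nu = r - i then ?c i else 0) =
          (\<Sum>i\<le>r. if i = ?i then (if psize lam - psize nu = r - i then ?c i else 0) else 0)"
        by (rule sum.cong) auto
      also have "\<dots> = (if ?i \<le> r \<and> psize lam - psize nu = r - ?i then ?c ?i else 0)"
        by simp
      also have "\<dots> = G nu ka"
      proof -
        have e1: "(?i \<le> r \<and> psize lam - psize nu = r - ?i) = (psize lam - psize ka = r)"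
          using le le2 by auto
        have e2: "?c ?i = cst (a (psize lam - psize nu) * b ?i * vs lam nu * sk nu ka) * Qv ka"
          if "psize lam - psize ka = r"
        proof -
          have "r - ?i = psize lam - psize nu" using le le2 that by auto
          then show ?thesis by (simp only: cst_mult mult_ac)
        qed
        show ?thesis unfolding e1 G_def by (rule if_cong [OF refl e2 refl])
      qed
      finally show "(\<Sum>i\<le>r. if psize nu - psize ka = i \<and> psize lam - psize nu = r - i then ?c i else 0) = G nu ka" .
    qed
    finally show ?thesis .
  qed
  then have "(\<Sum>i\<le>r. \<Sum>nu\<in>below lam. if psize lam - psize nu = r - i
      then cst (a (r - i) * vs lam nu) * skQ b i nu else 0) = (\<Sum>nu\<in>below lam. \<Sum>ka\<in>below nu. G nu ka)"
    by (subst sum.swap) (rule sum.cong [OF refl])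
  also have "\<dots> = (\<Sum>(nu, ka)\<in>Sigma (below lam) below. G nu ka)"
    using lam by (intro sum.Sigma) auto
  also have "\<dots> = (\<Sum>(ka, nu)\<in>Sigma (below lam) (between lam). G nu ka)"
    by (rule sum.reindex_bij_witness [where i = "\<lambda>(a, b). (b, a)" and j = "\<lambda>(a, b). (b, a)"])
      (auto intro: contained_trans)
  also have "\<dots> = (\<Sum>ka\<in>below lam. \<Sum>nu\<in>between lam ka. G nu ka)"
    using lam by (intro sum.Sigma [symmetric]) auto
  also have "\<dots> = (\<Sum>ka\<in>below lam. if psize lam - psize ka = r
      then cst (\<Sum>nu\<in>between lam ka. a (psize lam - psize nu) * b (psize nu - psize ka) * vs lam nu * sk nu ka) * Qv ka
      else 0)"
    by (rule sum.cong [OF refl]) (simp add: G_def cst_sum sum_distrib_right)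
  finally show ?thesis .
qed

lemma sum_below_top:
  assumes lam: "is_partition lam"
  shows "(\<Sum>nu\<in>below lam. if psize lam - psize nu = 0 then F nu else 0) = F lam"
proof -
  have "(\<Sum>nu\<in>below lam. if psize lam - psize nu = 0 then F nu else 0) =
     (\<Sum>nu\<in>below lam. if nu = lam then F nu else 0)"
    by (rule sum.cong [OF refl]) (simp only: below_same_size [OF lam])
  then show ?thesis using lam by simp
qed

lemma lin_Hop: "lin (Hop i)"
  by (simp add: Hop_def lin_pshift)

lemma if_cst_mult: "(if P then cst a * x else 0) = cst (if P then a else 0) * x"
  by simp

lemma Hop_Eop_Qv:
  assumes lam: "is_partition lam"
  shows "Hop i (Eop s (Qv lam)) = (\<Sum>nu\<in>below lam.
    if psize lam - psize nu = s then cst ((-1) ^ s * vs lam nu) * Hop i (Qv nu) else 0)"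
  unfolding Eop_Qv [OF lam] if_cst_mult by (simp only: lin_sum [OF lin_Hop] lin_cst [OF lin_Hop])

lemma sum_atMost_last_eq:
  fixes f g :: "nat \<Rightarrow> sym"
  assumes "(\<Sum>i\<le>r. f i) = (\<Sum>i\<le>r. g i)" "\<And>i. i < r \<Longrightarrow> f i = g i"
  shows "f r = g r"
proof -
  have "(\<Sum>i<r. f i) = (\<Sum>i<r. g i)" using assms(2) by (intro sum.cong) auto
  moreover have "(\<Sum>i<r. f i) + f r = (\<Sum>i<r. g i) + g r"
    using assms(1) by (simp add: lessThan_Suc_atMost [symmetric])
  ultimately show ?thesis by simp
qed

text \<open>Both sides satisfy the recursion that H(u) E(-u) = 1 imposes: the operators by
  \<open>sum_Hop_Eop\<close>, the candidates by \<open>sum_vs_sk_inverse\<close>. The terms with i <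
  r agree by induction, which leaves the term i = r.\<close>

lemma Hop_Qv:
  assumes "is_partition lam"
  shows "Hop r (Qv lam) = skQ (\<lambda>_. 1) r lam"
  using assms
proof (induction r arbitrary: lam rule: less_induct)
  case (less r)
  note lam = less.prems
  show ?case
  proof (cases "r = 0")
    case True
    show ?thesis
      using sum_below_top [OF lam, of "\<lambda>ka. cst (1 * sk lam ka) * Qv ka"]
      unfolding True skQ_def Hop_def pshift_0 sk_self [OF lam] by simp
  next
    case False
    let ?T = "\<lambda>F i. \<Sum>nu\<in>below lam. if psize lam - psize nu = r - i
      then cst ((-1) ^ (r - i) * vs lam nu) * F i nu else 0"
    \<comment> \<open>For i = r only nu = lam is left, with coefficient \<open>vs lam lam\<close> =
      1.\<close>
    have top: "?T F r = F r lam" for F :: "nat \<Rightarrow> nat list \<Rightarrow> sym"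
      using sum_below_top [OF lam, of "\<lambda>nu. cst ((-1) ^ (r - r) * vs lam nu) * F r nu"]
      unfolding diff_self_eq_0 vs_self [OF lam] by simp
    have "(\<Sum>i\<le>r. ?T (\<lambda>i nu. Hop i (Qv nu)) i) = 0"
      using sum_Hop_Eop [of r "Qv lam"] False by (simp add: Hop_Eop_Qv [OF lam])
    moreover have "(\<Sum>i\<le>r. ?T (skQ (\<lambda>_. 1)) i) = 0"
    proof -
      have "(\<Sum>i\<le>r. ?T (skQ (\<lambda>_. 1)) i) = (\<Sum>ka\<in>below lam. if psize lam - psize ka = r
        then cst (\<Sum>nu\<in>between lam ka. (-1) ^ (psize lam - psize nu) * 1 * vs lam nu * sk nu ka) * Qv ka
        else 0)"
        by (rule sum_vs_skQ [OF lam])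
      also have "\<dots> = 0"
      proof (rule sum.neutral, rule ballI)
        fix ka assume ka: "ka \<in> below lam"
        then have "(\<Sum>nu\<in>between lam ka. (-1) ^ (psize lam - psize nu) * 1 * vs lam nu * sk nu ka) =
            (if lam = ka then 1 else 0)"
          using sum_vs_sk_inverse [OF lam, of ka] by simp
        then show "(if psize lam - psize ka = r
          then cst (\<Sum>nu\<in>between lam ka. (-1) ^ (psize lam - psize nu) * 1 * vs lam nu * sk nu ka) * Qv ka
          else 0) = 0" using False by simp
      qed
      finally show ?thesis .
    qed
    ultimately have eq: "(\<Sum>i\<le>r. ?T (\<lambda>i nu. Hop i (Qv nu)) i) = (\<Sum>i\<le>r. ?T (skQ (\<lambda>_. 1)) i)"
      by (rule trans [OF _ sym])
    have "?T (\<lambda>i nu. Hop i (Qv nu)) r = ?T (skQ (\<lambda>_. 1)) r"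
      by (rule sum_atMost_last_eq [OF eq]) (use less.IH in \<open>auto intro!: sum.cong\<close>)
    then show ?thesis
      by (simp only: top [of "\<lambda>i nu. Hop i (Qv nu)"] top [of "skQ (\<lambda>_. 1)"])
  qed
qed

lemma qperp_Qv:
  assumes lam: "is_partition lam"
  shows "qperp r (Qv lam) = (\<Sum>ka\<in>below lam.
    if psize lam - psize ka = r then cst (hs lam ka) * Qv ka else 0)"
proof -
  have "qperp r (Qv lam) = (\<Sum>i\<le>r. \<Sum>nu\<in>below lam. if psize lam - psize nu = r - i
      then cst ((- tt) ^ (r - i) * vs lam nu) * skQ (\<lambda>_. 1) i nu else 0)"
    unfolding sum_Hop_Eop_qperp [symmetric]
  proof (rule sum.cong [OF refl])
    fix i
    have m: "(- tt) ^ (r - i) = tt ^ (r - i) * (-1) ^ (r - i)"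
      using power_mult_distrib [of tt "-1" "r - i"] by simp
    show "Hop i (cst (tt ^ (r - i)) * Eop (r - i) (Qv lam)) = (\<Sum>nu\<in>below lam. if psize lam - psize nu = r - i
      then cst ((- tt) ^ (r - i) * vs lam nu) * skQ (\<lambda>_. 1) i nu else 0)"
      unfolding lin_cst [OF lin_Hop] Hop_Eop_Qv [OF lam] m sum_distrib_left
    proof (rule sum.cong [OF refl])
      fix nu assume "nu \<in> below lam"
      then have h: "Hop i (Qv nu) = skQ (\<lambda>_. 1) i nu" using Hop_Qv by simp
      show "cst (tt ^ (r - i)) * (if psize lam - psize nu = r - i then cst ((-1) ^ (r - i) * vs lam nu) * Hop i (Qv nu) else 0) =
        (if psize lam - psize nu = r - i then cst (tt ^ (r - i) * (-1) ^ (r - i) * vs lam nu) * skQ (\<lambda>_. 1) i nu else 0)"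
        unfolding h cst_mult by (simp only: mult.assoc mult_zero_right split: if_split) simp
    qed
  qed
  also have "\<dots> = (\<Sum>ka\<in>below lam. if psize lam - psize ka = r
      then cst (\<Sum>nu\<in>between lam ka. (- tt) ^ (psize lam - psize nu) * 1 * vs lam nu * sk nu ka) * Qv ka
      else 0)"
    by (rule sum_vs_skQ [OF lam])
  also have "\<dots> = (\<Sum>ka\<in>below lam. if psize lam - psize ka = r then cst (hs lam ka) * Qv ka else 0)"
    using sum_vs_sk_hs [OF lam] by (intro sum.cong refl) auto
  finally show ?thesis .
qed

text \<open>The sum over nu is left unevaluated here; it becomes the summation over nu in the skew
  Pieri rule.\<close>

lemma Rop_Qv:
  assumes lam: "is_partition lam"
  shows "Rop r (Qv lam) = (\<Sum>ka\<in>below lam. if psize lam - psize ka = r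
    then cst (\<Sum>nu\<in>between lam ka. (-1) ^ (psize lam - psize nu) * tt ^ (psize nu - psize ka) * vs lam nu * sk nu ka) * Qv ka
    else 0)"
proof -
  have "Rop r (Qv lam) = (\<Sum>i\<le>r. \<Sum>nu\<in>below lam. if psize lam - psize nu = r - i
      then cst ((-1) ^ (r - i) * vs lam nu) * skQ (\<lambda>i. tt ^ i) i nu else 0)"
    unfolding sum_Hop_Eop_Rop [symmetric]
  proof (rule sum.cong [OF refl])
    fix i
    have m: "skQ (\<lambda>i. tt ^ i) i nu = cst (tt ^ i) * skQ (\<lambda>_. 1) i nu" for nu
      unfolding skQ_def sum_distrib_left
      by (rule sum.cong [OF refl], simp only: cst_mult mult.assoc mult_zero_right split: if_split) simp
    show "cst (tt ^ i) * Hop i (Eop (r - i) (Qv lam)) = (\<Sum>nu\<in>below lam. if psize lam - psize nu = r - i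
      then cst ((-1) ^ (r - i) * vs lam nu) * skQ (\<lambda>i. tt ^ i) i nu else 0)"
      unfolding Hop_Eop_Qv [OF lam] m sum_distrib_left
    proof (rule sum.cong [OF refl])
      fix nu assume "nu \<in> below lam"
      then have h: "Hop i (Qv nu) = skQ (\<lambda>_. 1) i nu" using Hop_Qv by simp
      show "cst (tt ^ i) * (if psize lam - psize nu = r - i then cst ((-1) ^ (r - i) * vs lam nu) * Hop i (Qv nu) else 0) =
        (if psize lam - psize nu = r - i then cst ((-1) ^ (r - i) * vs lam nu) * (cst (tt ^ i) * skQ (\<lambda>_. 1) i nu) else 0)"
        unfolding h by (simp only: mult.left_commute mult_zero_right split: if_split) simp
    qed
  qed
  also have "\<dots> = (\<Sum>ka\<in>below lam. if psize lam - psize ka = r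
    then cst (\<Sum>nu\<in>between lam ka. (-1) ^ (psize lam - psize nu) * tt ^ (psize nu - psize ka) * vs lam nu * sk nu ka) * Qv ka
    else 0)"
    by (rule sum_vs_skQ [OF lam])
  finally show ?thesis .
qed

section \<open>Triangularity with respect to products of elementary functions\<close>

lemma sum_nonzeroE:
  assumes "(\<Sum>x\<in>A. f x) \<noteq> 0"
  obtains x where "x \<in> A" "f x \<noteq> 0"
  using assms by (meson sum.not_neutral_contains_not_neutral)

text \<open>exp (- sum p_n u^n / n) is E(-u), so the sign turns its coefficient into e_k.\<close>

definition eg :: "nat \<Rightarrow> sym" where
  "eg k = cst ((-1) ^ k) * psexp (\<lambda>n. -1) k"

lemma eg_0 [simp]: "eg 0 = 1"
  by (simp add: eg_def)

lemma homog_eg: "homog k (eg k)"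
  unfolding eg_def by (intro homog_cst_mult homog_psexp)

lemma hl_psexp_minus: "hl_inner (psexp (\<lambda>n. -1) r * f) g = hl_inner f (Eop r g)"
  unfolding Eop_def by (rule hl_psexp_mult) (use one_minus_tt_power in auto)

lemma hl_qg_mult: "hl_inner (qg r * f) g = hl_inner f (qperp r g)"
  unfolding qg_def qperp_def by (rule hl_psexp_mult) simp

lemma hl_if_right: "hl_inner f (if P then g else 0) = (if P then hl_inner f g else 0)"
  by simp

lemma hl_eg_Qv:
  assumes "is_partition lam"
  shows "hl_inner (eg r * f) (Qv lam) = (\<Sum>nu\<in>below lam.
    if psize lam - psize nu = r then vs lam nu * hl_inner f (Qv nu) else 0)"
proof -
  have sq: "(-1::coef) ^ r * ((-1) ^ r * x) = x" for x
    by (simp add: mult.assoc [symmetric] power_mult_distrib [symmetric])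
  have "hl_inner (eg r * f) (Qv lam) = (-1) ^ r * hl_inner f (Eop r (Qv lam))"
    by (simp only: eg_def mult.assoc hl_cst_left hl_psexp_minus)
  also have "\<dots> = (\<Sum>nu\<in>below lam.
    (-1) ^ r * (if psize lam - psize nu = r then (-1) ^ r * vs lam nu * hl_inner f (Qv nu) else 0))"
    unfolding Eop_Qv [OF assms] hl_sum_right hl_if_right hl_cst_right sum_distrib_left ..
  also have "\<dots> = (\<Sum>nu\<in>below lam.
    if psize lam - psize nu = r then vs lam nu * hl_inner f (Qv nu) else 0)"
    by (rule sum.cong [OF refl], simp only: mult.assoc sq mult_zero_right split: if_split) simp
  finally show ?thesis .
qed

lemma hl_qg_Qv:
  assumes "is_partition lam"
  shows "hl_inner (qg r * f) (Qv lam) = (\<Sum>nu\<in>below lam.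
    if psize lam - psize nu = r then hs lam nu * hl_inner f (Qv nu) else 0)"
  unfolding hl_qg_mult qperp_Qv [OF assms] hl_sum_right hl_if_right hl_cst_right ..

text \<open>Beyond position k the tail of b is at most the tail of a, so the given totals force the
  reverse inequality on the initial sums. Used for the columns of vertical strips and for the rows
  of horizontal strips.\<close>

lemma interlace_partial_sums:
  fixes a b :: "nat \<Rightarrow> nat"
  assumes ab: "\<And>j. j \<ge> 1 \<Longrightarrow> b (Suc j) \<le> a j"
    and tot: "(\<Sum>j=1..Suc J. b j) = c + (\<Sum>j=1..Suc J. a j)" and k: "k \<le> J"
  shows "c + (\<Sum>j=1..k. a j) \<le> (\<Sum>j=1..Suc k. b j)"
proof -
  have "(\<Sum>j=1..Suc i. b j) + (\<Sum>j=1..k. a j) \<le> (\<Sum>j=1..Suc k. b j) + (\<Sum>j=1..i. a j)" if "k \<le> i" for i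
    using that
  proof (induction i rule: dec_induct)
    case (step i)
    then show ?case using ab [of "Suc i"] by simp
  qed simp
  from this [OF k] tot show ?thesis by simp
qed

text \<open>Dominance order of the conjugate partitions.\<close>

definition cd :: "nat list \<Rightarrow> nat list \<Rightarrow> bool" where
  "cd a b \<longleftrightarrow> (\<forall>k. (\<Sum>j=1..k. conj a j) \<le> (\<Sum>j=1..k. conj b j))"

lemma cd_refl [simp]: "cd a a"
  by (simp add: cd_def)

lemma cd_trans: "cd a b \<Longrightarrow> cd b c \<Longrightarrow> cd a c"
  unfolding cd_def by (meson order_trans)

lemma partial_sums_eqD:
  fixes a b :: "nat \<Rightarrow> nat"
  assumes "\<And>k. (\<Sum>j=1..k. a j) = (\<Sum>j=1..k. b j)" "j \<ge> 1"
  shows "a j = b j"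
proof -
  obtain i where "j = Suc i" using assms(2) by (cases j) auto
  then show ?thesis using assms(1) [of j] assms(1) [of i] by simp
qed

lemma cd_antisym:
  assumes "is_partition a" "is_partition b" "cd a b" "cd b a"
  shows "a = b"
proof (rule partition_eqI [OF assms(1,2)])
  fix j :: nat assume j: "j \<ge> 1"
  have s: "(\<Sum>j=1..k. conj a j) = (\<Sum>j=1..k. conj b j)" for k
    using assms(3,4) unfolding cd_def by (intro le_antisym) auto
  show "conj a j = conj b j" by (rule partial_sums_eqD [of "conj a" "conj b", OF s j])
qed

text \<open>epl cs is the product of the elementary functions e_c, and ev lambda is e_{lambda'}.\<close>

definition epl :: "nat list \<Rightarrow> sym" where
  "epl cs = prod_list (map eg cs)"

lemma epl_simps [simp]: "epl [] = 1" "epl (c # cs) = eg c * epl cs"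
  by (simp_all add: epl_def)

lemma epl_append: "epl (cs @ ds) = epl cs * epl ds"
  by (simp add: epl_def)

lemma homog_epl: "homog (sum_list cs) (epl cs)"
  by (induction cs) (simp_all add: homog_mult homog_eg)

definition ev :: "nat list \<Rightarrow> sym" where
  "ev lam = epl (map (conj lam) [1..<Suc (psize lam)])"

lemma epl_conj_eq_ev:
  assumes "is_partition lam" "part lam 1 \<le> J"
  shows "epl (map (conj lam) [1..<Suc J]) = ev lam"
proof -
  have *: "epl (map (conj lam) [1..<Suc K]) = epl (map (conj lam) [1..<Suc (part lam 1)])"
    if "part lam 1 \<le> K" for K
    using that
  proof (induction K rule: dec_induct)
    case (step K)
    then show ?case using conj_beyond [OF assms(1), of "Suc K"]
      by (simp add: epl_append del: One_nat_def)
  qed simp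
  show ?thesis unfolding ev_def using *[OF assms(2)] *[OF part_le_psize] by simp
qed

lemma sum_list_map_upt: "sum_list (map f [1..<Suc n]) = (\<Sum>j=1..n. f j)" for f :: "nat \<Rightarrow> nat"
  by (induction n) simp_all

lemma homog_ev:
  assumes "is_partition lam"
  shows "homog (psize lam) (ev lam)"
proof -
  have "sum_list (map (conj lam) [1..<Suc (psize lam)]) = psize lam"
    unfolding sum_list_map_upt by (rule psize_conj [OF assms part_le_psize, symmetric])
  then show ?thesis
    using homog_epl [of "map (conj lam) [1..<Suc (psize lam)]"] unfolding ev_def by (simp only:)
qed

text \<open>Moving e_c across the pairing removes a vertical strip of size c, and interlacing lets
  the partial sums of cs accumulate in the first columns of lam. The list is arbitrary for the sake
  of the induction.\<close>

lemma hl_epl_Qv_nonzero: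
  assumes "is_partition lam" "hl_inner (epl cs) (Qv lam) \<noteq> 0"
  shows "sum_list (take k cs) \<le> (\<Sum>j=1..k. conj lam j)"
  using assms
proof (induction cs arbitrary: lam k)
  case (Cons c cs)
  from Cons.prems(2) obtain nu where nu: "nu \<in> below lam"
    "(if psize lam - psize nu = c then vs lam nu * hl_inner (epl cs) (Qv nu) else 0) \<noteq> 0"
    unfolding epl_simps hl_eg_Qv [OF Cons.prems(1)] by (rule sum_nonzeroE)
  then have n: "is_partition nu" "contained nu lam" "psize lam - psize nu = c" "vs lam nu \<noteq> 0"
    "hl_inner (epl cs) (Qv nu) \<noteq> 0"
    by (auto split: if_splits)
  show ?case
  proof (cases k)
    case (Suc i)
    let ?J = "max i (part lam 1)"
    have "vert_strip lam nu" using n(4) by (auto simp: vs_def split: if_splits)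
    then have ab: "conj lam (Suc j) \<le> conj nu j" if "j \<ge> 1" for j
      using that n(1) Cons.prems(1) by (simp add: vert_strip_iff_conj)
    have "psize lam = c + psize nu"
      using n(3) contained_psize [OF n(1) Cons.prems(1) n(2)] by simp
    moreover have "psize lam = (\<Sum>j=1..Suc ?J. conj lam j)" "psize nu = (\<Sum>j=1..Suc ?J. conj nu j)"
      using Cons.prems(1) n(1) contained_part_1 [OF n(2)] by (intro psize_conj; simp)+
    ultimately have "c + (\<Sum>j=1..i. conj nu j) \<le> (\<Sum>j=1..Suc i. conj lam j)"
      by (intro interlace_partial_sums [where J = ?J]) (simp_all only: ab max.cobounded1)
    moreover have "sum_list (take i cs) \<le> (\<Sum>j=1..i. conj nu j)"
      by (rule Cons.IH [OF n(1,5)])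
    ultimately show ?thesis using Suc by simp
  qed simp
qed simp

lemma hl_ev_Qv_nonzero:
  assumes "is_partition al" "is_partition lam" "hl_inner (ev al) (Qv lam) \<noteq> 0"
  shows "cd al lam"
  unfolding cd_def
proof
  fix k
  let ?J = "max k (part al 1)"
  have "epl (map (conj al) [1..<Suc ?J]) = ev al"
    by (rule epl_conj_eq_ev [OF assms(1)]) simp
  then have "sum_list (take k (map (conj al) [1..<Suc ?J])) \<le> (\<Sum>j=1..k. conj lam j)"
    using assms by (intro hl_epl_Qv_nonzero) simp_all
  moreover have "take k (map (conj al) [1..<Suc ?J]) = map (conj al) [1..<Suc k]"
    by (simp add: take_map take_upt del: upt_Suc)
  ultimately show "(\<Sum>j=1..k. conj al j) \<le> (\<Sum>j=1..k. conj lam j)"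
    by (simp only: sum_list_map_upt)
qed

lemma hl_1_1: "hl_inner 1 1 = 1"
  using hl_pm [of 1 "{#}"] by (simp add: zt_def z0_def)

lemma psize_0: "is_partition l \<Longrightarrow> psize l = 0 \<Longrightarrow> l = []"
  by (cases l) (auto simp: psize_def is_partition_Cons)

lemma psize_Nil [simp]: "psize [] = 0"
  by (simp add: psize_def)

lemma Qv_Nil [simp]: "Qv [] = 1"
  by (simp add: Qv_def)

lemma part_1_le_iff: "is_partition l \<Longrightarrow> part l 1 \<le> J \<longleftrightarrow> conj l (Suc J) = 0"
  using le_part_iff_le_conj [of l 1 "Suc J"] by auto

text \<open>A vertical strip with as many boxes as lam has rows takes one box from every row, which
  amounts to deleting the first column; this single term has coefficient 1.\<close>

lemma hl_epl_conj_Qv_diag: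
  assumes "is_partition lam" "part lam 1 \<le> J"
  shows "hl_inner (epl (map (conj lam) [1..<Suc J])) (Qv lam) = 1"
  using assms
proof (induction J arbitrary: lam)
  case 0
  then have "psize lam = 0" using psize_conj [of lam 0] by simp
  then have "lam = []" using psize_0 0 by simp
  then show ?case by (simp add: hl_1_1)
next
  case (Suc J)
  note lam = Suc.prems(1)
  have z: "conj lam (Suc (Suc J)) = 0" using part_1_le_iff [OF lam] Suc.prems(2) by simp
  have "conj lam (Suc j) = 0" if "j > Suc J" for j
    using conj_antimono [of "Suc (Suc J)" "Suc j" lam] z that by simp
  \<comment> \<open>\<open>lm\<close> is lam without its first column.\<close>
  then obtain lm where lm: "is_partition lm" "\<And>j. j \<ge> 1 \<Longrightarrow> conj lm j = conj lam (Suc j)"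
    using ex_partition_conj [of "\<lambda>j. conj lam (Suc j)" "Suc J"] by (auto simp: conj_antimono)
  have lm1: "part lm 1 \<le> J" using part_1_le_iff [OF lm(1)] lm(2) z by simp
  have sub: "contained lm lam"
    using lm lam by (simp add: contained_iff_conj conj_antimono)
  have vst: "vert_strip lam lm" using lm lam by (simp add: vert_strip_iff_conj)
  have VSm: "lm \<in> VS lam []" using lm(1) sub vst by (simp add: VS_def)
  have v1: "vs lam lm = 1"
    unfolding vs_conj [OF lam VSm order_refl] by (rule prod.neutral) (use lm(2) in simp)
  have sh: "(\<Sum>j=1..Suc J. conj lam j) = conj lam 1 + (\<Sum>j=1..J. conj lam (Suc j))"
    by (induction J) simp_all
  have "psize lm = (\<Sum>j=1..J. conj lm j)" by (rule psize_conj [OF lm(1) lm1])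
  also have "\<dots> = (\<Sum>j=1..J. conj lam (Suc j))" by (rule sum.cong) (use lm(2) in auto)
  finally have sz: "psize lam = conj lam 1 + psize lm"
    using psize_conj [OF lam Suc.prems(2)] sh by simp
  \<comment> \<open>Interlacing puts lm inside nu, and the two have equal size.\<close>
  have nu: "nu = lm" if "nu \<in> below lam" "psize lam - psize nu = conj lam 1" "vs lam nu \<noteq> 0" for nu
  proof -
    have n: "is_partition nu" "contained nu lam" using that by auto
    have "vert_strip lam nu" using that(3) by (auto simp: vs_def split: if_splits)
    then have "contained lm nu"
      using n(1) lm lam by (simp add: contained_iff_conj vert_strip_iff_conj)
    moreover have "psize lm = psize nu"
      using that(2) sz contained_psize [OF n(1) lam n(2)] by simp
    ultimately show ?thesis using contained_eqI [OF lm(1) n(1)] by simp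
  qed
  let ?cs = "map (conj lam) [1..<Suc (Suc J)]"
  let ?ds = "map (conj lm) [1..<Suc J]"
  have "map Suc [1..<Suc J] = [Suc 1..<Suc (Suc J)]" by (rule map_Suc_upt)
  then have "?cs = conj lam 1 # map (conj lam) (map Suc [1..<Suc J])"
    by (simp add: upt_conv_Cons del: upt_Suc map_map)
  also have "map (conj lam) (map Suc [1..<Suc J]) = ?ds"
    unfolding map_map by (rule map_cong [OF refl]) (use lm(2) in auto)
  finally have cs: "?cs = conj lam 1 # ?ds" .
  have "hl_inner (epl ?cs) (Qv lam) = (\<Sum>nu\<in>below lam.
    if psize lam - psize nu = conj lam 1 then vs lam nu * hl_inner (epl ?ds) (Qv nu) else 0)"
    unfolding cs epl_simps by (rule hl_eg_Qv [OF lam])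
  also have "\<dots> = (\<Sum>nu\<in>below lam. if nu = lm then 1 else 0)"
  proof (rule sum.cong [OF refl])
    fix nu assume b: "nu \<in> below lam"
    show "(if psize lam - psize nu = conj lam 1 then vs lam nu * hl_inner (epl ?ds) (Qv nu) else 0) =
      (if nu = lm then 1 else 0)"
    proof (cases "nu = lm")
      case True
      have "hl_inner (epl ?ds) (Qv lm) = 1" by (rule Suc.IH [OF lm(1) lm1])
      then show ?thesis using True v1 sz by simp
    next
      case False
      then have "vs lam nu = 0" if "psize lam - psize nu = conj lam 1" using nu b that by blast
      then show ?thesis using False by simp
    qed
  qed
  also have "\<dots> = 1" using lam lm(1) sub by simp
  finally show ?case .
qed

lemma hl_ev_Qv_diag: "is_partition lam \<Longrightarrow> hl_inner (ev lam) (Qv lam) = 1"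
  unfolding ev_def by (rule hl_epl_conj_Qv_diag) (simp_all add: part_le_psize)

section \<open>Products of elementary functions span Lambda\<close>

lemma span_epl_mult:
  assumes "x \<in> sv.span (range epl)" "y \<in> sv.span (range epl)"
  shows "x * y \<in> sv.span (range epl)"
  using assms(1)
proof (induction rule: sv.span_induct_alt)
  case base
  show ?case by (simp add: sv.span_zero)
next
  case (step c x x')
  then obtain cs where cs: "x = epl cs" by auto
  have "epl cs * y \<in> sv.span (range epl)"
    using assms(2)
  proof (induction rule: sv.span_induct_alt)
    case base
    show ?case by (simp add: sv.span_zero)
  next
    case (step d z z')
    then obtain ds where ds: "z = epl ds" by auto
    have "epl cs * (cst d * z + z') = cst d * epl (cs @ ds) + epl cs * z'"
      by (simp only: ds epl_append distrib_left mult.left_commute)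
    then show ?case using step.IH by (simp add: sv.span_add sv.span_scale sv.span_base)
  qed
  then have "cst c * (epl cs * y) + x' * y \<in> sv.span (range epl)"
    using step.IH by (intro sv.span_add sv.span_scale)
  then show ?case by (simp only: cs distrib_right mult.assoc)
qed

lemma psexp_minus_in_span: "psexp (\<lambda>n. -1) k \<in> sv.span (range epl)"
proof -
  have "psexp (\<lambda>n. -1) k = cst ((-1) ^ k) * epl [k]"
    by (simp add: eg_def mult.assoc [symmetric] cst_mult [symmetric] power_mult_distrib [symmetric])
  then show ?thesis by (metis rangeI sv.span_base sv.span_scale)
qed

text \<open>Newton's identity: in the recursion for e_n the term m = n is p_n alone, and the others
  involve smaller power sums.\<close>

lemma pw_in_span: "n \<ge> 1 \<Longrightarrow> pw n \<in> sv.span (range epl)"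
proof (induction n rule: less_induct)
  case (less n)
  let ?g = "psexp (\<lambda>n. -1)"
  have "{1..n} = insert n {1..<n}" using less.prems by auto
  then have "(\<Sum>m=1..n. cst (-1) * pw m * ?g (n - m)) = - pw n - (\<Sum>m\<in>{1..<n}. pw m * ?g (n - m))"
    by (simp add: cst_minus sum_negf)
  then have "of_nat n * ?g n = - pw n - (\<Sum>m\<in>{1..<n}. pw m * ?g (n - m))"
    by (rule trans [OF psexp_rec])
  then have "pw n = - (of_nat n * ?g n) - (\<Sum>m\<in>{1..<n}. pw m * ?g (n - m))"
    by simp
  moreover have "of_nat n * ?g n \<in> sv.span (range epl)"
    unfolding cst_of_nat [symmetric] by (rule sv.span_scale [OF psexp_minus_in_span])
  moreover have "(\<Sum>m\<in>{1..<n}. pw m * ?g (n - m)) \<in> sv.span (range epl)"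
    using less.IH by (intro sv.span_sum span_epl_mult psexp_minus_in_span) auto
  ultimately show ?case by (simp only: sv.span_diff sv.span_neg)
qed

text \<open>Factors commute, so the indices may be sorted, and a decreasing list is the list of
  columns of a partition; zeros in it are harmless because e_0 = 1.\<close>

lemma epl_in_ev: "epl cs \<in> ev ` {l. is_partition l}"
proof -
  define ds where "ds = rev (sort cs)"
  define n where "n = length ds"
  define c where "c j = (if 1 \<le> j \<and> j \<le> n then ds ! (j - 1) else 0)" for j
  have srt: "sorted_wrt (\<ge>) ds" by (simp add: ds_def sorted_wrt_rev)
  have "c (Suc j) \<le> c j" if "j \<ge> 1" for j
  proof (cases "Suc j \<le> n")
    case True
    then have "ds ! j \<le> ds ! (j - 1)"
      using sorted_wrt_nth_less [OF srt, of "j - 1" j] that by (simp add: n_def)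
    then show ?thesis using True that by (simp add: c_def)
  qed (simp add: c_def)
  then obtain al where al: "is_partition al" "\<And>j. j \<ge> 1 \<Longrightarrow> conj al j = c j"
    using ex_partition_conj [of c n] by (auto simp: c_def)
  have "part al 1 \<le> n" using part_1_le_iff [OF al(1)] al(2) by (simp add: c_def)
  then have "ev al = epl (map (conj al) [1..<Suc n])"
    using epl_conj_eq_ev [OF al(1)] by simp
  also have "map (conj al) [1..<Suc n] = ds"
    by (rule nth_equalityI) (auto simp: n_def al c_def simp del: upt_Suc)
  also have "epl ds = epl cs"
  proof -
    have "mset (map eg ds) = mset (map eg cs)" by (simp add: ds_def)
    then show ?thesis unfolding epl_def prod_mset_prod_list [symmetric] by simp
  qed
  finally have "epl cs = ev al" by (rule sym)
  then show ?thesis by (rule image_eqI) (simp add: al(1))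
qed

lemma in_Lambda_span_ev:
  assumes "in_Lambda f"
  shows "f \<in> sv.span (ev ` {l. is_partition l})"
proof -
  have "pm M \<in> sv.span (range epl)" if "0 \<notin># M" for M
    using that
  proof (induction M)
    case empty
    have "epl [] \<in> sv.span (range epl)" by (intro sv.span_base rangeI)
    then show ?case by simp
  next
    case (add n M)
    then have "pw n \<in> sv.span (range epl)" "pm M \<in> sv.span (range epl)"
      by (auto intro: pw_in_span)
    then show ?case by (subst pm_add_mset) (rule span_epl_mult)
  qed
  then have "(\<Sum>M\<in>Poly_Mapping.keys f. cst (Poly_Mapping.lookup f M) * pm M) \<in> sv.span (range epl)"
    using assms by (intro sv.span_sum sv.span_scale) (auto simp: in_Lambda_def)
  then have "f \<in> sv.span (range epl)" by (simp only: sym_expand [symmetric])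
  moreover have "sv.span (range epl) \<subseteq> sv.span (ev ` {l. is_partition l})"
    using epl_in_ev by (intro sv.span_mono) auto
  ultimately show ?thesis by blast
qed

section \<open>Triangular systems over a finite strict order\<close>

lemma card_below_less:
  assumes "finite I" "i \<in> I" "k \<in> I" "R i k"
    and tr: "\<And>i j k. i \<in> I \<Longrightarrow> j \<in> I \<Longrightarrow> k \<in> I \<Longrightarrow> R i j \<Longrightarrow> R j k \<Longrightarrow> R i k"
    and irr: "\<And>i. i \<in> I \<Longrightarrow> \<not> R i i"
  shows "card {j \<in> I. R k j} < card {j \<in> I. R i j}"
proof (rule psubset_card_mono)
  show "{j \<in> I. R k j} \<subset> {j \<in> I. R i j}"
    using assms(2-4) tr [of i k] irr [of k] by blast
qed (use assms(1) in simp)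

text \<open>Inversion of a unitriangular matrix of pairings. It yields the basis dual to the
  Q_lambda from the e_{lambda'}, and later the monomial functions from that basis.\<close>

lemma dual_family_exists:
  fixes y z :: "nat list \<Rightarrow> sym"
  assumes fin: "finite I"
    and tr: "\<And>i j k. i \<in> I \<Longrightarrow> j \<in> I \<Longrightarrow> k \<in> I \<Longrightarrow> R i j \<Longrightarrow> R j k \<Longrightarrow> R i k"
    and irr: "\<And>i. i \<in> I \<Longrightarrow> \<not> R i i"
    and diag: "\<And>i. i \<in> I \<Longrightarrow> hl_inner (y i) (z i) = 1"
    and tri: "\<And>i j. i \<in> I \<Longrightarrow> j \<in> I \<Longrightarrow> hl_inner (y i) (z j) \<noteq> 0 \<Longrightarrow> i = j \<or> R i j"
  shows "\<exists>x. \<forall>i\<in>I. (\<forall>j\<in>I. hl_inner (x i) (z j) = (if i = j then 1 else 0)) \<and>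
    x i - y i \<in> sv.span (y ` {j \<in> I. R i j})"
proof -
  have "\<exists>x. (\<forall>j\<in>I. hl_inner x (z j) = (if i = j then 1 else 0)) \<and>
      x - y i \<in> sv.span (y ` {j \<in> I. R i j})" if "i \<in> I" for i
    using that
  proof (induction "card {j \<in> I. R i j}" arbitrary: i rule: less_induct)
    case (less i)
    note i = less.prems
    let ?S = "{j \<in> I. R i j}"
    have ex: "\<forall>k\<in>?S. \<exists>x. (\<forall>j\<in>I. hl_inner x (z j) = (if k = j then 1 else 0)) \<and>
      x - y k \<in> sv.span (y ` {j \<in> I. R k j})"
    proof
      fix k assume k: "k \<in> ?S"
      have "card {j \<in> I. R k j} < card ?S"
        by (rule card_below_less [OF fin i]) (use k tr irr in blast)+
      then show "\<exists>x. (\<forall>j\<in>I. hl_inner x (z j) = (if k = j then 1 else 0)) \<and>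
        x - y k \<in> sv.span (y ` {j \<in> I. R k j})"
        using less.hyps k by simp
    qed
    obtain X where X: "\<forall>k\<in>?S. (\<forall>j\<in>I. hl_inner (X k) (z j) = (if k = j then 1 else 0)) \<and>
      X k - y k \<in> sv.span (y ` {j \<in> I. R k j})"
      by (rule exE [OF bchoice [OF ex]])
    \<comment> \<open>The X_k are already dual to the z_j, so subtracting them removes the unwanted
      pairings without creating new ones.\<close>
    let ?x = "y i - (\<Sum>k\<in>?S. cst (hl_inner (y i) (z k)) * X k)"
    have "hl_inner ?x (z j) = (if i = j then 1 else 0)" if j: "j \<in> I" for j
    proof -
      have "hl_inner ?x (z j) = hl_inner (y i) (z j) - (\<Sum>k\<in>?S. hl_inner (y i) (z k) * hl_inner (X k) (z j))"
        by (simp only: hl_diff_left hl_sum_left hl_cst_left)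
      also have "(\<Sum>k\<in>?S. hl_inner (y i) (z k) * hl_inner (X k) (z j)) =
          (\<Sum>k\<in>?S. if k = j then hl_inner (y i) (z j) else 0)"
        using X j by (intro sum.cong refl) auto
      also have "\<dots> = (if R i j then hl_inner (y i) (z j) else 0)"
        using fin j by simp
      finally have "hl_inner ?x (z j) = hl_inner (y i) (z j) - (if R i j then hl_inner (y i) (z j) else 0)" .
      then show ?thesis using diag [OF i] tri [OF i j] irr [OF i] by auto
    qed
    moreover have "?x - y i \<in> sv.span (y ` ?S)"
    proof -
      have "X k \<in> sv.span (y ` ?S)" if k: "k \<in> ?S" for k
      proof -
        have "y ` {j \<in> I. R k j} \<subseteq> y ` ?S" using tr [OF i] k by blast
        then have "X k - y k \<in> sv.span (y ` ?S)" using X k sv.span_mono by blast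
        moreover have "y k \<in> sv.span (y ` ?S)" using k by (intro sv.span_base) blast
        ultimately have "(X k - y k) + y k \<in> sv.span (y ` ?S)" by (rule sv.span_add)
        then show ?thesis by simp
      qed
      then have "- (\<Sum>k\<in>?S. cst (hl_inner (y i) (z k)) * X k) \<in> sv.span (y ` ?S)"
        by (intro sv.span_neg sv.span_sum sv.span_scale)
      then show ?thesis by simp
    qed
    ultimately show ?case by blast
  qed
  then show ?thesis by (intro bchoice ballI)
qed

text \<open>A unitriangular change of family is inverted by induction on the number of indices above
  i. Applied to express e_{lambda'} by the dual basis, and the dual basis by the q_lambda.\<close>

lemma triangular_inverse:
  fixes x y :: "nat list \<Rightarrow> sym"
  assumes fin: "finite I"
    and tr: "\<And>i j k. i \<in> I \<Longrightarrow> j \<in> I \<Longrightarrow> k \<in> I \<Longrightarrow> R i j \<Longrightarrow> R j k \<Longrightarrow> R i k"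
    and irr: "\<And>i. i \<in> I \<Longrightarrow> \<not> R i i"
    and xy: "\<And>i. i \<in> I \<Longrightarrow> x i - y i \<in> sv.span (y ` {j \<in> I. R i j})"
    and i: "i \<in> I"
  shows "y i \<in> sv.span (x ` {j \<in> I. j = i \<or> R i j})"
  using i
proof (induction "card {j \<in> I. R i j}" arbitrary: i rule: less_induct)
  case (less i)
  note i = less.prems
  let ?S = "{j \<in> I. j = i \<or> R i j}"
  have "y k \<in> sv.span (x ` ?S)" if k: "k \<in> {j \<in> I. R i j}" for k
  proof -
    have "card {j \<in> I. R k j} < card {j \<in> I. R i j}"
      by (rule card_below_less [OF fin i]) (use k tr irr in blast)+
    then have "y k \<in> sv.span (x ` {j \<in> I. j = k \<or> R k j})" using less.hyps k by simp
    moreover have "x ` {j \<in> I. j = k \<or> R k j} \<subseteq> x ` ?S" using tr [OF i] k by blast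
    ultimately show ?thesis using sv.span_mono by blast
  qed
  then have "sv.span (y ` {j \<in> I. R i j}) \<subseteq> sv.span (x ` ?S)"
    by (intro sv.span_minimal sv.subspace_span) blast
  then have "x i - y i \<in> sv.span (x ` ?S)" using xy [OF i] by blast
  moreover have "x i \<in> sv.span (x ` ?S)" using i by (intro sv.span_base) blast
  ultimately have m: "x i - (x i - y i) \<in> sv.span (x ` ?S)" by (rule sv.span_diff [rotated])
  have e: "x i - (x i - y i) = y i" by (rule diff_diff_eq2 [THEN trans]) simp
  show ?case using m unfolding e .
qed

section \<open>The basis dual to Q and its orthogonality\<close>

abbreviation Par :: "nat list set" where
  "Par \<equiv> {l. is_partition l}"

lemma partitions_of_iff: "l \<in> partitions_of n \<longleftrightarrow> is_partition l \<and> psize l = n"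
  by (simp add: partitions_of_def psize_def)

lemma hl_span_zero:
  assumes "f \<in> sv.span S" "\<And>x. x \<in> S \<Longrightarrow> hl_inner x g = 0"
  shows "hl_inner f g = 0"
  using assms(1)
proof (induction rule: sv.span_induct_alt)
  case (step c x y)
  then show ?case using assms(2) by (simp add: hl_add_left hl_cst_left)
qed simp

lemma homog_span:
  assumes "f \<in> sv.span S" "\<And>x. x \<in> S \<Longrightarrow> homog n x"
  shows "homog n f"
  using assms(1)
proof (induction rule: sv.span_induct_alt)
  case (step c x y)
  then show ?case using assms(2) by (intro homog_add homog_cst_mult)
qed simp

text \<open>Conjugation reverses dominance, so these partitions lie strictly below lam in the
  dominance order itself; see \<open>cd_above_dominated\<close>.\<close>

definition cd_above :: "nat list \<Rightarrow> nat list set" where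
  "cd_above lam = {mu. is_partition mu \<and> psize mu = psize lam \<and> cd lam mu \<and> mu \<noteq> lam}"

lemma cd_strict:
  shows "\<And>i j k. i \<in> partitions_of n \<Longrightarrow> j \<in> partitions_of n \<Longrightarrow> k \<in> partitions_of n \<Longrightarrow>
      cd i j \<and> j \<noteq> i \<Longrightarrow> cd j k \<and> k \<noteq> j \<Longrightarrow> cd i k \<and> k \<noteq> i"
  using cd_trans cd_antisym by (metis partitions_of_iff)

lemma cd_above_partitions_of:
  "i \<in> partitions_of n \<Longrightarrow> {j \<in> partitions_of n. cd i j \<and> j \<noteq> i} = cd_above i"
  by (auto simp: cd_above_def partitions_of_iff)

text \<open>Duality is imposed within one degree, where there are finitely many partitions; between
  different degrees it follows from homogeneity.\<close>

definition dual_of_Qv :: "(nat list \<Rightarrow> sym) \<Rightarrow> bool" where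
  "dual_of_Qv P \<longleftrightarrow> (\<forall>lam. is_partition lam \<longrightarrow>
     (\<forall>mu\<in>partitions_of (psize lam). hl_inner (P lam) (Qv mu) = (if lam = mu then 1 else 0)) \<and>
     P lam - ev lam \<in> sv.span (ev ` cd_above lam))"

lemma ex_dual_of_Qv: "\<exists>P. dual_of_Qv P"
proof -
  have ex: "\<forall>n. \<exists>x. \<forall>i\<in>partitions_of n. (\<forall>j\<in>partitions_of n. hl_inner (x i) (Qv j) = (if i = j then 1 else 0)) \<and>
    x i - ev i \<in> sv.span (ev ` {j \<in> partitions_of n. cd i j \<and> j \<noteq> i})"
  proof (rule allI, rule dual_family_exists)
    fix n
    show "finite (partitions_of n)" by simp
    show "cd i k \<and> k \<noteq> i" if "i \<in> partitions_of n" "j \<in> partitions_of n" "k \<in> partitions_of n"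
      "cd i j \<and> j \<noteq> i" "cd j k \<and> k \<noteq> j" for i j k
      by (rule cd_strict [OF that])
    show "hl_inner (ev i) (Qv i) = 1" if "i \<in> partitions_of n" for i
      using that by (simp add: partitions_of_iff hl_ev_Qv_diag)
    show "i = j \<or> cd i j \<and> j \<noteq> i" if "i \<in> partitions_of n" "j \<in> partitions_of n"
      "hl_inner (ev i) (Qv j) \<noteq> 0" for i j
      using that hl_ev_Qv_nonzero [of i j] by (auto simp: partitions_of_iff)
  qed simp
  obtain X where X: "\<forall>n. \<forall>i\<in>partitions_of n.
    (\<forall>j\<in>partitions_of n. hl_inner (X n i) (Qv j) = (if i = j then 1 else 0)) \<and>
    X n i - ev i \<in> sv.span (ev ` {j \<in> partitions_of n. cd i j \<and> j \<noteq> i})"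
    by (rule exE [OF choice [OF ex]])
  have "dual_of_Qv (\<lambda>lam. X (psize lam) lam)"
    unfolding dual_of_Qv_def
  proof (intro allI impI)
    fix lam assume "is_partition lam"
    then have l: "lam \<in> partitions_of (psize lam)" by (simp add: partitions_of_iff)
    show "(\<forall>mu\<in>partitions_of (psize lam). hl_inner (X (psize lam) lam) (Qv mu) = (if lam = mu then 1 else 0)) \<and>
      X (psize lam) lam - ev lam \<in> sv.span (ev ` cd_above lam)"
      using X [rule_format, OF l] unfolding cd_above_partitions_of [OF l] by blast
  qed
  then show ?thesis by (rule exI [where x = "\<lambda>lam. X (psize lam) lam"])
qed

text \<open>The future P_lambda. It can be identified with \<open>HLP\<close> only after its
  orthogonality has been shown.\<close>

definition Pt :: "nat list \<Rightarrow> sym" where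
  "Pt = (SOME P. dual_of_Qv P)"

lemma dual_of_Qv_Pt: "dual_of_Qv Pt"
  unfolding Pt_def by (rule someI_ex [OF ex_dual_of_Qv])

lemma Pt_diff_ev: "is_partition lam \<Longrightarrow> Pt lam - ev lam \<in> sv.span (ev ` cd_above lam)"
  using dual_of_Qv_Pt unfolding dual_of_Qv_def by blast

lemma homog_Pt: "is_partition lam \<Longrightarrow> homog (psize lam) (Pt lam)"
proof -
  assume lam: "is_partition lam"
  have "homog (psize lam) (Pt lam - ev lam)"
    using Pt_diff_ev [OF lam]
  proof (rule homog_span)
    fix x assume "x \<in> ev ` cd_above lam"
    then obtain mu where "is_partition mu" "psize mu = psize lam" "x = ev mu"
      by (auto simp: cd_above_def)
    then show "homog (psize lam) x" using homog_ev [of mu] by simp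
  qed
  from homog_add [OF this homog_ev [OF lam]] show ?thesis by simp
qed

lemma hl_Pt_Qv:
  assumes "is_partition lam" "is_partition mu"
  shows "hl_inner (Pt lam) (Qv mu) = (if lam = mu then 1 else 0)"
proof (cases "psize lam = psize mu")
  case True
  then have "mu \<in> partitions_of (psize lam)" using assms by (simp add: partitions_of_iff)
  then show ?thesis using dual_of_Qv_Pt assms unfolding dual_of_Qv_def by blast
next
  case False
  then show ?thesis using hl_homog_neq [OF homog_Pt homog_Qv] assms by auto
qed

lemma in_Lambda_span_Pt:
  assumes "in_Lambda f"
  shows "f \<in> sv.span (Pt ` Par)"
proof -
  have "ev lam \<in> sv.span (Pt ` Par)" if lam: "is_partition lam" for lam
  proof -
    let ?I = "partitions_of (psize lam)"
    have "ev lam \<in> sv.span (Pt ` {j \<in> ?I. j = lam \<or> cd lam j \<and> j \<noteq> lam})"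
    proof (rule triangular_inverse)
      show "finite ?I" by simp
      show "cd i k \<and> k \<noteq> i" if "i \<in> ?I" "j \<in> ?I" "k \<in> ?I" "cd i j \<and> j \<noteq> i" "cd j k \<and> k \<noteq> j" for i j k
        by (rule cd_strict [OF that])
      show "Pt i - ev i \<in> sv.span (ev ` {j \<in> ?I. cd i j \<and> j \<noteq> i})" if "i \<in> ?I" for i
        unfolding cd_above_partitions_of [OF that] using that by (intro Pt_diff_ev) (simp add: partitions_of_iff)
      show "lam \<in> ?I" using lam by (simp add: partitions_of_iff)
    qed simp
    moreover have "Pt ` {j \<in> ?I. j = lam \<or> cd lam j \<and> j \<noteq> lam} \<subseteq> Pt ` Par"
      by (auto simp: partitions_of_iff)
    ultimately show ?thesis using sv.span_mono by blast
  qed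
  then have "sv.span (ev ` Par) \<subseteq> sv.span (Pt ` Par)"
    by (intro sv.span_minimal sv.subspace_span) blast
  then show ?thesis using in_Lambda_span_ev [OF assms] by blast
qed

text \<open>The expansion is asserted for every sufficiently large finite F, so that expansions can
  be added in the induction over the span.\<close>

lemma Pt_expand_finite:
  assumes "f \<in> sv.span (Pt ` Par)"
  shows "\<exists>F0. finite F0 \<and> F0 \<subseteq> Par \<and> (\<forall>F. finite F \<and> F0 \<subseteq> F \<and> F \<subseteq> Par \<longrightarrow>
    f = (\<Sum>lam\<in>F. cst (hl_inner f (Qv lam)) * Pt lam))"
  using assms
proof (induction rule: sv.span_induct_alt)
  case base
  show ?case by (rule exI [of _ "{}"]) simp
next
  case (step c x y)
  then obtain l where l: "x = Pt l" "is_partition l" by auto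
  from step.IH obtain F0 where F0: "finite F0" "F0 \<subseteq> Par"
    "\<forall>F. finite F \<and> F0 \<subseteq> F \<and> F \<subseteq> Par \<longrightarrow> y = (\<Sum>lam\<in>F. cst (hl_inner y (Qv lam)) * Pt lam)"
    by (elim exE conjE)
  have "cst c * x + y = (\<Sum>lam\<in>F. cst (hl_inner (cst c * x + y) (Qv lam)) * Pt lam)"
    if F: "finite F" "insert l F0 \<subseteq> F" "F \<subseteq> Par" for F
  proof -
    have "(\<Sum>lam\<in>F. cst (hl_inner (cst c * x + y) (Qv lam)) * Pt lam) =
      (\<Sum>lam\<in>F. cst (c * hl_inner x (Qv lam)) * Pt lam) + (\<Sum>lam\<in>F. cst (hl_inner y (Qv lam)) * Pt lam)"
      by (simp only: hl_add_left hl_cst_left cst_add distrib_right sum.distrib)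
    also have "(\<Sum>lam\<in>F. cst (hl_inner y (Qv lam)) * Pt lam) = y"
      by (rule F0(3) [rule_format, symmetric]) (use F in auto)
    also have "(\<Sum>lam\<in>F. cst (c * hl_inner x (Qv lam)) * Pt lam) = (\<Sum>lam\<in>F. if l = lam then cst c * Pt lam else 0)"
    proof (rule sum.cong [OF refl])
      fix lam assume "lam \<in> F"
      then have "is_partition lam" using F by auto
      then have "hl_inner x (Qv lam) = (if l = lam then 1 else 0)"
        unfolding l(1) by (rule hl_Pt_Qv [OF l(2)])
      then show "cst (c * hl_inner x (Qv lam)) * Pt lam = (if l = lam then cst c * Pt lam else 0)"
        by simp
    qed
    also have "\<dots> = cst c * x" using F l by simp
    finally show ?thesis ..
  qed
  note main = this
  show ?case
  proof (intro exI [of _ "insert l F0"] conjI allI impI)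
    show "finite (insert l F0)" "insert l F0 \<subseteq> Par" using F0 l by auto
    fix F assume F: "finite F \<and> insert l F0 \<subseteq> F \<and> F \<subseteq> Par"
    show "cst c * x + y = (\<Sum>lam\<in>F. cst (hl_inner (cst c * x + y) (Qv lam)) * Pt lam)"
      by (rule main) (use F in simp_all)
  qed
qed

lemma Pt_expand:
  assumes "homog n f"
  shows "f = (\<Sum>lam\<in>partitions_of n. cst (hl_inner f (Qv lam)) * Pt lam)"
proof -
  from Pt_expand_finite [OF in_Lambda_span_Pt [OF homog_imp_in_Lambda [OF assms]]]
  obtain F0 where F0: "finite F0" "F0 \<subseteq> Par" "\<forall>F. finite F \<and> F0 \<subseteq> F \<and> F \<subseteq> Par \<longrightarrow>
    f = (\<Sum>lam\<in>F. cst (hl_inner f (Qv lam)) * Pt lam)" by (elim exE conjE)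
  let ?F = "F0 \<union> partitions_of n"
  have "f = (\<Sum>lam\<in>?F. cst (hl_inner f (Qv lam)) * Pt lam)"
    by (rule F0(3) [rule_format]) (use F0(1,2) in \<open>auto simp: partitions_of_iff\<close>)
  also have "\<dots> = (\<Sum>lam\<in>partitions_of n. cst (hl_inner f (Qv lam)) * Pt lam)"
  proof (rule sum.mono_neutral_right)
    show "\<forall>lam\<in>?F - partitions_of n. cst (hl_inner f (Qv lam)) * Pt lam = 0"
    proof
      fix lam assume "lam \<in> ?F - partitions_of n"
      then have "is_partition lam" "n \<noteq> psize lam" using F0(2) by (auto simp: partitions_of_iff)
      then show "cst (hl_inner f (Qv lam)) * Pt lam = 0"
        using hl_homog_neq [OF assms homog_Qv] by simp
    qed
  qed (use F0 in auto)
  finally show ?thesis .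
qed

lemma Qv_nondegenerate:
  assumes "in_Lambda f" "\<And>lam. is_partition lam \<Longrightarrow> hl_inner f (Qv lam) = 0"
  shows "f = 0"
proof -
  from Pt_expand_finite [OF in_Lambda_span_Pt [OF assms(1)]]
  obtain F where "finite F" and F: "F \<subseteq> Par" and F': "\<forall>G. finite G \<and> F \<subseteq> G \<and> G \<subseteq> Par \<longrightarrow>
    f = (\<Sum>lam\<in>G. cst (hl_inner f (Qv lam)) * Pt lam)" by (elim exE conjE)
  have f: "f = (\<Sum>lam\<in>F. cst (hl_inner f (Qv lam)) * Pt lam)"
    by (rule F' [rule_format]) (use \<open>finite F\<close> F in auto)
  have "(\<Sum>lam\<in>F. cst (hl_inner f (Qv lam)) * Pt lam) = 0"
    using F assms(2) by (intro sum.neutral) auto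
  with f show ?thesis by (rule trans)
qed

lemma Pt_nondegenerate:
  assumes "in_Lambda g" "\<And>lam. is_partition lam \<Longrightarrow> hl_inner (Pt lam) g = 0"
  shows "g = 0"
proof (rule hl_nondegenerate [OF assms(1)])
  fix M :: "nat multiset" assume "0 \<notin># M"
  then have "in_Lambda (pm M)" by (rule homog_imp_in_Lambda [OF homog_pm [OF _ refl]])
  then have "pm M \<in> sv.span (Pt ` Par)" by (rule in_Lambda_span_Pt)
  then show "hl_inner (pm M) g = 0"
  proof (rule hl_span_zero)
    fix x assume "x \<in> Pt ` Par"
    then obtain l where "x = Pt l" "is_partition l" by blast
    then show "hl_inner x g = 0" using assms(2) by simp
  qed
qed

section \<open>Products of the q_r and their pairings\<close>

definition qp :: "nat list \<Rightarrow> sym" where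
  "qp nu = prod_list (map qg nu)"

lemma qp_simps [simp]: "qp [] = 1" "qp (r # nu) = qg r * qp nu"
  by (simp_all add: qp_def)

lemma homog_qp: "homog (psize nu) (qp nu)"
  by (induction nu) (simp_all add: psize_def homog_mult homog_qg)

lemma sum_part: "(\<Sum>i=1..k. part l i) = sum_list (take k l)"
proof (induction k)
  case (Suc k)
  show ?case
  proof (cases "k < length l")
    case True
    then show ?thesis using Suc by (simp add: take_Suc_conv_app_nth part_def)
  next
    case False
    then show ?thesis using Suc by (simp add: part_def)
  qed
qed simp

lemma psize_sum_part: "length l \<le> J \<Longrightarrow> psize l = (\<Sum>i=1..J. part l i)"
  unfolding sum_part psize_def by simp

lemma horiz_strip_part:
  assumes "is_partition lam" "is_partition mu" "horiz_strip lam mu" "i \<ge> 1"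
  shows "part lam (Suc i) \<le> part mu i"
proof (rule le_by_lower)
  fix j assume j: "1 \<le> j" "j \<le> part lam (Suc i)"
  then have "Suc i \<le> conj lam j" using assms le_part_iff_le_conj [of lam "Suc i" j] by simp
  also have "\<dots> \<le> conj mu j + 1" using assms(3) j by (auto simp: horiz_strip_def)
  finally show "j \<le> part mu i" using assms j le_part_iff_le_conj [of mu i j] by simp
qed

text \<open>The counterpart of the argument for products of e_c: the adjoint of q_r removes
  horizontal strips, and interlacing now concerns rows.\<close>

lemma hl_qp_Qv_nonzero:
  assumes "is_partition lam" "hl_inner (qp nu) (Qv lam) \<noteq> 0"
  shows "dominated nu lam"
  using assms
proof (induction nu arbitrary: lam)
  case (Cons r nu)
  from Cons.prems(2) obtain ka where ka: "ka \<in> below lam"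
    "(if psize lam - psize ka = r then hs lam ka * hl_inner (qp nu) (Qv ka) else 0) \<noteq> 0"
    unfolding qp_simps hl_qg_Qv [OF Cons.prems(1)] by (rule sum_nonzeroE)
  then have n: "is_partition ka" "contained ka lam" "psize lam - psize ka = r" "hs lam ka \<noteq> 0"
    "hl_inner (qp nu) (Qv ka) \<noteq> 0"
    by (auto split: if_splits)
  have hor: "horiz_strip lam ka" using n(4) by (auto simp: hs_def split: if_splits)
  show ?case
    unfolding dominated_def
  proof
    fix k
    show "sum_list (take k (r # nu)) \<le> sum_list (take k lam)"
    proof (cases k)
      case (Suc i)
      let ?J = "max i (max (length lam) (length ka))"
      have ab: "part lam (Suc j) \<le> part ka j" if "j \<ge> 1" for j
        by (rule horiz_strip_part [OF Cons.prems(1) n(1) hor that])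
      have "psize lam = r + psize ka"
        using n(3) contained_psize [OF n(1) Cons.prems(1) n(2)] by simp
      moreover have "psize lam = (\<Sum>j=1..Suc ?J. part lam j)" "psize ka = (\<Sum>j=1..Suc ?J. part ka j)"
        by (intro psize_sum_part; simp)+
      ultimately have "r + (\<Sum>j=1..i. part ka j) \<le> (\<Sum>j=1..Suc i. part lam j)"
        by (intro interlace_partial_sums [where J = ?J]) (simp_all only: ab max.cobounded1)
      moreover have "sum_list (take i nu) \<le> sum_list (take i ka)"
        using Cons.IH [OF n(1,5)] by (simp add: dominated_def)
      ultimately show ?thesis unfolding sum_part Suc by simp
    qed simp
  qed
qed (simp add: dominated_def)

lemma mult_Cons: "mult (a # l) j = (if a = j then Suc (mult l j) else mult l j)"
  by (simp add: mult_def)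

lemma bfac_superset: "finite A \<Longrightarrow> set l \<subseteq> A \<Longrightarrow> bfac l = (\<Prod>i\<in>A. qfac (mult l i))"
  unfolding bfac_def qfac_def [symmetric]
  by (rule prod.mono_neutral_left) (auto simp: mult_def count_list_0_iff)

lemma bfac_Cons: "bfac (r # nu) = (1 - tt ^ mult (r # nu) r) * bfac nu"
proof -
  let ?A = "insert r (set nu)"
  have rem: "(\<Prod>i\<in>?A. f i) = f r * (\<Prod>i\<in>?A - {r}. f i)" for f :: "nat \<Rightarrow> coef"
    by (rule prod.remove) auto
  have "bfac (r # nu) = (\<Prod>i\<in>?A. qfac (mult (r # nu) i))"
    by (rule bfac_superset) auto
  also note rem [of "\<lambda>i. qfac (mult (r # nu) i)"]
  finally have 1: "bfac (r # nu) = qfac (mult (r # nu) r) * (\<Prod>i\<in>?A - {r}. qfac (mult (r # nu) i))" .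
  have "bfac nu = (\<Prod>i\<in>?A. qfac (mult nu i))"
    by (rule bfac_superset) auto
  also note rem [of "\<lambda>i. qfac (mult nu i)"]
  finally have 2: "bfac nu = qfac (mult nu r) * (\<Prod>i\<in>?A - {r}. qfac (mult nu i))" .
  have 3: "(\<Prod>i\<in>?A - {r}. qfac (mult (r # nu) i)) = (\<Prod>i\<in>?A - {r}. qfac (mult nu i))"
    by (rule prod.cong) (auto simp: mult_Cons)
  show ?thesis unfolding 1 2 3 by (simp add: mult_Cons qfac_Suc mult_ac)
qed

lemma bfac_nonzero: "bfac l \<noteq> 0"
  by (subst bfac_superset [of "set l"]) auto

lemma contained_Cons: "is_partition (r # nu) \<Longrightarrow> contained nu (r # nu)"
  by (subst contained_iff_conj) (auto simp: is_partition_Cons conj_Cons)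

lemma hs_Cons:
  assumes "is_partition (r # nu)"
  shows "hs (r # nu) nu = 1 - tt ^ mult (r # nu) r"
proof -
  have r: "r \<ge> 1" using assms by (simp add: is_partition_Cons)
  have "horiz_strip (r # nu) nu" by (simp add: horiz_strip_def conj_Cons)
  moreover have "{j\<in>{1..part (r # nu) 1}. conj (r # nu) j = conj nu j + 1 \<and> conj (r # nu) (j+1) = conj nu (j+1)} = {r}"
    using r by (auto simp: conj_Cons part_def split: if_splits)
  ultimately show ?thesis by (simp add: hs_def)
qed

text \<open>A horizontal strip as large as the first row can only be removed so that the remaining
  rows are left, and the factors 1 - t^{m_r} of the successive removals multiply to
  b_lambda.\<close>

lemma hl_qp_Qv_diag: "is_partition lam \<Longrightarrow> hl_inner (qp lam) (Qv lam) = bfac lam"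
proof (induction lam)
  case Nil
  then show ?case by (simp add: hl_1_1 bfac_def)
next
  case (Cons r nu)
  note lam = Cons.prems
  have nu: "is_partition nu" using lam by (simp add: is_partition_Cons)
  have uniq: "ka = nu" if "ka \<in> below (r # nu)" "psize (r # nu) - psize ka = r" "hs (r # nu) ka \<noteq> 0" for ka
  proof -
    have k: "is_partition ka" "contained ka (r # nu)" using that by auto
    have "horiz_strip (r # nu) ka" using that(3) by (auto simp: hs_def split: if_splits)
    then have p: "part nu i \<le> part ka i" if "i \<ge> 1" for i
      using horiz_strip_part [OF lam k(1) _ that] that by (simp add: part_Cons)
    have "part nu i \<le> part ka i" for i using p [of i] by (cases i) simp_all
    then have "contained nu ka" by (simp add: contained_def)
    moreover have "psize nu = psize ka"
      using that(2) contained_psize [OF k(1) lam k(2)] by (simp add: psize_def)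
    ultimately show ?thesis using contained_eqI [OF nu k(1)] by simp
  qed
  have "hl_inner (qp (r # nu)) (Qv (r # nu)) = (\<Sum>ka\<in>below (r # nu).
    if psize (r # nu) - psize ka = r then hs (r # nu) ka * hl_inner (qp nu) (Qv ka) else 0)"
    unfolding qp_simps by (rule hl_qg_Qv [OF lam])
  also have "\<dots> = (\<Sum>ka\<in>below (r # nu). if ka = nu then hs (r # nu) nu * bfac nu else 0)"
  proof (rule sum.cong [OF refl])
    fix ka assume b: "ka \<in> below (r # nu)"
    show "(if psize (r # nu) - psize ka = r then hs (r # nu) ka * hl_inner (qp nu) (Qv ka) else 0) =
      (if ka = nu then hs (r # nu) nu * bfac nu else 0)"
    proof (cases "ka = nu")
      case True
      then show ?thesis using Cons.IH [OF nu] by (simp add: psize_def)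
    next
      case False
      then have "hs (r # nu) ka = 0" if "psize (r # nu) - psize ka = r" using uniq b that by blast
      then show ?thesis using False by simp
    qed
  qed
  also have "\<dots> = hs (r # nu) nu * bfac nu" using lam nu contained_Cons [OF lam] by simp
  finally show ?case by (simp add: hs_Cons [OF lam] bfac_Cons)
qed

text \<open>The exponents again have product -1, so an index drops by at most one. On products of
  several e_c this leads to \<open>decrements\<close>.\<close>

lemma qperp_eg: "qperp r (eg c) = (if r = 0 then eg c else if r = 1 \<and> c \<ge> 1 then eg (c - 1) else 0)"
proof -
  have "qperp r (eg c) = cst ((-1) ^ c) * qperp r (psexp (\<lambda>n. -1) c)"
    unfolding eg_def qperp_def by (rule lin_cst [OF lin_pshift])
  also have "qperp r (psexp (\<lambda>n. -1) c) = (if r = 0 then psexp (\<lambda>n. -1) c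
      else if r = 1 \<and> c \<ge> 1 then - psexp (\<lambda>n. -1) (c - 1) else 0)"
    unfolding qperp_def by (rule pshift_psexp_minus_one) simp
  finally show ?thesis by (cases c) (simp_all add: eg_def cst_minus)
qed

text \<open>All ways of lowering r of the entries, chosen at distinct positions, by one.\<close>

fun decrements :: "nat \<Rightarrow> nat list \<Rightarrow> nat list list" where
  "decrements r [] = (if r = 0 then [[]] else [])"
| "decrements r (c # cs) = map ((#) c) (decrements r cs) @
     (if r \<ge> 1 \<and> c \<ge> 1 then map ((#) (c - 1)) (decrements (r - 1) cs) else [])"

lemma sum_list_epl_Cons: "sum_list (map epl (map ((#) c) dss)) = eg c * sum_list (map epl dss)"
  by (induction dss) (simp_all add: distrib_left)

lemma qperp_epl: "qperp r (epl cs) = sum_list (map epl (decrements r cs))"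
proof (induction cs arbitrary: r)
  case Nil
  show ?case by (simp add: qperp_def pshift_one)
next
  case (Cons c cs)
  have "qperp r (epl (c # cs)) = (\<Sum>i\<le>r. qperp i (eg c) * qperp (r - i) (epl cs))"
    by (simp add: qperp_def pshift_mult)
  also have "\<dots> = (\<Sum>i\<in>(if r = 0 then {0} else {0, 1}). qperp i (eg c) * qperp (r - i) (epl cs))"
    by (intro sum.mono_neutral_right) (auto simp: qperp_eg)
  also have "\<dots> = eg c * qperp r (epl cs) + (if r \<ge> 1 \<and> c \<ge> 1 then eg (c - 1) * qperp (r - 1) (epl cs) else 0)"
    by (auto simp: qperp_eg)
  also have "\<dots> = sum_list (map epl (decrements r (c # cs)))"
    unfolding Cons.IH decrements.simps map_append sum_list_append sum_list_epl_Cons [symmetric] by simp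
  finally show ?case .
qed

text \<open>Termwise: 1 + min (c - 1) k = min c (k + 1) for a lowered entry c \<ge> 1, and min c k
  \<le> min c (k + 1) for the others.\<close>

lemma decrements_min:
  "ds \<in> set (decrements r cs) \<Longrightarrow> r + sum_list (map (\<lambda>d. min d k) ds) \<le> sum_list (map (\<lambda>c. min c (Suc k)) cs)"
proof (induction cs arbitrary: r ds)
  case (Cons c cs)
  consider ds' where "ds = c # ds'" "ds' \<in> set (decrements r cs)"
    | ds' where "ds = (c - 1) # ds'" "ds' \<in> set (decrements (r - 1) cs)" "r \<ge> 1" "c \<ge> 1"
    using Cons.prems by (auto split: if_splits)
  then show ?case
  proof cases
    case 1
    then show ?thesis using Cons.IH [of ds' r] by simp
  next
    case 2
    then show ?thesis using Cons.IH [of ds' "r - 1"] by simp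
  qed
qed (auto split: if_splits)

lemma hl_sum_list_nonzero:
  "hl_inner f (sum_list (map F xs)) \<noteq> 0 \<Longrightarrow> \<exists>x\<in>set xs. hl_inner f (F x) \<noteq> 0"
  by (induction xs) (auto simp: hl_add_right)

text \<open>If cs lists columns, the sum of min c k is the number of boxes in the first k rows. The
  adjoint of q_r takes r boxes from different columns, and \<open>decrements_min\<close> follows
  this count.\<close>

lemma hl_qp_epl_nonzero:
  "hl_inner (qp nu) (epl cs) \<noteq> 0 \<Longrightarrow> sum_list (take k nu) \<le> sum_list (map (\<lambda>c. min c k) cs)"
proof (induction nu arbitrary: cs k)
  case (Cons r nu)
  then have "hl_inner (qp nu) (sum_list (map epl (decrements r cs))) \<noteq> 0"
    by (simp add: hl_qg_mult qperp_epl)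
  then obtain ds where ds: "ds \<in> set (decrements r cs)" "hl_inner (qp nu) (epl ds) \<noteq> 0"
    using hl_sum_list_nonzero by blast
  show ?case
  proof (cases k)
    case (Suc i)
    have "sum_list (take k (r # nu)) = r + sum_list (take i nu)" using Suc by simp
    also have "\<dots> \<le> r + sum_list (map (\<lambda>d. min d i) ds)" using Cons.IH [OF ds(2)] by simp
    also have "\<dots> \<le> sum_list (map (\<lambda>c. min c k) cs)" using decrements_min [OF ds(1)] Suc by simp
    finally show ?thesis .
  qed simp
qed simp

lemma conj_take: "is_partition l \<Longrightarrow> conj (take k l) j = min (conj l j) k"
proof (induction l arbitrary: k)
  case (Cons a l)
  have l: "is_partition l" using Cons.prems by (simp add: is_partition_Cons)
  show ?case
  proof (cases k)
    case (Suc i)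
    show ?thesis
    proof (cases "j \<le> a")
      case True
      then show ?thesis using Cons.IH [OF l, of i] Suc by (simp add: conj_Cons)
    next
      case False
      then have "conj l j = 0" using Cons.prems by (intro conj_eq_0) (auto simp: is_partition_Cons)
      then show ?thesis using Cons.IH [OF l, of i] Suc False by (simp add: conj_Cons)
    qed
  qed simp
qed simp

lemma sum_min_conj:
  assumes "is_partition l" "part l 1 \<le> J"
  shows "(\<Sum>j=1..J. min (conj l j) k) = sum_list (take k l)"
proof -
  have "sum_list (take k l) = (\<Sum>j=1..J. conj (take k l) j)"
    using assms set_le_part_1 [OF assms(1)] by (intro sum_conj_aux) (auto dest!: in_set_takeD intro: le_trans)
  then show ?thesis by (simp add: conj_take [OF assms(1)])
qed

lemma hl_qp_ev_nonzero:
  assumes "is_partition al" "hl_inner (qp nu) (ev al) \<noteq> 0"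
  shows "dominated nu al"
  unfolding dominated_def
proof
  fix k
  have "map (\<lambda>c. min c k) (map (conj al) [1..<Suc (psize al)]) = map (\<lambda>j. min (conj al j) k) [1..<Suc (psize al)]"
    by simp
  then show "sum_list (take k nu) \<le> sum_list (take k al)"
    using hl_qp_epl_nonzero [OF assms(2) [unfolded ev_def], of k] sum_min_conj [OF assms(1) part_le_psize, of k]
    by (simp only: sum_list_map_upt)
qed

lemma decrements_short: "length cs < r \<Longrightarrow> decrements r cs = []"
  by (induction cs arbitrary: r) auto

lemma decrements_full: "\<forall>c\<in>set cs. c \<ge> 1 \<Longrightarrow> decrements (length cs) cs = [map (\<lambda>c. c - 1) cs]"
  by (induction cs) (auto simp: decrements_short)

text \<open>Lowering r distinct entries of a list of r positive columns is possible in one way only,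
  and it deletes the first row.\<close>

lemma hl_qp_ev_diag: "is_partition lam \<Longrightarrow> hl_inner (qp lam) (ev lam) = 1"
proof (induction lam)
  case Nil
  then show ?case by (simp add: ev_def hl_1_1)
next
  case (Cons r nu)
  have nu: "is_partition nu" "\<forall>x\<in>set nu. x \<le> r" using Cons.prems by (auto simp: is_partition_Cons)
  have pn: "part nu 1 \<le> r" using nu(2) by (cases nu) (auto simp: part_def)
  let ?cs = "map (conj (r # nu)) [1..<Suc r]"
  have "ev (r # nu) = epl ?cs"
    by (rule epl_conj_eq_ev [OF Cons.prems, symmetric]) (simp add: part_def)
  then have "hl_inner (qp (r # nu)) (ev (r # nu)) = hl_inner (qp nu) (qperp r (epl ?cs))"
    by (simp only: qp_simps hl_qg_mult)
  also have "qperp r (epl ?cs) = sum_list (map epl (decrements (length ?cs) ?cs))"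
    by (simp add: qperp_epl del: upt_Suc)
  also have "decrements (length ?cs) ?cs = [map (\<lambda>c. c - 1) ?cs]"
    by (rule decrements_full) (auto simp: conj_Cons)
  also have "map (\<lambda>c. c - 1) ?cs = map (conj nu) [1..<Suc r]"
    by (auto simp: conj_Cons simp del: upt_Suc)
  also have "sum_list (map epl [map (conj nu) [1..<Suc r]]) = ev nu"
    by (simp only: epl_conj_eq_ev [OF nu(1) pn] list.map sum_list.Cons sum_list.Nil add_0_right)
  finally show ?case using Cons.IH [OF nu(1)] by simp
qed

text \<open>Conjugation reverses dominance. The boxes in the first k rows are counted by columns, as
  sums of \<open>min (conj l j) k\<close>.\<close>

lemma cd_imp_dominated:
  assumes "is_partition a" "is_partition b" "psize a = psize b" "cd a b"
  shows "dominated b a"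
  unfolding dominated_def
proof
  fix k
  \<comment> \<open>The columns of a up to this one have more than k boxes and the later ones at
    most k, so for a the minimum is known on either side.\<close>
  let ?m = "part a (Suc k)"
  let ?J = "max ?m (max (part a 1) (part b 1))"
  have split: "(\<Sum>j=1..?J. f j) = (\<Sum>j=1..?m. f j) + (\<Sum>j=Suc ?m..?J. f j)" for f :: "nat \<Rightarrow> nat"
  proof -
    obtain p where p: "?J = ?m + p" using le_Suc_ex [of ?m ?J] by auto
    show ?thesis unfolding p using sum.ub_add_nat [of 1 ?m f p] by simp
  qed
  have m: "Suc k \<le> conj a j \<longleftrightarrow> j \<le> ?m" if "j \<ge> 1" for j
    using le_part_iff_le_conj [OF assms(1), of "Suc k" j] that by simp
  have "(\<Sum>j=1..?J. min (conj b j) k) \<le> (\<Sum>j=1..?m. k) + (\<Sum>j=Suc ?m..?J. conj b j)"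
    unfolding split by (intro add_mono sum_mono) auto
  moreover have "(\<Sum>j=1..?J. min (conj a j) k) = (\<Sum>j=1..?m. k) + (\<Sum>j=Suc ?m..?J. conj a j)"
  proof -
    have "(\<Sum>j=1..?m. min (conj a j) k) = (\<Sum>j=1..?m. k)"
      using m by (intro sum.cong) (auto simp: Suc_le_eq)
    moreover have "(\<Sum>j=Suc ?m..?J. min (conj a j) k) = (\<Sum>j=Suc ?m..?J. conj a j)"
    proof (rule sum.cong [OF refl])
      fix j assume "j \<in> {Suc ?m..?J}"
      then show "min (conj a j) k = conj a j" using m [of j] by simp
    qed
    ultimately show ?thesis unfolding split by simp
  qed
  moreover have "(\<Sum>j=1..?m. conj b j) + (\<Sum>j=Suc ?m..?J. conj b j) = (\<Sum>j=1..?m. conj a j) + (\<Sum>j=Suc ?m..?J. conj a j)"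
    unfolding split [symmetric] using assms psize_conj [OF assms(1), of ?J] psize_conj [OF assms(2), of ?J] by simp
  moreover have "(\<Sum>j=1..?m. conj a j) \<le> (\<Sum>j=1..?m. conj b j)" using assms(4) by (simp add: cd_def)
  ultimately have "(\<Sum>j=1..?J. min (conj b j) k) \<le> (\<Sum>j=1..?J. min (conj a j) k)" by linarith
  then show "sum_list (take k b) \<le> sum_list (take k a)"
    using sum_min_conj [OF assms(1), of ?J k] sum_min_conj [OF assms(2), of ?J k] by simp
qed

lemma dominated_refl [simp]: "dominated a a"
  by (simp add: dominated_def)

lemma dominated_trans: "dominated a b \<Longrightarrow> dominated b c \<Longrightarrow> dominated a c"
  unfolding dominated_def by (meson order_trans)

lemma dominated_antisym:
  assumes "is_partition a" "is_partition b" "dominated a b" "dominated b a"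
  shows "a = b"
proof -
  have s: "(\<Sum>i=1..k. part a i) = (\<Sum>i=1..k. part b i)" for k
    unfolding sum_part using assms(3,4) unfolding dominated_def by (intro le_antisym) auto
  have "part a i = part b i" for i
    using partial_sums_eqD [of "part a" "part b", OF s, of i] by (cases i) simp_all
  then have "contained a b" "contained b a" by (simp_all add: contained_def)
  moreover from this have "psize a = psize b"
    using contained_psize [OF assms(1,2)] contained_psize [OF assms(2,1)] by simp
  ultimately show ?thesis using contained_eqI [OF assms(1,2)] by simp
qed

lemma dominated_strict:
  shows "\<And>i j k. i \<in> partitions_of n \<Longrightarrow> j \<in> partitions_of n \<Longrightarrow> k \<in> partitions_of n \<Longrightarrow>
      dominated i j \<and> j \<noteq> i \<Longrightarrow> dominated j k \<and> k \<noteq> j \<Longrightarrow> dominated i k \<and> k \<noteq> i"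
  using dominated_trans dominated_antisym by (metis partitions_of_iff)

section \<open>Orthogonality and norms of the dual basis\<close>

lemma eq_plus_imp_diff: "(a::sym) = b + c \<Longrightarrow> a - b = c"
  by simp

lemma qp_diff_Pt:
  assumes "nu \<in> partitions_of n"
  shows "qp nu - cst (bfac nu) * Pt nu \<in> sv.span (Pt ` {j \<in> partitions_of n. dominated nu j \<and> j \<noteq> nu})"
proof -
  have nu: "is_partition nu" "psize nu = n" using assms by (auto simp: partitions_of_iff)
  have "qp nu = (\<Sum>lam\<in>partitions_of n. cst (hl_inner (qp nu) (Qv lam)) * Pt lam)"
    using homog_qp [of nu] nu by (intro Pt_expand) simp
  also have "\<dots> = cst (hl_inner (qp nu) (Qv nu)) * Pt nu +
      (\<Sum>lam\<in>partitions_of n - {nu}. cst (hl_inner (qp nu) (Qv lam)) * Pt lam)"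
    by (rule sum.remove) (use assms in auto)
  finally have "qp nu - cst (hl_inner (qp nu) (Qv nu)) * Pt nu =
      (\<Sum>lam\<in>partitions_of n - {nu}. cst (hl_inner (qp nu) (Qv lam)) * Pt lam)"
    by (rule eq_plus_imp_diff)
  then have "qp nu - cst (bfac nu) * Pt nu =
      (\<Sum>lam\<in>partitions_of n - {nu}. cst (hl_inner (qp nu) (Qv lam)) * Pt lam)"
    unfolding hl_qp_Qv_diag [OF nu(1)] .
  moreover have "\<dots> \<in> sv.span (Pt ` {j \<in> partitions_of n. dominated nu j \<and> j \<noteq> nu})"
  proof (rule sv.span_sum)
    fix lam assume lam: "lam \<in> partitions_of n - {nu}"
    show "cst (hl_inner (qp nu) (Qv lam)) * Pt lam \<in> sv.span (Pt ` {j \<in> partitions_of n. dominated nu j \<and> j \<noteq> nu})"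
    proof (cases "hl_inner (qp nu) (Qv lam) = 0")
      case True
      then show ?thesis by (simp add: sv.span_zero)
    next
      case False
      then have "dominated nu lam" using lam hl_qp_Qv_nonzero [of lam nu] by (simp add: partitions_of_iff)
      then show ?thesis using lam by (intro sv.span_scale sv.span_base) blast
    qed
  qed
  ultimately show ?thesis by simp
qed

lemma Pt_in_span_qp:
  assumes "nu \<in> partitions_of n"
  shows "Pt nu \<in> sv.span (qp ` {j \<in> partitions_of n. dominated nu j})"
proof -
  let ?I = "partitions_of n"
  \<comment> \<open>Division by b_i makes the expansion of q_i unitriangular.\<close>
  let ?x = "\<lambda>i. cst (1 / bfac i) * qp i"
  let ?S = "sv.span (qp ` {j \<in> ?I. dominated nu j})"
  have "Pt nu \<in> sv.span (?x ` {j \<in> ?I. j = nu \<or> dominated nu j \<and> j \<noteq> nu})"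
  proof (rule triangular_inverse)
    show "finite ?I" by simp
    show "dominated i k \<and> k \<noteq> i" if "i \<in> ?I" "j \<in> ?I" "k \<in> ?I"
      "dominated i j \<and> j \<noteq> i" "dominated j k \<and> k \<noteq> j" for i j k
      by (rule dominated_strict [OF that])
    show "?x i - Pt i \<in> sv.span (Pt ` {j \<in> ?I. dominated i j \<and> j \<noteq> i})" if "i \<in> ?I" for i
    proof -
      have "cst (1 / bfac i) * (qp i - cst (bfac i) * Pt i) \<in> sv.span (Pt ` {j \<in> ?I. dominated i j \<and> j \<noteq> i})"
        by (rule sv.span_scale [OF qp_diff_Pt [OF that]])
      moreover have "cst (1 / bfac i) * (cst (bfac i) * Pt i) = Pt i"
        using bfac_nonzero [of i] by (simp add: mult.assoc [symmetric] cst_mult [symmetric])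
      ultimately show ?thesis by (simp only: right_diff_distrib)
    qed
    show "nu \<in> ?I" by (rule assms)
  qed simp
  moreover have "sv.span (?x ` {j \<in> ?I. j = nu \<or> dominated nu j \<and> j \<noteq> nu}) \<subseteq> ?S"
  proof (rule sv.span_minimal [OF _ sv.subspace_span])
    have "?x j \<in> ?S" if "j \<in> ?I" "j = nu \<or> dominated nu j \<and> j \<noteq> nu" for j
      using that by (intro sv.span_scale sv.span_base) auto
    then show "?x ` {j \<in> ?I. j = nu \<or> dominated nu j \<and> j \<noteq> nu} \<subseteq> ?S" by blast
  qed
  ultimately show ?thesis by blast
qed

lemma Pt_in_span_ev:
  assumes "is_partition lam"
  shows "Pt lam \<in> sv.span (ev ` insert lam (cd_above lam))"
proof -
  have "Pt lam - ev lam \<in> sv.span (ev ` insert lam (cd_above lam))"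
    using Pt_diff_ev [OF assms] sv.span_mono [of "ev ` cd_above lam" "ev ` insert lam (cd_above lam)"] by blast
  moreover have "ev lam \<in> sv.span (ev ` insert lam (cd_above lam))" by (intro sv.span_base) blast
  ultimately have "(Pt lam - ev lam) + ev lam \<in> sv.span (ev ` insert lam (cd_above lam))" by (rule sv.span_add)
  then show ?thesis by simp
qed

lemma cd_above_dominated:
  "is_partition lam \<Longrightarrow> ka \<in> insert lam (cd_above lam) \<Longrightarrow> is_partition ka \<and> dominated ka lam"
  using cd_imp_dominated [of lam ka] by (auto simp: cd_above_def)

text \<open>P_lambda is a combination of e_{kappa'} with kappa \<le> lambda, and P_mu of q_nu with
  mu \<le> nu. A nonzero pairing of q_nu with e_{kappa'} requires nu \<le> kappa, hence mu \<le>
  lambda.\<close>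

lemma hl_Pt_Pt_nonzero:
  assumes "is_partition lam" "is_partition mu" "hl_inner (Pt lam) (Pt mu) \<noteq> 0"
  shows "dominated mu lam"
proof (rule ccontr)
  assume nd: "\<not> dominated mu lam"
  have "hl_inner (Pt lam) (Pt mu) = 0"
    using Pt_in_span_ev [OF assms(1)]
  proof (rule hl_span_zero)
    fix x assume "x \<in> ev ` insert lam (cd_above lam)"
    then obtain ka where ka: "x = ev ka" "is_partition ka" "dominated ka lam"
      using cd_above_dominated [OF assms(1)] by blast
    have "Pt mu \<in> sv.span (qp ` {j \<in> partitions_of (psize mu). dominated mu j})"
      using assms(2) by (intro Pt_in_span_qp) (simp add: partitions_of_iff)
    then have "hl_inner (Pt mu) x = 0"
    proof (rule hl_span_zero)
      fix y assume "y \<in> qp ` {j \<in> partitions_of (psize mu). dominated mu j}"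
      then obtain nu where nu: "y = qp nu" "dominated mu nu" by blast
      show "hl_inner y x = 0"
        using hl_qp_ev_nonzero [OF ka(2), of nu] nd nu ka dominated_trans by blast
    qed
    then show "hl_inner x (Pt mu) = 0" by (simp add: hl_sym)
  qed
  then show False using assms(3) by simp
qed

text \<open>By symmetry of the form a nonzero pairing would give dominance in both
  directions.\<close>

lemma hl_Pt_Pt_neq:
  assumes "is_partition lam" "is_partition mu" "lam \<noteq> mu"
  shows "hl_inner (Pt lam) (Pt mu) = 0"
  using hl_Pt_Pt_nonzero [OF assms(1,2)] hl_Pt_Pt_nonzero [OF assms(2,1)] dominated_antisym [OF assms(1,2)]
    assms(3) hl_sym by metis

text \<open>Only the leading term e_{lambda'} of P_lambda can pair with q_lambda, since the others
  belong to partitions strictly below lambda.\<close>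

lemma hl_qp_Pt_diag:
  assumes "is_partition lam"
  shows "hl_inner (qp lam) (Pt lam) = 1"
proof -
  have "hl_inner (Pt lam - ev lam) (qp lam) = 0"
    using Pt_diff_ev [OF assms]
  proof (rule hl_span_zero)
    fix x assume "x \<in> ev ` cd_above lam"
    then obtain ka where ka: "x = ev ka" "ka \<in> cd_above lam" by blast
    then have k: "is_partition ka" "dominated ka lam" "ka \<noteq> lam"
      using cd_above_dominated [OF assms, of ka] by (auto simp: cd_above_def)
    then have "\<not> dominated lam ka" using dominated_antisym [OF assms k(1)] by blast
    then show "hl_inner x (qp lam) = 0"
      using hl_qp_ev_nonzero [OF k(1), of lam] ka(1) hl_sym by metis
  qed
  then have "hl_inner (qp lam) (Pt lam) = hl_inner (qp lam) (ev lam)"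
    unfolding hl_diff_left hl_sym [of "qp lam"] by simp
  then show ?thesis by (simp add: hl_qp_ev_diag [OF assms])
qed

text \<open>q_lambda is b_lambda P_lambda plus terms orthogonal to P_lambda, and its pairing with
  P_lambda is 1.\<close>

lemma hl_Pt_Pt_diag:
  assumes "is_partition lam"
  shows "bfac lam * hl_inner (Pt lam) (Pt lam) = 1"
proof -
  have l: "lam \<in> partitions_of (psize lam)" using assms by (simp add: partitions_of_iff)
  have "hl_inner (qp lam - cst (bfac lam) * Pt lam) (Pt lam) = 0"
    using qp_diff_Pt [OF l]
  proof (rule hl_span_zero)
    fix x assume "x \<in> Pt ` {j \<in> partitions_of (psize lam). dominated lam j \<and> j \<noteq> lam}"
    then obtain j where "x = Pt j" "is_partition j" "j \<noteq> lam" by (auto simp: partitions_of_iff)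
    then show "hl_inner x (Pt lam) = 0" using hl_Pt_Pt_neq [of j lam] assms by simp
  qed
  then show ?thesis using hl_qp_Pt_diag [OF assms] by (simp add: hl_diff_left hl_cst_left)
qed

lemma Qv_eq_Pt:
  assumes "is_partition mu"
  shows "Qv mu = cst (bfac mu) * Pt mu"
proof -
  have "Qv mu - cst (bfac mu) * Pt mu = 0"
  proof (rule Pt_nondegenerate)
    show "in_Lambda (Qv mu - cst (bfac mu) * Pt mu)"
      using homog_diff [OF homog_Qv homog_cst_mult [OF homog_Pt]] assms homog_imp_in_Lambda by blast
    fix lam assume lam: "is_partition lam"
    show "hl_inner (Pt lam) (Qv mu - cst (bfac mu) * Pt mu) = 0"
    proof (cases "lam = mu")
      case True
      then show ?thesis
        using hl_Pt_Qv [OF lam assms] hl_Pt_Pt_diag [OF assms] by (simp add: hl_diff_right hl_cst_right)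
    next
      case False
      then show ?thesis
        using hl_Pt_Qv [OF lam assms] hl_Pt_Pt_neq [OF lam assms] by (simp add: hl_diff_right hl_cst_right)
    qed
  qed
  then show ?thesis by simp
qed

section \<open>Uniqueness of the Hall-Littlewood functions\<close>

text \<open>The algebra homomorphism p_n -> (1 - t^n) p_n relates the two scalar products and maps h_r to q_r;
  hence the monomial functions are dual to the products of the q_r for hl_inner.\<close>

definition psi :: "sym \<Rightarrow> sym" where
  "psi = lext (\<lambda>M. cst (\<Prod>x\<in>#M. 1 - tt ^ x) * pm M)"

lemma lin_psi: "lin psi"
  by (simp add: psi_def lin_lext)

lemma psi_pm: "psi (pm M) = cst (\<Prod>x\<in>#M. 1 - tt ^ x) * pm M"
  by (simp add: psi_def)

lemma psi_mult: "psi (f * g) = psi f * psi g"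
proof -
  have 0: "psi (pm M * pm N) = psi (pm M) * psi (pm N)" for M N
    by (simp only: psi_pm pm_add [symmetric] image_mset_union prod_mset_Un cst_mult) (simp only: pm_add mult_ac)
  have 1: "psi (f * pm N) = psi f * psi (pm N)" for N
    by (induction f rule: sym_induct)
      (simp_all only: lin_add [OF lin_psi] lin_cst [OF lin_psi] 0 distrib_right mult.assoc)
  have 2: "psi (f * (cst a * pm N)) = cst a * psi (f * pm N)" for a N
    by (metis lin_cst [OF lin_psi] mult.left_commute)
  show ?thesis
    by (induction g rule: sym_induct)
      (simp_all only: lin_add [OF lin_psi] lin_cst [OF lin_psi] 1 2 distrib_left mult.left_commute)
qed

lemma lookup_psi: "Poly_Mapping.lookup (psi f) M = (\<Prod>x\<in>#M. 1 - tt ^ x) * Poly_Mapping.lookup f M"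
proof (induction f rule: sym_induct)
  case (mono a N)
  show ?case by (simp add: lin_cst [OF lin_psi] psi_pm lookup_pm)
next
  case (add f g)
  then show ?case by (simp add: lin_add [OF lin_psi] lookup_add distrib_left)
qed

text \<open>The factor that \<open>psi\<close> attaches to p_M cancels the denominator of
  \<open>zt M\<close>. It is zero as soon as M contains 0, hence the hypothesis on g.\<close>

lemma hall_inner_psi:
  assumes "in_Lambda g"
  shows "hall_inner f g = hl_inner f (psi g)"
  unfolding hall_inner_def hl_inner_def
proof (rule sum.cong [OF refl])
  fix M
  show "Poly_Mapping.lookup f M * Poly_Mapping.lookup g M * of_nat (z0 M) =
    Poly_Mapping.lookup f M * Poly_Mapping.lookup (psi g) M * zt M"
  proof (cases "Poly_Mapping.lookup g M = 0")
    case False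
    then have "0 \<notin># M" using assms by (auto simp: in_Lambda_def in_keys_iff)
    then have "zt M \<noteq> 0" by (rule zt_nonzero)
    then have "(\<Prod>x\<in>#M. 1 - tt ^ x) \<noteq> 0" by (auto simp: zt_def)
    then show ?thesis by (simp add: lookup_psi zt_def)
  qed (simp add: lookup_psi)
qed

lemma psi_psexp: "psi (psexp (\<lambda>n. 1) n) = qg n"
proof (induction n rule: less_induct)
  case (less n)
  show ?case
  proof (cases "n = 0")
    case True
    then show ?thesis using psi_pm [of "{#}"] by (simp add: qg_def)
  next
    case False
    have "of_nat n * psi (psexp (\<lambda>n. 1) n) = psi (of_nat n * psexp (\<lambda>n. 1) n)"
      by (simp only: lin_of_nat [OF lin_psi])
    also have "\<dots> = (\<Sum>m=1..n. psi (pw m) * psi (psexp (\<lambda>n. 1) (n - m)))"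
      unfolding psexp_rec lin_sum [OF lin_psi] by (simp only: cst_1 mult_1_left psi_mult)
    also have "\<dots> = (\<Sum>m=1..n. cst (1 - tt ^ m) * pw m * psexp (\<lambda>n. 1 - tt ^ n) (n - m))"
    proof (rule sum.cong [OF refl])
      fix m assume "m \<in> {1..n}"
      then have "psi (psexp (\<lambda>n. 1) (n - m)) = psexp (\<lambda>n. 1 - tt ^ n) (n - m)"
        using less [of "n - m"] by (simp add: qg_def)
      then show "psi (pw m) * psi (psexp (\<lambda>n. 1) (n - m)) = cst (1 - tt ^ m) * pw m * psexp (\<lambda>n. 1 - tt ^ n) (n - m)"
        by (simp add: psi_pm)
    qed
    also have "\<dots> = of_nat n * qg n" unfolding qg_def psexp_rec ..
    finally show ?thesis by (rule of_nat_cancel [OF False])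
  qed
qed

section \<open>The complete functions as coefficients of an exponential\<close>

lemma conj_mset: "conj l j = size (filter_mset (\<lambda>x. j \<le> x) (mset l))"
  by (simp add: conj_def mset_filter [symmetric] del: mset_filter)

lemma partition_mset_inj:
  assumes "is_partition l" "is_partition m" "mset l = mset m"
  shows "l = m"
  by (rule partition_eqI [OF assms(1,2)]) (simp add: conj_mset assms(3))

lemma ex_partition_mset:
  assumes "0 \<notin># M"
  shows "\<exists>l. is_partition l \<and> mset l = M"
proof (rule exI [of _ "rev (sorted_list_of_multiset M)"], intro conjI)
  show "is_partition (rev (sorted_list_of_multiset M))"
    using assms by (simp add: is_partition_def sorted_wrt_rev)
qed simp

lemma lookup_hcomp:
  "Poly_Mapping.lookup (hcomp n) M = (if 0 \<notin># M \<and> sum_mset M = n then 1 / of_nat (z0 M) else 0)"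
proof -
  have L: "Poly_Mapping.lookup (hcomp n) M =
    (\<Sum>rho\<in>partitions_of n. if mset rho = M then 1 / of_nat (z0 M) else 0)"
    unfolding hcomp_def lookup_sum
    by (rule sum.cong [OF refl]) (simp add: lookup_single when_def)
  show ?thesis
  proof (cases "0 \<notin># M \<and> sum_mset M = n")
    case True
    then obtain l where l: "is_partition l" "mset l = M" using ex_partition_mset by blast
    have "sum_mset (mset l) = sum_list l" by (rule sum_mset_sum_list)
    then have ln: "l \<in> partitions_of n" using l True by (simp add: partitions_of_def)
    have "(\<Sum>rho\<in>partitions_of n. if mset rho = M then 1 / of_nat (z0 M) else 0) =
        (\<Sum>rho\<in>partitions_of n. if rho = l then 1 / of_nat (z0 M) else (0::coef))"
    proof (rule sum.cong [OF refl])
      fix rho assume "rho \<in> partitions_of n"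
      then have "mset rho = M \<longleftrightarrow> rho = l"
        using partition_mset_inj [of rho l] l by (auto simp: partitions_of_def)
      then show "(if mset rho = M then 1 / of_nat (z0 M) else 0) = (if rho = l then 1 / of_nat (z0 M) else (0::coef))"
        by (simp only:)
    qed
    then show ?thesis unfolding L using True ln by simp
  next
    case False
    have "mset rho \<noteq> M" if "rho \<in> partitions_of n" for rho
      using that False by (auto simp: partitions_of_def is_partition_def sum_mset_sum_list)
    then have "(\<Sum>rho\<in>partitions_of n. if mset rho = M then 1 / of_nat (z0 M) else 0) = (0::coef)"
      by (intro sum.neutral) simp
    then show ?thesis unfolding L if_not_P [OF False] .
  qed
qed

lemma lookup_pw_mult:
  "Poly_Mapping.lookup (pw k * f) M = (if k \<in># M then Poly_Mapping.lookup f (M - {#k#}) else 0)"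
proof (induction f rule: sym_induct)
  case (mono a N)
  have "pw k * (cst a * pm N) = cst a * pm (add_mset k N)"
    by (subst pm_add_mset) (simp only: mult.left_commute)
  moreover have "add_mset k N = M \<longleftrightarrow> k \<in># M \<and> N = M - {#k#}" by auto
  ultimately show ?case by (simp add: lookup_pm)
next
  case (add f g)
  then show ?case by (simp add: distrib_left lookup_add)
qed

lemma sum_count: "finite A \<Longrightarrow> set_mset M \<subseteq> A \<Longrightarrow> (\<Sum>k\<in>A. k * count M k) = sum_mset M"
proof (induction M)
  case (add x M)
  have "(\<Sum>k\<in>A. k * count (add_mset x M) k) = (\<Sum>k\<in>A. k * count M k + (if k = x then k else 0))"
    by (rule sum.cong) auto
  then show ?case using add by (simp add: sum.distrib)
qed simp

text \<open>Removing a part k from M divides z_M by k m_k(M), so at p_M the right-hand side has the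
  coefficient (sum_k k m_k(M)) / z_M = n / z_M.\<close>

lemma hcomp_rec: "of_nat n * hcomp n = (\<Sum>k=1..n. pw k * hcomp (n - k))"
proof (rule poly_mapping_eqI)
  fix M
  let ?g = "\<lambda>k. if k \<in># M then (if 0 \<notin># M - {#k#} \<and> sum_mset (M - {#k#}) = n - k
     then 1 / of_nat (z0 (M - {#k#})) else 0) else (0::coef)"
  have R: "Poly_Mapping.lookup (\<Sum>k=1..n. pw k * hcomp (n - k)) M = (\<Sum>k=1..n. ?g k)"
    unfolding lookup_sum lookup_pw_mult lookup_hcomp ..
  have L: "Poly_Mapping.lookup (of_nat n * hcomp n) M =
     of_nat n * (if 0 \<notin># M \<and> sum_mset M = n then 1 / of_nat (z0 M) else 0)"
    unfolding cst_of_nat [symmetric] lookup_cst_mult lookup_hcomp ..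
  show "Poly_Mapping.lookup (of_nat n * hcomp n) M = Poly_Mapping.lookup (\<Sum>k=1..n. pw k * hcomp (n - k)) M"
  proof (cases "0 \<notin># M \<and> sum_mset M = n")
    case True
    have "(\<Sum>k=1..n. ?g k) = (\<Sum>k\<in>set_mset M. of_nat (k * count M k) / of_nat (z0 M))"
    proof (rule sum.mono_neutral_cong_right)
      show "set_mset M \<subseteq> {1..n}"
      proof
        fix k assume k: "k \<in># M"
        then have "k \<le> n" using True sum_mset.remove [OF k] by simp
        moreover have "k \<noteq> 0" using True k by metis
        ultimately show "k \<in> {1..n}" by simp
      qed
      show "\<forall>k\<in>{1..n} - set_mset M. ?g k = 0" by simp
      fix k assume k: "k \<in> set_mset M"
      then have M: "M = add_mset k (M - {#k#})" by simp
      have "0 \<notin># M - {#k#}" using True by (meson in_diffD)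
      moreover have "sum_mset (M - {#k#}) = n - k" using True k by (simp add: sum_mset_remove1)
      ultimately have "?g k = 1 / of_nat (z0 (M - {#k#}))" using k by simp
      moreover have "z0 M = z0 (M - {#k#}) * (k * count M k)"
        using z0_add_mset [of k "M - {#k#}"] k by (simp add: insert_DiffM)
      moreover have "z0 M \<noteq> 0" using True z0_nonzero by blast
      ultimately show "?g k = of_nat (k * count M k) / of_nat (z0 M)"
        by (auto simp: field_simps simp del: of_nat_mult simp flip: of_nat_mult)
    qed simp
    also have "\<dots> = of_nat (\<Sum>k\<in>set_mset M. k * count M k) / of_nat (z0 M)"
      by (simp only: of_nat_sum sum_divide_distrib)
    also have "(\<Sum>k\<in>set_mset M. k * count M k) = n" using True by (simp add: sum_count)
    finally show ?thesis unfolding L R using True by simp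
  next
    case False
    have "?g k = 0" if k: "k \<in> {1..n}" for k
    proof (cases "k \<in># M \<and> 0 \<notin># M - {#k#}")
      case True
      then have "count (M - {#k#}) 0 = 0" by (simp only: not_in_iff)
      then have "0 \<notin># M" using k unfolding not_in_iff by simp
      then have "sum_mset M \<noteq> n" using False by simp
      moreover have "sum_mset M = k + sum_mset (M - {#k#})" using True by (simp add: sum_mset.remove)
      ultimately have "sum_mset (M - {#k#}) \<noteq> n - k" using k by auto
      then show ?thesis by simp
    qed auto
    then have "(\<Sum>k=1..n. ?g k) = 0" by (intro sum.neutral) blast
    then show ?thesis unfolding L R if_not_P [OF False] mult_zero_right by (rule sym)
  qed
qed

lemma hcomp_0: "hcomp 0 = 1"
proof (rule poly_mapping_eqI)
  fix M :: "nat multiset"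
  show "Poly_Mapping.lookup (hcomp 0) M = Poly_Mapping.lookup 1 M"
    unfolding lookup_hcomp by (auto simp: lookup_one when_def z0_def)
qed

lemma hcomp_psexp: "hcomp n = psexp (\<lambda>n. 1) n"
proof (induction n rule: less_induct)
  case (less n)
  show ?case
  proof (cases "n = 0")
    case True
    then show ?thesis by (simp add: hcomp_0)
  next
    case False
    have "of_nat n * hcomp n = (\<Sum>k=1..n. cst 1 * pw k * psexp (\<lambda>n. 1) (n - k))"
      unfolding hcomp_rec using less by (intro sum.cong refl) auto
    also have "\<dots> = of_nat n * psexp (\<lambda>n. 1) n"
      by (rule psexp_rec [symmetric])
    finally show ?thesis by (rule of_nat_cancel [OF False])
  qed
qed

lemma in_Lambda_hprod: "in_Lambda (hprod mu)"
proof (induction mu)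
  case Nil
  show ?case using in_Lambda_cst [of 1] by (simp add: hprod_def)
next
  case (Cons a mu)
  then show ?case
    using in_Lambda_mult [OF homog_imp_in_Lambda [OF homog_psexp] Cons]
    by (simp add: hprod_def hcomp_psexp)
qed

lemma psi_hprod: "psi (hprod mu) = qp mu"
proof (induction mu)
  case Nil
  show ?case using psi_pm [of "{#}"] by (simp add: hprod_def)
next
  case (Cons a mu)
  then show ?case by (simp add: hprod_def psi_mult hcomp_psexp psi_psexp)
qed

lemma hall_inner_hprod: "hall_inner f (hprod mu) = hl_inner f (qp mu)"
  unfolding hall_inner_psi [OF in_Lambda_hprod] psi_hprod ..

lemma qp_nondegenerate:
  assumes "homog n f" "\<And>mu. mu \<in> partitions_of n \<Longrightarrow> hl_inner f (qp mu) = 0"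
  shows "f = 0"
proof (rule Pt_nondegenerate [OF homog_imp_in_Lambda [OF assms(1)]])
  fix lam assume lam: "is_partition lam"
  show "hl_inner (Pt lam) f = 0"
  proof (cases "psize lam = n")
    case True
    then have "Pt lam \<in> sv.span (qp ` {j \<in> partitions_of n. dominated lam j})"
      using lam by (intro Pt_in_span_qp) (simp add: partitions_of_iff)
    then show ?thesis
    proof (rule hl_span_zero)
      fix x assume "x \<in> qp ` {j \<in> partitions_of n. dominated lam j}"
      then obtain j where "x = qp j" "j \<in> partitions_of n" by blast
      then show "hl_inner x f = 0" using assms(2) hl_sym by metis
    qed
  next
    case False
    then show ?thesis using hl_homog_neq [OF homog_Pt [OF lam] assms(1)] by simp
  qed
qed

lemma hl_Pt_qp_nonzero:
  assumes "is_partition lam" "hl_inner (Pt lam) (qp nu) \<noteq> 0"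
  shows "dominated nu lam"
proof (rule ccontr)
  assume nd: "\<not> dominated nu lam"
  have "hl_inner (Pt lam) (qp nu) = 0"
    using Pt_in_span_ev [OF assms(1)]
  proof (rule hl_span_zero)
    fix x assume "x \<in> ev ` insert lam (cd_above lam)"
    then obtain ka where ka: "x = ev ka" "is_partition ka" "dominated ka lam"
      using cd_above_dominated [OF assms(1)] by blast
    have "hl_inner (qp nu) (ev ka) = 0"
      using hl_qp_ev_nonzero [OF ka(2), of nu] nd dominated_trans [OF _ ka(3), of nu] by blast
    then show "hl_inner x (qp nu) = 0" by (simp add: ka(1) hl_sym)
  qed
  then show False using assms(2) by simp
qed

section \<open>Monomial functions and the characterisation of P_lambda\<close>

definition dom_below :: "nat list \<Rightarrow> nat list set" where
  "dom_below lam = {mu \<in> partitions_of (psize lam). dominated mu lam \<and> mu \<noteq> lam}"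

lemma dom_below_subset:
  assumes "is_partition lam" "mu \<in> dom_below lam"
  shows "dom_below mu \<subseteq> dom_below lam" "card (dom_below mu) < card (dom_below lam)"
proof -
  have m: "is_partition mu" "psize mu = psize lam" "dominated mu lam" "mu \<noteq> lam"
    using assms(2) by (auto simp: dom_below_def partitions_of_iff)
  have "ka \<in> dom_below lam" if "ka \<in> dom_below mu" for ka
  proof -
    have k: "is_partition ka" "psize ka = psize mu" "dominated ka mu"
      using that by (auto simp: dom_below_def partitions_of_iff)
    have "ka \<noteq> lam" using k(3) m dominated_antisym [OF m(1) assms(1)] by blast
    then show ?thesis using k m dominated_trans [OF k(3) m(3)] by (simp add: dom_below_def partitions_of_iff)
  qed
  then show sub: "dom_below mu \<subseteq> dom_below lam" by blast
  have "mu \<notin> dom_below mu" by (simp add: dom_below_def)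
  then have "dom_below mu \<subset> dom_below lam" using sub assms(2) by blast
  then show "card (dom_below mu) < card (dom_below lam)"
    by (intro psubset_card_mono) (simp add: dom_below_def)
qed

text \<open>The pairing of P_lambda with q_mu is unitriangular in dominance, so lower terms can be
  added to the P_lambda to make them dual to the q_mu.\<close>

lemma ex_monomial:
  assumes "is_partition lam"
  shows "\<exists>f. f - Pt lam \<in> sv.span (Pt ` dom_below lam) \<and>
    (\<forall>mu\<in>partitions_of (psize lam). hl_inner f (qp mu) = (if lam = mu then 1 else 0))"
proof -
  let ?I = "partitions_of (psize lam)"
  have "\<exists>x. \<forall>i\<in>?I. (\<forall>j\<in>?I. hl_inner (x i) (qp j) = (if i = j then 1 else 0)) \<and>
    x i - Pt i \<in> sv.span (Pt ` {j \<in> ?I. dominated j i \<and> j \<noteq> i})"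
  proof (rule dual_family_exists)
    show "finite ?I" by simp
    show "dominated k i \<and> k \<noteq> i" if "i \<in> ?I" "j \<in> ?I" "k \<in> ?I"
      "dominated j i \<and> j \<noteq> i" "dominated k j \<and> k \<noteq> j" for i j k
    proof -
      have p: "is_partition i" "is_partition j" using that by (simp_all add: partitions_of_iff)
      have "k \<noteq> i" using that(4,5) dominated_antisym [OF p(2,1)] by blast
      then show ?thesis using that(4,5) dominated_trans [of k j i] by blast
    qed
    show "hl_inner (Pt i) (qp i) = 1" if "i \<in> ?I" for i
      using that hl_qp_Pt_diag [of i] hl_sym [of "Pt i"] by (simp add: partitions_of_iff)
    show "i = j \<or> dominated j i \<and> j \<noteq> i" if "i \<in> ?I" "j \<in> ?I" "hl_inner (Pt i) (qp j) \<noteq> 0" for i j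
      using that hl_Pt_qp_nonzero [of i j] by (auto simp: partitions_of_iff)
  qed simp
  then obtain x where "\<forall>i\<in>?I. (\<forall>j\<in>?I. hl_inner (x i) (qp j) = (if i = j then 1 else 0)) \<and>
    x i - Pt i \<in> sv.span (Pt ` {j \<in> ?I. dominated j i \<and> j \<noteq> i})" by (elim exE)
  moreover have "lam \<in> ?I" using assms by (simp add: partitions_of_iff)
  ultimately show ?thesis unfolding dom_below_def by blast
qed

lemma homog_span_Pt_dom_below:
  assumes "is_partition lam" "f \<in> sv.span (Pt ` dom_below lam)"
  shows "homog (psize lam) f"
  using assms(2)
proof (rule homog_span)
  fix x assume "x \<in> Pt ` dom_below lam"
  then obtain mu where "x = Pt mu" "is_partition mu" "psize mu = psize lam"
    by (auto simp: dom_below_def partitions_of_iff)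
  then show "homog (psize lam) x" using homog_Pt [of mu] by simp
qed

text \<open>\<open>THE\<close> is resolved by the family of \<open>ex_monomial\<close> together with
  \<open>qp_nondegenerate\<close>. The third property, m_lambda being P_lambda plus lower terms,
  serves the uniqueness of the P_lambda.\<close>

lemma mono_properties:
  assumes "is_partition lam"
  shows "homog (psize lam) (mono lam)"
    and "mu \<in> partitions_of (psize lam) \<Longrightarrow> hl_inner (mono lam) (qp mu) = (if lam = mu then 1 else 0)"
    and "mono lam - Pt lam \<in> sv.span (Pt ` dom_below lam)"
proof -
  obtain f where f: "f - Pt lam \<in> sv.span (Pt ` dom_below lam)"
    "\<forall>mu\<in>partitions_of (psize lam). hl_inner f (qp mu) = (if lam = mu then 1 else 0)"
    using ex_monomial [OF assms] by blast
  have hf: "homog (psize lam) f"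
    using homog_add [OF homog_span_Pt_dom_below [OF assms f(1)] homog_Pt [OF assms]] by simp
  have "mono lam = f"
    unfolding mono_def hall_inner_hprod
  proof (rule the_equality)
    show "homog (psize lam) f \<and> (\<forall>mu\<in>partitions_of (psize lam). hl_inner f (qp mu) = (if mu = lam then 1 else 0))"
      using hf f(2) by auto
    fix g assume g: "homog (psize lam) g \<and>
      (\<forall>mu\<in>partitions_of (psize lam). hl_inner g (qp mu) = (if mu = lam then 1 else 0))"
    have "g - f = 0"
    proof (rule qp_nondegenerate)
      show "homog (psize lam) (g - f)" using g hf by (intro homog_diff) auto
      fix mu assume "mu \<in> partitions_of (psize lam)"
      then show "hl_inner (g - f) (qp mu) = 0" using g f(2) by (auto simp: hl_diff_left)
    qed
    then show "g = f" by simp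
  qed
  then show "homog (psize lam) (mono lam)" "mono lam - Pt lam \<in> sv.span (Pt ` dom_below lam)"
    "mu \<in> partitions_of (psize lam) \<Longrightarrow> hl_inner (mono lam) (qp mu) = (if lam = mu then 1 else 0)"
    using hf f by auto
qed

text \<open>As m and q are dual, the coefficient of m_mu is the pairing with q_mu, which vanishes
  unless mu \<le> lambda.\<close>

lemma Pt_mono_expansion:
  assumes "is_partition lam"
  shows "Pt lam = mono lam + (\<Sum>mu\<in>dom_below lam. cst (hl_inner (Pt lam) (qp mu)) * mono mu)"
proof -
  let ?X = "mono lam + (\<Sum>mu\<in>dom_below lam. cst (hl_inner (Pt lam) (qp mu)) * mono mu)"
  have mm: "is_partition mu \<and> psize mu = psize lam" if "mu \<in> dom_below lam" for mu
    using that by (simp add: dom_below_def partitions_of_iff)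
  have "Pt lam - ?X = 0"
  proof (rule qp_nondegenerate)
    have "homog (psize lam) (mono mu)" if "mu \<in> dom_below lam" for mu
      using mono_properties(1) [of mu] mm [OF that] by simp
    then show "homog (psize lam) (Pt lam - ?X)"
      by (intro homog_diff homog_add homog_sum homog_cst_mult homog_Pt mono_properties assms) auto
    fix nu assume nu: "nu \<in> partitions_of (psize lam)"
    have "hl_inner ?X (qp nu) = (if lam = nu then 1 else 0) +
      (\<Sum>mu\<in>dom_below lam. hl_inner (Pt lam) (qp mu) * hl_inner (mono mu) (qp nu))"
      by (simp only: hl_add_left hl_sum_left hl_cst_left mono_properties(2) [OF assms nu])
    also have "(\<Sum>mu\<in>dom_below lam. hl_inner (Pt lam) (qp mu) * hl_inner (mono mu) (qp nu)) =
      (\<Sum>mu\<in>dom_below lam. if mu = nu then hl_inner (Pt lam) (qp nu) else 0)"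
    proof (rule sum.cong [OF refl])
      fix mu assume "mu \<in> dom_below lam"
      then have "hl_inner (mono mu) (qp nu) = (if mu = nu then 1 else 0)"
        using mm nu by (intro mono_properties(2)) auto
      then show "hl_inner (Pt lam) (qp mu) * hl_inner (mono mu) (qp nu) = (if mu = nu then hl_inner (Pt lam) (qp nu) else 0)"
        by simp
    qed
    also have "\<dots> = (if nu \<in> dom_below lam then hl_inner (Pt lam) (qp nu) else 0)"
      by (simp add: dom_below_def)
    finally have X: "hl_inner ?X (qp nu) = (if lam = nu then 1 else 0) +
      (if nu \<in> dom_below lam then hl_inner (Pt lam) (qp nu) else 0)" .
    have "hl_inner (Pt lam) (qp nu) = hl_inner ?X (qp nu)"
    proof (cases "lam = nu")
      case True
      then have "nu \<notin> dom_below lam" by (simp add: dom_below_def)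
      then show ?thesis unfolding X using True hl_qp_Pt_diag [OF assms] hl_sym [of "Pt lam"] by simp
    next
      case False
      then have "hl_inner (Pt lam) (qp nu) = 0" if "nu \<notin> dom_below lam"
        using that nu hl_Pt_qp_nonzero [OF assms, of nu] by (auto simp: dom_below_def)
      then show ?thesis unfolding X using False by simp
    qed
    then show "hl_inner (Pt lam - ?X) (qp nu) = 0" by (simp only: hl_diff_left diff_self)
  qed
  then show ?thesis by simp
qed

lemma dom_below_alt: "{mu \<in> partitions_of (psize lam). dominated mu lam \<and> mu \<noteq> lam} = dom_below lam"
  by (simp add: dom_below_def)

text \<open>Uniqueness by induction along dominance: for a second solution P, the difference of P
  lam and \<open>Pt lam\<close> is a combination of lower \<open>Pt mu\<close>. It is orthogonal to
  these because P mu = \<open>Pt mu\<close> by induction, and to all other \<open>Pt ka\<close>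
  because the basis is orthogonal.\<close>

lemma HLP_family_eq: "HLP_family = (\<lambda>l. if is_partition l then Pt l else 0)" (is "_ = ?P0")
  unfolding HLP_family_def dom_below_alt
proof (rule the_equality)
  show "(\<forall>lam. is_partition lam \<longrightarrow> (\<exists>c. ?P0 lam = mono lam + (\<Sum>mu\<in>dom_below lam. cst (c mu) * mono mu))) \<and>
    (\<forall>lam mu. is_partition lam \<and> is_partition mu \<and> lam \<noteq> mu \<longrightarrow> hl_inner (?P0 lam) (?P0 mu) = 0) \<and>
    (\<forall>lam. \<not> is_partition lam \<longrightarrow> ?P0 lam = 0)"
  proof (intro conjI allI impI)
    fix lam assume lam: "is_partition lam"
    then have "?P0 lam = mono lam + (\<Sum>mu\<in>dom_below lam. cst (hl_inner (Pt lam) (qp mu)) * mono mu)"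
      using Pt_mono_expansion [OF lam] by simp
    then show "\<exists>c. ?P0 lam = mono lam + (\<Sum>mu\<in>dom_below lam. cst (c mu) * mono mu)"
      by (rule exI [where x = "\<lambda>mu. hl_inner (Pt lam) (qp mu)"])
  next
    fix lam mu assume "is_partition lam \<and> is_partition mu \<and> lam \<noteq> mu"
    then show "hl_inner (?P0 lam) (?P0 mu) = 0" using hl_Pt_Pt_neq [of lam mu] by simp
  next
    fix lam assume "\<not> is_partition lam"
    then show "?P0 lam = 0" by simp
  qed
next
  fix P
  assume P: "(\<forall>lam. is_partition lam \<longrightarrow> (\<exists>c. P lam = mono lam + (\<Sum>mu\<in>dom_below lam. cst (c mu) * mono mu))) \<and>
    (\<forall>lam mu. is_partition lam \<and> is_partition mu \<and> lam \<noteq> mu \<longrightarrow> hl_inner (P lam) (P mu) = 0) \<and>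
    (\<forall>lam. \<not> is_partition lam \<longrightarrow> P lam = 0)"
  have "P lam = Pt lam" if "is_partition lam" for lam
    using that
  proof (induction "card (dom_below lam)" arbitrary: lam rule: less_induct)
    case (less lam)
    note lam = less.prems
    let ?S = "sv.span (Pt ` dom_below lam)"
    have mm: "is_partition mu" "psize mu = psize lam" if "mu \<in> dom_below lam" for mu
      using that by (simp_all add: dom_below_def partitions_of_iff)
    have IH: "P mu = Pt mu" if "mu \<in> dom_below lam" for mu
      by (rule less.hyps [OF dom_below_subset(2) [OF lam that] mm(1) [OF that]])
    have mS: "mono mu \<in> ?S" if mu: "mu \<in> dom_below lam" for mu
    proof -
      have "mono mu - Pt mu \<in> sv.span (Pt ` dom_below mu)"
        by (rule mono_properties(3) [OF mm(1) [OF mu]])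
      moreover have "sv.span (Pt ` dom_below mu) \<subseteq> ?S"
        by (intro sv.span_mono image_mono dom_below_subset(1) [OF lam mu])
      ultimately have "mono mu - Pt mu \<in> ?S" by blast
      moreover have "Pt mu \<in> ?S" using mu by (intro sv.span_base) blast
      ultimately have "(mono mu - Pt mu) + Pt mu \<in> ?S" by (rule sv.span_add)
      then show ?thesis by simp
    qed
    obtain c where c: "P lam = mono lam + (\<Sum>mu\<in>dom_below lam. cst (c mu) * mono mu)"
      using P lam by blast
    have "(\<Sum>mu\<in>dom_below lam. cst (c mu) * mono mu) \<in> ?S"
      by (intro sv.span_sum sv.span_scale mS)
    from sv.span_add [OF mono_properties(3) [OF lam] this]
    have D: "P lam - Pt lam \<in> ?S" unfolding c by (simp add: algebra_simps)
    have "P lam - Pt lam = 0"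
    proof (rule Pt_nondegenerate)
      show "in_Lambda (P lam - Pt lam)"
        by (rule homog_imp_in_Lambda [OF homog_span_Pt_dom_below [OF lam D]])
      fix ka assume ka: "is_partition ka"
      show "hl_inner (Pt ka) (P lam - Pt lam) = 0"
      proof (cases "ka \<in> dom_below lam")
        case True
        then have ne: "lam \<noteq> ka" by (auto simp: dom_below_def)
        have "hl_inner (P lam) (P ka) = 0" using P lam ka ne by blast
        then have "hl_inner (Pt ka) (P lam) = 0" by (simp add: IH [OF True] hl_sym)
        moreover have "hl_inner (Pt ka) (Pt lam) = 0"
          using hl_Pt_Pt_neq [OF ka lam] ne by blast
        ultimately show ?thesis by (simp add: hl_diff_right)
      next
        case False
        have "hl_inner (P lam - Pt lam) (Pt ka) = 0"
          using D
        proof (rule hl_span_zero)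
          fix x assume "x \<in> Pt ` dom_below lam"
          then obtain mu where mu: "x = Pt mu" "mu \<in> dom_below lam" by blast
          then have "mu \<noteq> ka" using False by blast
          then show "hl_inner x (Pt ka) = 0"
            unfolding mu(1) by (rule hl_Pt_Pt_neq [OF mm(1) [OF mu(2)] ka])
        qed
        then show ?thesis by (simp add: hl_sym)
      qed
    qed
    then show ?case by simp
  qed
  then show "P = ?P0" using P by (intro ext) auto
qed

lemma HLP_eq_Pt: "is_partition lam \<Longrightarrow> HLP lam = Pt lam"
  by (simp add: HLP_def HLP_family_eq)

lemma HLQ_eq_Qv: "is_partition lam \<Longrightarrow> HLQ lam = Qv lam"
  by (simp add: HLQ_def HLP_eq_Pt Qv_eq_Pt)

text \<open>Among the partitions of r, [r] is the largest in dominance, so the triangular expansion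
  of q_r consists of the term for [r].\<close>

lemma qr_eq_qg: "qr r = qg r"
proof (cases "r = 0")
  case True
  then show ?thesis by (simp add: qr_def qg_def)
next
  case False
  then have pr: "is_partition [r]" by (simp add: is_partition_Cons)
  have pz: "psize [r] = r" by (simp add: psize_def)
  have "qg r = (\<Sum>lam\<in>partitions_of r. cst (hl_inner (qp [r]) (Qv lam)) * Pt lam)"
    using Pt_expand [OF homog_qg [of r]] by simp
  also have "\<dots> = (\<Sum>lam\<in>partitions_of r. if lam = [r] then cst (bfac [r]) * Pt [r] else 0)"
  proof (rule sum.cong [OF refl])
    fix lam assume "lam \<in> partitions_of r"
    then have lam: "is_partition lam" "psize lam = r" by (auto simp: partitions_of_iff)
    show "cst (hl_inner (qp [r]) (Qv lam)) * Pt lam = (if lam = [r] then cst (bfac [r]) * Pt [r] else 0)"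
    proof (cases "lam = [r]")
      case True
      then show ?thesis using hl_qp_Qv_diag [OF pr] by simp
    next
      case False
      have le: "sum_list (take k lam) \<le> r" for k
        using lam(2) sum_list_append [of "take k lam" "drop k lam"] by (simp add: psize_def)
      have "dominated lam [r]"
        unfolding dominated_def
      proof
        fix k show "sum_list (take k lam) \<le> sum_list (take k [r])"
          using le [of k] by (cases k) simp_all
      qed
      then have "\<not> dominated [r] lam" using dominated_antisym [OF pr lam(1)] False by blast
      then have "hl_inner (qp [r]) (Qv lam) = 0" using hl_qp_Qv_nonzero [OF lam(1)] by blast
      then show ?thesis using False by simp
    qed
  qed
  also have "\<dots> = cst (bfac [r]) * Pt [r]"
    using pr pz by (simp add: partitions_of_iff)
  also have "bfac [r] = 1 - tt" by (simp add: bfac_Cons mult_def bfac_def [of "[]"])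
  finally show ?thesis using False by (simp add: qr_def HLP_eq_Pt [OF pr])
qed

section \<open>The skew Pieri rule\<close>

text \<open>The dual bases resolve \<open>THE\<close>: expansion in the P_nu gives existence, and an
  element of Lambda is determined by its pairings with the Q_nu.\<close>

lemma skewP_properties:
  assumes "is_partition lam" "is_partition mu"
  shows "in_Lambda (skewP lam mu)"
    and "is_partition nu \<Longrightarrow> hl_inner (skewP lam mu) (Qv nu) = hl_inner (Pt lam) (Qv nu * Qv mu)"
proof -
  \<comment> \<open>The required pairing vanishes by degree when nu is larger than lam in size, so
    this finite set carries the whole expansion.\<close>
  let ?A = "{nu. is_partition nu \<and> psize nu \<le> psize lam}"
  define f where "f = (\<Sum>nu\<in>?A. cst (hl_inner (Pt lam) (Qv nu * Qv mu)) * Pt nu)"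
  have f1: "in_Lambda f"
    unfolding f_def
    by (intro in_Lambda_sum in_Lambda_mult in_Lambda_cst homog_imp_in_Lambda [OF homog_Pt]) simp
  have f2: "hl_inner f (Qv ka) = hl_inner (Pt lam) (Qv ka * Qv mu)" if ka: "is_partition ka" for ka
  proof -
    have "hl_inner f (Qv ka) = (\<Sum>nu\<in>?A. hl_inner (Pt lam) (Qv nu * Qv mu) * hl_inner (Pt nu) (Qv ka))"
      unfolding f_def by (simp only: hl_sum_left hl_cst_left)
    also have "\<dots> = (\<Sum>nu\<in>?A. if nu = ka then hl_inner (Pt lam) (Qv ka * Qv mu) else 0)"
      using ka by (intro sum.cong refl) (simp add: hl_Pt_Qv)
    also have "\<dots> = (if psize ka \<le> psize lam then hl_inner (Pt lam) (Qv ka * Qv mu) else 0)"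
      using ka finite_partitions_le [of "psize lam"] by simp
    also have "\<dots> = hl_inner (Pt lam) (Qv ka * Qv mu)"
    proof (cases "psize ka \<le> psize lam")
      case False
      then show ?thesis
        using hl_homog_neq [OF homog_Pt [OF assms(1)] homog_mult [OF homog_Qv [OF ka] homog_Qv [OF assms(2)]]] by simp
    qed simp
    finally show ?thesis .
  qed
  have "skewP lam mu = f"
    unfolding skewP_def
  proof (rule the_equality)
    show "in_Lambda f \<and> (\<forall>nu. is_partition nu \<longrightarrow>
      hl_inner f (HLQ nu) = hl_inner (HLP lam) (HLQ nu * HLQ mu))"
      using f1 f2 assms by (simp add: HLQ_eq_Qv HLP_eq_Pt)
    fix g assume g: "in_Lambda g \<and> (\<forall>nu. is_partition nu \<longrightarrow>
      hl_inner g (HLQ nu) = hl_inner (HLP lam) (HLQ nu * HLQ mu))"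
    have "g - f = 0"
    proof (rule Qv_nondegenerate)
      show "in_Lambda (g - f)" using g f1 in_Lambda_diff by blast
      fix ka assume ka: "is_partition ka"
      then have "hl_inner g (Qv ka) = hl_inner (Pt lam) (Qv ka * Qv mu)"
        using g assms by (simp add: HLQ_eq_Qv HLP_eq_Pt)
      then show "hl_inner (g - f) (Qv ka) = 0" using f2 [OF ka] by (simp add: hl_diff_left)
    qed
    then show "g = f" by simp
  qed
  then show "in_Lambda (skewP lam mu)"
    "is_partition nu \<Longrightarrow> hl_inner (skewP lam mu) (Qv nu) = hl_inner (Pt lam) (Qv nu * Qv mu)"
    using f1 f2 by simp_all
qed

lemma hl_skewP_sum:
  assumes "is_partition lam" "is_partition mu" "\<And>nu. nu \<in> A \<Longrightarrow> is_partition nu"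
  shows "hl_inner (skewP lam mu) (\<Sum>nu\<in>A. if P nu then cst (c nu) * Qv nu else 0) =
    hl_inner (Pt lam) ((\<Sum>nu\<in>A. if P nu then cst (c nu) * Qv nu else 0) * Qv mu)"
  unfolding if_cst_mult sum_distrib_right mult.assoc hl_sum_right hl_cst_right
  by (rule sum.cong [OF refl]) (simp only: skewP_properties(2) [OF assms(1,2) assms(3)])

text \<open>Multiplicativity spreads \<open>qperp\<close> over the product; on f it then meets the
  inverse series \<open>Rop\<close>, and everything cancels except in degree 0.\<close>

lemma sum_qperp_Rop_mult: "(\<Sum>i\<le>r. qperp i (Rop (r - i) f * g)) = f * qperp r g"
proof -
  have "(\<Sum>i\<le>r. qperp i (Rop (r - i) f * g)) =
     (\<Sum>i\<le>r. \<Sum>j\<le>i. qperp j (Rop (r - i) f) * qperp (i - j) g)"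
    by (simp add: qperp_def pshift_mult)
  also have "\<dots> = (\<Sum>(i, j)\<in>Sigma {..r} (\<lambda>i. {..i}). qperp j (Rop (r - i) f) * qperp (i - j) g)"
    by (rule sum.Sigma) auto
  also have "\<dots> = (\<Sum>(k, j)\<in>Sigma {..r} (\<lambda>k. {..r - k}). qperp j (Rop (r - k - j) f) * qperp k g)"
    by (rule sum.reindex_bij_witness [where i = "\<lambda>(k, j). (k + j, j)" and j = "\<lambda>(i, j). (i - j, j)"])
      (auto simp: add.commute)
  also have "\<dots> = (\<Sum>k\<le>r. \<Sum>j\<le>r-k. qperp j (Rop (r - k - j) f) * qperp k g)"
    by (rule sum.Sigma [symmetric]) auto
  also have "\<dots> = (\<Sum>k\<le>r. if k = r then f * qperp r g else 0)"
    unfolding sum_distrib_right [symmetric] sum_qperp_Rop by (rule sum.cong) auto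
  also have "\<dots> = f * qperp r g" by simp
  finally show ?thesis .
qed

text \<open>The dual form of \<open>qperp_Qv\<close>: the coefficient of P_lp is the pairing with
  Q_lp.\<close>

lemma qg_mult_Pt:
  assumes "is_partition lam"
  shows "qg r * Pt lam = (\<Sum>lp\<in>{lp. is_partition lp \<and> psize lp = psize lam + r \<and> contained lam lp}.
    cst (hs lp lam) * Pt lp)"
proof -
  let ?I = "partitions_of (r + psize lam)"
  have "qg r * Pt lam = (\<Sum>lp\<in>?I. cst (hl_inner (qg r * Pt lam) (Qv lp)) * Pt lp)"
    by (rule Pt_expand [OF homog_mult [OF homog_qg homog_Pt [OF assms]]])
  also have "\<dots> = (\<Sum>lp\<in>?I. if contained lam lp then cst (hs lp lam) * Pt lp else 0)"
  proof (rule sum.cong [OF refl])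
    fix lp assume "lp \<in> ?I"
    then have lp: "is_partition lp" "psize lp = r + psize lam" by (auto simp: partitions_of_iff)
    have "hl_inner (qg r * Pt lam) (Qv lp) = (\<Sum>nu\<in>below lp. if nu = lam then hs lp lam else 0)"
      unfolding hl_qg_Qv [OF lp(1)]
    proof (rule sum.cong [OF refl])
      fix nu assume "nu \<in> below lp"
      then have "hl_inner (Pt lam) (Qv nu) = (if lam = nu then 1 else 0)"
        by (intro hl_Pt_Qv assms) simp
      then show "(if psize lp - psize nu = r then hs lp nu * hl_inner (Pt lam) (Qv nu) else 0) =
        (if nu = lam then hs lp lam else 0)"
        using lp(2) by auto
    qed
    also have "\<dots> = (if contained lam lp then hs lp lam else 0)" using lp(1) assms by simp
    finally show "cst (hl_inner (qg r * Pt lam) (Qv lp)) * Pt lp = (if contained lam lp then cst (hs lp lam) * Pt lp else 0)"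
      by simp
  qed
  also have "\<dots> = (\<Sum>lp\<in>{lp \<in> ?I. contained lam lp}. cst (hs lp lam) * Pt lp)"
    by (rule sum.inter_filter [symmetric]) simp
  also have "{lp \<in> ?I. contained lam lp} = {lp. is_partition lp \<and> psize lp = psize lam + r \<and> contained lam lp}"
    by (auto simp: partitions_of_iff)
  finally show ?thesis .
qed

theorem theorem4:
  fixes lam mu :: "nat list" and r :: nat
  assumes "is_partition lam" and "is_partition mu" and "contained mu lam"
  shows "skewP lam mu * qr r =
    (\<Sum>(lp, mm, nu)\<in>{(lp, mm, nu). is_partition lp \<and> is_partition mm \<and> is_partition nu \<and>
         contained lam lp \<and> contained mm nu \<and> contained nu mu \<and>
         (psize lp - psize lam) + (psize mu - psize mm) = r}.
       cst ((-1) ^ (psize mu - psize mm) * (- tt) ^ (psize nu - psize mm) *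
            hs lp lam * vs mu nu * sk nu mm) * skewP lp mm)"
proof -
  let ?T = "{(lp, mm, nu). is_partition lp \<and> is_partition mm \<and> is_partition nu \<and>
         contained lam lp \<and> contained mm nu \<and> contained nu mu \<and>
         (psize lp - psize lam) + (psize mu - psize mm) = r}"
  define C where "C lp mm nu = (-1) ^ (psize mu - psize mm) * (- tt) ^ (psize nu - psize mm) *
            hs lp lam * vs mu nu * sk nu mm" for lp mm nu
  let ?R = "\<Sum>(lp, mm, nu)\<in>?T. cst (C lp mm nu) * skewP lp mm"
  let ?A = "\<lambda>i. {lp. is_partition lp \<and> psize lp = psize lam + i \<and> contained lam lp}"
  let ?B = "\<lambda>i. {mm \<in> below mu. psize mu - psize mm = r - i}"
  have finA: "finite (?A i)" for i
    by (rule finite_subset [OF _ finite_partitions_le [of "psize lam + i"]]) auto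
  have finB: "finite (?B i)" for i using assms(2) by simp
  have finC: "finite (between mu mm)" for mm using assms(2) by simp
  \<comment> \<open>With a and b the sizes of mu/nu and nu/mm, (-1)^(a+b) (-t)^b = (-1)^a t^b: the
    signs of the statement are those in the expansion of (q(u)^perp)^(-1) Q_mu.\<close>
  have sign: "C lp mm nu = hs lp lam * ((-1) ^ (psize mu - psize nu) * tt ^ (psize nu - psize mm) * vs mu nu * sk nu mm)"
    if mm: "is_partition mm" and nu: "nu \<in> between mu mm" for lp mm nu
  proof -
    have "psize nu \<le> psize mu" "psize mm \<le> psize nu"
      using nu mm assms(2) contained_psize [of nu mu] contained_psize [of mm nu] by auto
    then have "psize mu - psize mm = (psize mu - psize nu) + (psize nu - psize mm)" by simp
    moreover have "(- tt) ^ b = (-1) ^ b * tt ^ b" for b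
      using power_mult_distrib [of "-1" tt b] by simp
    moreover have "(-1 :: coef) ^ b * ((-1) ^ b * x) = x" for b x
      by (simp add: mult.assoc [symmetric] power_mult_distrib [symmetric])
    ultimately show ?thesis unfolding C_def by (simp only: power_add mult.assoc) (simp only: mult.left_commute)
  qed
  have "skewP lam mu * qr r - ?R = 0"
  proof (rule Qv_nondegenerate)
    have "in_Lambda (skewP lam mu * qr r)"
      unfolding qr_eq_qg
      by (intro in_Lambda_mult skewP_properties(1) assms homog_imp_in_Lambda [OF homog_qg])
    moreover have "in_Lambda ?R"
      by (intro in_Lambda_sum) (auto intro!: in_Lambda_mult skewP_properties(1))
    ultimately show "in_Lambda (skewP lam mu * qr r - ?R)" by (rule in_Lambda_diff)
    fix ka assume ka: "is_partition ka"
    let ?H = "\<lambda>lp mm. hl_inner (skewP lp mm) (Qv ka)"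
    have "hl_inner (skewP lam mu * qr r) (Qv ka) = hl_inner (skewP lam mu) (qperp r (Qv ka))"
      unfolding qr_eq_qg mult.commute [of "skewP lam mu"] by (rule hl_qg_mult)
    also have "\<dots> = hl_inner (Pt lam) (qperp r (Qv ka) * Qv mu)"
      unfolding qperp_Qv [OF ka] by (rule hl_skewP_sum [OF assms(1,2)]) simp
    \<comment> \<open>All \<open>qperp\<close> are brought to the outside, so that they can be moved
      to P_lambda as multiplications by q_i, where the Pieri rule applies.\<close>
    also have "qperp r (Qv ka) * Qv mu = (\<Sum>i\<le>r. qperp i (Rop (r - i) (Qv mu) * Qv ka))"
      unfolding sum_qperp_Rop_mult by (rule mult.commute)
    also have "hl_inner (Pt lam) \<dots> = (\<Sum>i\<le>r. hl_inner (qg i * Pt lam) (Rop (r - i) (Qv mu) * Qv ka))"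
      unfolding hl_sum_right hl_qg_mult ..
    also have "\<dots> = (\<Sum>i\<le>r. \<Sum>lp\<in>?A i. \<Sum>mm\<in>?B i. \<Sum>nu\<in>between mu mm. C lp mm nu * ?H lp mm)"
    proof (rule sum.cong [OF refl])
      fix i
      let ?K = "\<lambda>mm. \<Sum>nu\<in>between mu mm. (-1) ^ (psize mu - psize nu) * tt ^ (psize nu - psize mm) * vs mu nu * sk nu mm"
      have R: "Rop (r - i) (Qv mu) = (\<Sum>mm\<in>?B i. cst (?K mm) * Qv mm)"
        unfolding Rop_Qv [OF assms(2)] by (rule sum.inter_filter [symmetric]) (use assms(2) in simp)
      have "hl_inner (qg i * Pt lam) (Rop (r - i) (Qv mu) * Qv ka) =
        (\<Sum>lp\<in>?A i. hs lp lam * (\<Sum>mm\<in>?B i. ?K mm * hl_inner (Pt lp) (Qv mm * Qv ka)))"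
      proof -
        have "Rop (r - i) (Qv mu) * Qv ka = (\<Sum>mm\<in>?B i. cst (?K mm) * (Qv mm * Qv ka))"
          unfolding R by (simp only: sum_distrib_right [where r = "Qv ka"] mult.assoc [of "cst _"])
        then have "hl_inner (Pt lp) (Rop (r - i) (Qv mu) * Qv ka) =
            (\<Sum>mm\<in>?B i. ?K mm * hl_inner (Pt lp) (Qv mm * Qv ka))" for lp
          by (simp only: hl_sum_right hl_cst_right)
        then show ?thesis
          unfolding qg_mult_Pt [OF assms(1)] by (simp only: hl_sum_left hl_cst_left)
      qed
      also have "\<dots> = (\<Sum>lp\<in>?A i. \<Sum>mm\<in>?B i. \<Sum>nu\<in>between mu mm. C lp mm nu * ?H lp mm)"
        unfolding sum_distrib_left
      proof (intro sum.cong refl)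
        fix lp mm assume lp: "lp \<in> ?A i" and mm: "mm \<in> ?B i"
        have "hl_inner (Pt lp) (Qv mm * Qv ka) = ?H lp mm"
          using lp mm ka skewP_properties(2) [of lp mm ka] by (simp add: mult.commute)
        then have "hs lp lam * (?K mm * hl_inner (Pt lp) (Qv mm * Qv ka)) =
          (\<Sum>nu\<in>between mu mm. hs lp lam * ((-1) ^ (psize mu - psize nu) * tt ^ (psize nu - psize mm) * vs mu nu * sk nu mm) * ?H lp mm)"
          by (simp only: sum_distrib_left sum_distrib_right mult.assoc)
        also have "\<dots> = (\<Sum>nu\<in>between mu mm. C lp mm nu * ?H lp mm)"
          using mm sign by (intro sum.cong refl) simp
        finally show "hs lp lam * (?K mm * hl_inner (Pt lp) (Qv mm * Qv ka)) =
          (\<Sum>nu\<in>between mu mm. C lp mm nu * ?H lp mm)" .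
      qed
      finally show "hl_inner (qg i * Pt lam) (Rop (r - i) (Qv mu) * Qv ka) =
        (\<Sum>lp\<in>?A i. \<Sum>mm\<in>?B i. \<Sum>nu\<in>between mu mm. C lp mm nu * ?H lp mm)" .
    qed
    also have "\<dots> = (\<Sum>(i, lp, mm, nu)\<in>Sigma {..r} (\<lambda>i. Sigma (?A i) (\<lambda>lp. Sigma (?B i) (\<lambda>mm. between mu mm))).
        C lp mm nu * ?H lp mm)"
      using finA finB finC by (simp add: sum.Sigma finite_SigmaI)
    \<comment> \<open>The index i is recovered as the size of lp/lam, and the size condition on mm
      then becomes the condition that the two sizes add up to r.\<close>
    also have "\<dots> = (\<Sum>(lp, mm, nu)\<in>?T. C lp mm nu * ?H lp mm)"
    proof (rule sum.reindex_bij_witness [where i = "\<lambda>(lp, mm, nu). (psize lp - psize lam, lp, mm, nu)"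
          and j = "\<lambda>(i, lp, mm, nu). (lp, mm, nu)"])
      fix p assume p: "p \<in> ?T"
      then obtain lp mm nu where e: "p = (lp, mm, nu)" "is_partition lp" "is_partition mm" "is_partition nu"
        "contained lam lp" "contained mm nu" "contained nu mu"
        "(psize lp - psize lam) + (psize mu - psize mm) = r" by auto
      have "psize lam \<le> psize lp" using contained_psize [OF assms(1) e(2,5)] .
      moreover have "contained mm mu" using contained_trans [OF e(6,7)] .
      ultimately show "(case p of (lp, mm, nu) \<Rightarrow> (psize lp - psize lam, lp, mm, nu)) \<in>
          Sigma {..r} (\<lambda>i. Sigma (?A i) (\<lambda>lp. Sigma (?B i) (\<lambda>mm. between mu mm)))"
        using e by auto
    qed auto
    also have "\<dots> = hl_inner ?R (Qv ka)"
      unfolding hl_sum_left by (rule sum.cong) (auto simp: hl_cst_left)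
    finally show "hl_inner (skewP lam mu * qr r - ?R) (Qv ka) = 0" by (simp add: hl_diff_left)
  qed
  then show ?thesis unfolding C_def by simp
qed

end
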